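(* Assume (R) and (Q) from the context. For all integers $k,\ell\ge1$ with $k,\ell\le r_{\mathrm{loc}}(\theta^\star)$, every $h\in U_k$ and every $g\in U_\ell$, as $\mathrm{SNR}=\beta^2/\sigma^2\to0$ (with $\sigma$ fixed and $\beta\to0^+$), $$\big\langle h,\mathcal I_{\mathrm{obs}}^{(W)}(\theta^\star;\beta)g\big\rangle=\begin{cases}\dfrac{\mathrm{SNR}^k}{k!}\big\langle DT_k(\theta^\star)[h],DT_k(\theta^\star)[g]\big\rangle_F+O(\mathrm{SNR}^{k+1}),&k=\ell,\\[1.5ex] O\bigl(\mathrm{SNR}^{(k+\ell+1)/2}\bigr),&|k-\ell|=1,\\[1ex] O\bigl(\mathrm{SNR}^{(k+\ell+2)/2}\bigr),&|k-\ell|\ge2.\end{cases}$$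
   Context: Model. Fix integers $d,m\ge 1$ and $\sigma>0$. Let $(\mathcal Z,\mathcal F,\mu)$ be a probability space, $A:\mathcal Z\to\mathbb R^{d\times m}$ measurable, and $\Theta\subset\mathbb R^m$ a $C^2$ embedded submanifold of dimension $m$ (boundary allowed), with $\theta^\star$ an interior point of $\Theta$. For $\theta\in\mathbb R^m$, $\beta\ge0$ let $p_{\theta,\beta}(y)=\int_{\mathcal Z}\varphi_\sigma(y-\beta A(z)\theta)\,\mu(dz)$, where $\varphi_\sigma$ is the density of $\mathcal N(0,\sigma^2I_d)$. (R) $\Theta$ is compact; $\|A(z)\|_{\mathrm{op}}\le a_{\max}<\infty$ for $\mu$-a.e. $z$; and $\mathbb E_{Z\sim\mu}[A(Z)^\top A(Z)]$ is positive definite. Equivalence. $\theta\sim\theta'$ (for $\theta,\theta'\in\Theta$) if $A(Z)\theta$ and $A(Z)\theta'$ have the same law under $Z\sim\mu$. $[\theta]=\{\theta'\in\Theta:\theta'\sim\theta\}$. (Q) There is an open neighborhood $U_\star\subset\Theta$ of $\theta^\star$ such that $U_\star/{\sim}$ admits a $C^2$ manifold structure for which the canonical projection $U_\star\to U_\star/{\sim}$ is a $C^2$ submersion. $T(\theta^\star)$ is the tangent space at $\theta^\star$ to $[\theta^\star]$ (velocities at $0$ of $C^1$ curves in $[\theta^\star]$ through $\theta^\star$ at time $0$), and $W=T(\theta^\star)^\perp\subset\mathbb R^m$. Fisher information. $\mathcal I_{\mathrm{obs}}(\theta;\beta)=\mathbb E_{Y\sim p_{\theta,\beta}}[\nabla_\theta\log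 p_{\theta,\beta}(Y)\nabla_\theta\log p_{\theta,\beta}(Y)^\top]$; $\mathcal I^{(W)}_{\mathrm{obs}}(\theta^\star;\beta):W\to W$ is the self-adjoint operator with $\langle h,\mathcal I^{(W)}_{\mathrm{obs}}(\theta^\star;\beta)g\rangle=h^\top\mathcal I_{\mathrm{obs}}(\theta^\star;\beta)g$ for $h,g\in W$. Moments and layers. $T_k(\theta)=\mathbb E_{Z\sim\mu}[(A(Z)\theta)^{\otimes k}]\in(\mathbb R^d)^{\otimes k}$ for $\theta\in\mathbb R^m$, $k\ge1$; $DT_k(\theta^\star)[h]$ is its derivative at $\theta^\star$ in direction $h$; $\langle\cdot,\cdot\rangle_F$ is the Frobenius (entrywise) inner product of tensors. For $h\in W\setminus\{0\}$, $r(h)=\min\{j\ge1:DT_j(\theta^\star)[h]\ne0\}$ ($=\infty$ if none), and $r_{\mathrm{loc}}(\theta^\star)=\max_{h\in W\setminus\{0\}}r(h)\in\{1,2,\dots\}\cup\{\infty\}$. Moment filtration: $V_1=W$ and $V_k=\{h\in W:DT_j(\theta^\star)[h]=0\ \text{for all }j<k\}$ for $k\ge2$. Informative layers: $U_k=V_k\cap V_{k+1}^\perp$ (Euclidean orthogonality). *)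

theory Defs
  imports "HOL-Probability.Probability" "HOL-Library.Landau_Symbols"
begin

section \<open>Submanifolds, quotient manifolds and submersions of class $C^2$\<close>

text \<open>
  Derivatives are taken within \<open>S\<close>, so that the same notion serves for open sets and for
  relatively open subsets of a linear subspace \<open>E\<close>.  In the second case \<open>f'\<close> and \<open>f''\<close> are only
  determined on \<open>E\<close>, but precomposing with the orthogonal projection onto \<open>E\<close> shows that they
  can be found iff \<open>f\<close> is $C^2$ in the usual sense as a map on an open subset of the vector
  space \<open>E\<close>.
\<close>

definition C2_on :: "('a::real_normed_vector \<Rightarrow> 'b::real_normed_vector) \<Rightarrow> 'a set \<Rightarrow> bool" where
  "C2_on f S \<longleftrightarrow>
     (\<exists>(f' :: 'a \<Rightarrow> 'a \<Rightarrow>\<^sub>L 'b) (f'' :: 'a \<Rightarrow> 'a \<Rightarrow>\<^sub>L ('a \<Rightarrow>\<^sub>L 'b)).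
        (\<forall>x\<in>S. (f has_derivative blinfun_apply (f' x)) (at x within S)) \<and>
        (\<forall>x\<in>S. (f' has_derivative blinfun_apply (f'' x)) (at x within S)) \<and>
        continuous_on S f'')"

definition C2_diffeo :: "'a::real_normed_vector set \<Rightarrow> 'a set \<Rightarrow> ('a \<Rightarrow> 'a) \<Rightarrow> ('a \<Rightarrow> 'a) \<Rightarrow> bool" where
  "C2_diffeo U V \<phi> \<psi> \<longleftrightarrow> homeomorphism U V \<phi> \<psi> \<and> C2_on \<phi> U \<and> C2_on \<psi> V"

text \<open>
  A full-dimensional embedded submanifold, boundary allowed: locally flattened onto a half-space.
  Points without boundary nearby are covered by taking \<open>V\<close> inside the open half-space.
\<close>

definition C2_full_dim_submanifold :: "(real^'m) set \<Rightarrow> bool" where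
  "C2_full_dim_submanifold S \<longleftrightarrow>
     (\<forall>p\<in>S. \<exists>U V \<phi> \<psi> i. open U \<and> open V \<and> p \<in> U \<and> C2_diffeo U V \<phi> \<psi> \<and>
        \<phi> ` (U \<inter> S) = V \<inter> {x. 0 \<le> x $ i})"

text \<open>A chart is a pair of its domain and its coordinate map, with values in the vector space \<open>E\<close>.\<close>

definition C2_atlas :: "'q topology \<Rightarrow> 'e::euclidean_space set \<Rightarrow> ('q set \<times> ('q \<Rightarrow> 'e)) set \<Rightarrow> bool" where
  "C2_atlas X E \<A> \<longleftrightarrow>
     (\<Union>(D, c)\<in>\<A>. D) = topspace X \<and>
     (\<forall>(D, c)\<in>\<A>. openin X D \<and> openin (top_of_set E) (c ` D) \<and>
        homeomorphic_map (subtopology X D) (top_of_set (c ` D)) c) \<and>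
     (\<forall>(D, c)\<in>\<A>. \<forall>(D', c')\<in>\<A>. C2_on (c' \<circ> inv_into D c) (c ` (D \<inter> D')))"

definition C2_manifold :: "'q topology \<Rightarrow> 'e::euclidean_space set \<Rightarrow> ('q set \<times> ('q \<Rightarrow> 'e)) set \<Rightarrow> bool" where
  "C2_manifold X E \<A> \<longleftrightarrow>
     subspace E \<and> Hausdorff_space X \<and> second_countable X \<and> C2_atlas X E \<A>"

definition C2_submersion ::
  "'a::euclidean_space set \<Rightarrow> 'q topology \<Rightarrow> 'e::euclidean_space set \<Rightarrow> ('q set \<times> ('q \<Rightarrow> 'e)) set \<Rightarrow>
   ('a \<Rightarrow> 'q) \<Rightarrow> bool" where
  "C2_submersion U X E \<A> \<pi> \<longleftrightarrow>
     continuous_map (top_of_set U) X \<pi> \<and>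
     (\<forall>(D, c)\<in>\<A>. C2_on (c \<circ> \<pi>) {x \<in> U. \<pi> x \<in> D} \<and>
        (\<forall>x\<in>U. \<pi> x \<in> D \<longrightarrow> range (frechet_derivative (c \<circ> \<pi>) (at x)) = E))"

section \<open>The model and its Fisher information\<close>

definition gauss_density :: "real \<Rightarrow> real^'d \<Rightarrow> real" where
  "gauss_density \<sigma> x = exp (- (norm x)\<^sup>2 / (2 * \<sigma>\<^sup>2)) / sqrt (2 * pi * \<sigma>\<^sup>2) ^ CARD('d)"

definition obs_density ::
  "'z measure \<Rightarrow> ('z \<Rightarrow> real^'m^'d) \<Rightarrow> real \<Rightarrow> real^'m \<Rightarrow> real \<Rightarrow> real^'d \<Rightarrow> real" where
  "obs_density M A \<sigma> \<theta> \<beta> y = (LINT z|M. gauss_density \<sigma> (y - \<beta> *\<^sub>R (A z *v \<theta>)))"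

definition gradient :: "('a::real_inner \<Rightarrow> real) \<Rightarrow> 'a \<Rightarrow> 'a" where
  "gradient f x = (THE D. GDERIV f x :> D)"

definition score ::
  "'z measure \<Rightarrow> ('z \<Rightarrow> real^'m^'d) \<Rightarrow> real \<Rightarrow> real^'m \<Rightarrow> real \<Rightarrow> real^'d \<Rightarrow> real^'m" where
  "score M A \<sigma> \<theta> \<beta> y = gradient (\<lambda>\<theta>'. ln (obs_density M A \<sigma> \<theta>' \<beta> y)) \<theta>"

definition fisher_obs ::
  "'z measure \<Rightarrow> ('z \<Rightarrow> real^'m^'d) \<Rightarrow> real \<Rightarrow> real^'m \<Rightarrow> real \<Rightarrow> real^'m^'m" where
  "fisher_obs M A \<sigma> \<theta> \<beta> =
     (LINT y|density lborel (\<lambda>y. ennreal (obs_density M A \<sigma> \<theta> \<beta> y)).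
        (\<chi> i j. score M A \<sigma> \<theta> \<beta> y $ i * score M A \<sigma> \<theta> \<beta> y $ j))"

text \<open>The operator on \<open>W\<close> representing the restriction of the Fisher information form to \<open>W\<close>.\<close>

definition fisher_obs_on ::
  "'z measure \<Rightarrow> ('z \<Rightarrow> real^'m^'d) \<Rightarrow> real \<Rightarrow> (real^'m) set \<Rightarrow> real^'m \<Rightarrow> real \<Rightarrow> real^'m \<Rightarrow> real^'m" where
  "fisher_obs_on M A \<sigma> W \<theta> \<beta> g =
     (THE u. u \<in> W \<and> (\<forall>h\<in>W. h \<bullet> u = h \<bullet> (fisher_obs M A \<sigma> \<theta> \<beta> *v g)))"

definition snr :: "real \<Rightarrow> real \<Rightarrow> real" where
  "snr \<sigma> \<beta> = \<beta>\<^sup>2 / \<sigma>\<^sup>2"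

definition condition_R :: "'z measure \<Rightarrow> ('z \<Rightarrow> real^'m^'d) \<Rightarrow> (real^'m) set \<Rightarrow> bool" where
  "condition_R M A S \<longleftrightarrow>
     compact S \<and>
     (\<exists>a_max. AE z in M. onorm (\<lambda>v. A z *v v) \<le> a_max) \<and>
     (\<forall>v. v \<noteq> 0 \<longrightarrow> v \<bullet> ((LINT z|M. transpose (A z) ** A z) *v v) > 0)"

section \<open>Equivalence of parameters, tangent and normal space\<close>

definition same_law :: "'z measure \<Rightarrow> ('z \<Rightarrow> real^'m^'d) \<Rightarrow> real^'m \<Rightarrow> real^'m \<Rightarrow> bool" where
  "same_law M A \<theta> \<theta>' \<longleftrightarrow> distr M borel (\<lambda>z. A z *v \<theta>) = distr M borel (\<lambda>z. A z *v \<theta>')"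

definition param_rel :: "'z measure \<Rightarrow> ('z \<Rightarrow> real^'m^'d) \<Rightarrow> (real^'m) set \<Rightarrow> ((real^'m) \<times> (real^'m)) set" where
  "param_rel M A S = {(\<theta>, \<theta>'). \<theta> \<in> S \<and> \<theta>' \<in> S \<and> same_law M A \<theta> \<theta>'}"

definition param_class :: "'z measure \<Rightarrow> ('z \<Rightarrow> real^'m^'d) \<Rightarrow> (real^'m) set \<Rightarrow> real^'m \<Rightarrow> (real^'m) set" where
  "param_class M A S \<theta> = param_rel M A S `` {\<theta>}"

text \<open>
  A $C^2$ submersion from an open subset of \<^typ>\<open>real^'m\<close> forces the dimension of its target to be
  at most \<^term>\<open>CARD('m)\<close>.  Hence linear subspaces \<open>E\<close> of \<^typ>\<open>real^'m\<close> provide all possible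
  model spaces for the quotient manifold, whose dimension is otherwise unrestricted.
\<close>

definition condition_Q ::
  "'z measure \<Rightarrow> ('z \<Rightarrow> real^'m^'d) \<Rightarrow> (real^'m) set \<Rightarrow> real^'m \<Rightarrow> bool" where
  "condition_Q M A S \<theta>s \<longleftrightarrow>
     (\<exists>(U :: (real^'m) set) (X :: (real^'m) set topology) (E :: (real^'m) set) \<A>.
        open U \<and> \<theta>s \<in> U \<and> U \<subseteq> S \<and>
        topspace X = U // param_rel M A U \<and>
        C2_manifold X E \<A> \<and>
        C2_submersion U X E \<A> (\<lambda>\<theta>. param_rel M A U `` {\<theta>}))"

definition class_tangent ::
  "'z measure \<Rightarrow> ('z \<Rightarrow> real^'m^'d) \<Rightarrow> (real^'m) set \<Rightarrow> real^'m \<Rightarrow> (real^'m) set" where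
  "class_tangent M A S \<theta> =
     {v. \<exists>\<gamma> \<epsilon>. \<epsilon> > 0 \<and> \<gamma> C1_differentiable_on {-\<epsilon><..<\<epsilon>} \<and> \<gamma> ` {-\<epsilon><..<\<epsilon>} \<subseteq> param_class M A S \<theta> \<and>
          \<gamma> 0 = \<theta> \<and> (\<gamma> has_vector_derivative v) (at 0)}"

definition class_normal ::
  "'z measure \<Rightarrow> ('z \<Rightarrow> real^'m^'d) \<Rightarrow> (real^'m) set \<Rightarrow> real^'m \<Rightarrow> (real^'m) set" where
  "class_normal M A S \<theta> = (class_tangent M A S \<theta>)\<^sup>\<bottom>"

section \<open>Moment tensors and informative layers\<close>

text \<open>
  A tensor in $(\mathbb R^d)^{\otimes k}$ is its family of entries, indexed by the multi-indices of
  length \<open>k\<close> and extended by \<open>0\<close> to all other lists; the zero tensor is \<open>\<lambda>_. 0\<close>.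
\<close>

definition tensor_power :: "nat \<Rightarrow> real^'d \<Rightarrow> 'd list \<Rightarrow> real" where
  "tensor_power k v is = (if length is = k then (\<Prod>i\<leftarrow>is. v $ i) else 0)"

definition frobenius :: "nat \<Rightarrow> ('d::finite list \<Rightarrow> real) \<Rightarrow> ('d list \<Rightarrow> real) \<Rightarrow> real" where
  "frobenius k S T = (\<Sum>is | length is = k. S is * T is)"

definition moment :: "'z measure \<Rightarrow> ('z \<Rightarrow> real^'m^'d) \<Rightarrow> nat \<Rightarrow> real^'m \<Rightarrow> 'd list \<Rightarrow> real" where
  "moment M A k \<theta> is = (LINT z|M. tensor_power k (A z *v \<theta>) is)"

text \<open>The derivative of the tensor-valued map \<open>moment M A k\<close>, taken entry by entry.\<close>

definition dmoment ::
  "'z measure \<Rightarrow> ('z \<Rightarrow> real^'m^'d) \<Rightarrow> nat \<Rightarrow> real^'m \<Rightarrow> real^'m \<Rightarrow> 'd list \<Rightarrow> real" where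
  "dmoment M A k \<theta> h is = frechet_derivative (\<lambda>\<theta>'. moment M A k \<theta>' is) (at \<theta>) h"

text \<open>In \<^typ>\<open>enat\<close>, the infimum of a nonempty set is its minimum, and \<^term>\<open>Inf {} = (\<infinity>::enat)\<close>.\<close>

definition first_order :: "'z measure \<Rightarrow> ('z \<Rightarrow> real^'m^'d) \<Rightarrow> real^'m \<Rightarrow> real^'m \<Rightarrow> enat" where
  "first_order M A \<theta> h = (INF j\<in>{j. 1 \<le> j \<and> dmoment M A j \<theta> h \<noteq> (\<lambda>_. 0)}. enat j)"

text \<open>
  The supremum is attained if the normal space is nonzero, since the subspaces on which the first
  moment derivatives vanish can shrink only finitely often.  For a zero normal space it is \<open>0\<close>.
\<close>

definition r_loc :: "'z measure \<Rightarrow> ('z \<Rightarrow> real^'m^'d) \<Rightarrow> (real^'m) set \<Rightarrow> real^'m \<Rightarrow> enat" where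
  "r_loc M A S \<theta> = (SUP h\<in>class_normal M A S \<theta> - {0}. first_order M A \<theta> h)"

definition filtration ::
  "'z measure \<Rightarrow> ('z \<Rightarrow> real^'m^'d) \<Rightarrow> (real^'m) set \<Rightarrow> real^'m \<Rightarrow> nat \<Rightarrow> (real^'m) set" where
  "filtration M A S \<theta> k =
     {h \<in> class_normal M A S \<theta>. \<forall>j. 1 \<le> j \<and> j < k \<longrightarrow> dmoment M A j \<theta> h = (\<lambda>_. 0)}"

definition layer ::
  "'z measure \<Rightarrow> ('z \<Rightarrow> real^'m^'d) \<Rightarrow> (real^'m) set \<Rightarrow> real^'m \<Rightarrow> nat \<Rightarrow> (real^'m) set" where
  "layer M A S \<theta> k = filtration M A S \<theta> k \<inter> (filtration M A S \<theta> (k + 1))\<^sup>\<bottom>"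

end

theory Submission
  imports Defs
begin

text \<open>
  After division by the centred Gaussian density the likelihood is
  \<open>q = E (exp (\<beta> (y \<bullet> x) / \<sigma>\<^sup>2 - \<beta>\<^sup>2 |x|\<^sup>2 / (2 \<sigma>\<^sup>2)))\<close> with \<open>x = A(Z) \<theta>\<close>, and the Fisher form in
  directions \<open>h\<close>, \<open>g\<close> is the Gaussian integral of \<open>a b / q\<close>, where \<open>a\<close>, \<open>b\<close> are the directional
  derivatives of \<open>q\<close>.  Write \<open>1 / q = 2 - q + (q - 1)\<^sup>2 / q\<close>.

  The integrals of \<open>a b\<close> and of \<open>a b q\<close> are explicit: three independent copies \<open>u\<close>, \<open>v\<close>, \<open>w\<close> of
  \<open>x\<close> turn them into the mixed derivative, in \<open>u\<close> along \<open>h\<close> and in \<open>v\<close> along \<open>g\<close>, of the expectation of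
  \<open>exp (s (u \<bullet> v + u \<bullet> w + v \<bullet> w))\<close> with \<open>s = \<beta>\<^sup>2 / \<sigma>\<^sup>2\<close> (and \<open>w = 0\<close> in the first case), a power
  series in \<open>s\<close>.  If the first moment derivatives along \<open>h\<close> vanish up to order \<open>k - 1\<close>, then differentiating
  along \<open>h\<close> kills all polynomials in \<open>u\<close> of degree below \<open>k\<close>.  Hence the series starts at order
  \<open>max k l\<close>, and for \<open>k = l\<close> only \<open>(u \<bullet> v)\<^sup>k\<close> survives in the leading coefficient.  As the series is one in
  \<open>s\<close> rather than in \<open>\<beta>\<close>, no parity argument is needed.

  The same vanishing gives \<open>a = O(\<beta>\<^sup>k)\<close> and \<open>b = O(\<beta>\<^sup>l)\<close> pointwise, up to factors of exponential growth in
  \<open>y\<close>, and \<open>q - 1 = O(\<beta>)\<close>, so the last term contributes \<open>O(\<beta>\<^bsup>k+l+2\<^esup>)\<close>.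
\<close>

section \<open>Gaussian integrals\<close>

text \<open>\<open>lborel_eq\<close> presents Lebesgue measure as the image of a product of
  one-dimensional ones, where functions of product form integrate factor by factor. This reduces
  Gaussian moments to those of \<open>normal_density\<close>.\<close>

lemma
  fixes f :: "'a::euclidean_space \<Rightarrow> real \<Rightarrow> real"
  assumes f: "\<And>b. b \<in> Basis \<Longrightarrow> integrable lborel (f b)"
  shows integrable_lborel_prod: "integrable lborel (\<lambda>x. \<Prod>b\<in>Basis. f b (x \<bullet> b))"
    and integral_lborel_prod:
      "(LINT x|lborel. (\<Prod>b\<in>Basis. f b (x \<bullet> b))) = (\<Prod>b\<in>Basis. (LINT t|lborel. f b t))"
proof -
  interpret product_sigma_finite "\<lambda>_::'a. lborel :: real measure"
    by unfold_locales
  have [measurable]: "f b \<in> borel_measurable borel" if "b \<in> Basis" for b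
    using f[OF that] by simp
  have eq: "(\<Prod>b\<in>Basis. f b ((\<Sum>c\<in>Basis. g c *\<^sub>R c) \<bullet> b)) = (\<Prod>b\<in>Basis. f b (g b))" for g :: "'a \<Rightarrow> real"
    by (intro prod.cong refl) simp
  have m: "(\<lambda>x. \<Prod>b\<in>Basis. f b (x \<bullet> b)) \<in> borel_measurable (borel :: 'a measure)"
    by measurable
  show "integrable lborel (\<lambda>x. \<Prod>b\<in>Basis. f b (x \<bullet> b))"
    unfolding lborel_eq[where 'a='a]
    using product_integrable_prod[of Basis f] f
    by (subst integrable_distr_eq) (use m in \<open>auto simp: eq\<close>)
  show "(LINT x|lborel. (\<Prod>b\<in>Basis. f b (x \<bullet> b))) = (\<Prod>b\<in>Basis. (LINT t|lborel. f b t))"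
    unfolding lborel_eq[where 'a='a]
    using product_integral_prod[of Basis f] f
    by (subst integral_distr) (use m in \<open>auto simp: eq\<close>)
qed

lemma gauss_density_eq_prod:
  "gauss_density \<sigma> x = (\<Prod>b\<in>Basis. normal_density 0 \<sigma> (x \<bullet> b))"
proof -
  have "(norm x)\<^sup>2 = (\<Sum>b\<in>Basis. (x \<bullet> b)\<^sup>2)"
    by (subst euclidean_inner[of x x, folded power2_norm_eq_inner]) (simp add: power2_eq_square)
  then have "- (norm x)\<^sup>2 / (2 * \<sigma>\<^sup>2) = (\<Sum>b\<in>Basis. - (x \<bullet> b)\<^sup>2 / (2 * \<sigma>\<^sup>2))"
    by (simp add: sum_negf sum_divide_distrib)
  then show ?thesis
    unfolding gauss_density_def normal_density_def
    by (simp add: exp_sum prod_dividef power_divide)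
qed

lemma gauss_density_pos: "\<sigma> > 0 \<Longrightarrow> gauss_density \<sigma> x > 0"
  unfolding gauss_density_def by (simp add: zero_less_power)

lemma gauss_density_measurable [measurable]: "gauss_density \<sigma> \<in> borel_measurable borel"
  unfolding gauss_density_def by measurable

lemma gauss_density_minus [simp]: "gauss_density \<sigma> (- x) = gauss_density \<sigma> x"
  by (simp add: gauss_density_def)

lemma
  assumes \<sigma>: "\<sigma> > 0"
  shows gauss_integrable: "integrable lborel (gauss_density \<sigma> :: real^'d \<Rightarrow> real)"
    and gauss_integral: "(LINT x|lborel. gauss_density \<sigma> (x :: real^'d)) = 1"
proof -
  show "integrable lborel (gauss_density \<sigma> :: real^'d \<Rightarrow> real)"
    unfolding gauss_density_eq_prod by (intro integrable_lborel_prod) (use \<sigma> in auto)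
  show "(LINT x|lborel. gauss_density \<sigma> (x :: real^'d)) = 1"
    unfolding gauss_density_eq_prod by (subst integral_lborel_prod) (use \<sigma> in auto)
qed

text \<open>The coordinates are independent centred normal variables, so the mixed moment factors;
  for distinct \<open>b\<close> and \<open>c\<close> one of the factors is an odd moment.\<close>

lemma has_integral_gauss_coord:
  fixes b c :: "real^'d"
  assumes \<sigma>: "\<sigma> > 0" and b: "b \<in> Basis" and c: "c \<in> Basis"
  shows "has_bochner_integral lborel (\<lambda>x. gauss_density \<sigma> x * ((x \<bullet> b) * (x \<bullet> c)))
      (if b = c then \<sigma>\<^sup>2 else 0)"
proof -
  \<comment> \<open>\<open>n e\<close> is the exponent of coordinate \<open>e\<close> in
    \<open>(x \<bullet> b) * (x \<bullet> c)\<close>: \<open>2\<close> at \<open>b\<close> if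
    \<open>b = c\<close>, otherwise \<open>1\<close> at each of \<open>b\<close> and
    \<open>c\<close>, and \<open>0\<close> elsewhere.\<close>
  define n where "n e = (if e = b then 1 else 0) + (if e = c then 1 else 0 :: nat)" for e
  define f where "f e t = normal_density 0 \<sigma> t * t ^ n e" for e and t :: real
  have int: "integrable lborel (f e)" for e
    unfolding f_def using integrable_normal_moment[OF \<sigma>, of 0 "n e"] by simp
  have "(\<Prod>e\<in>Basis. (x \<bullet> e) ^ n e) = (x \<bullet> b) * (x \<bullet> c)" for x :: "real^'d"
    using b c by (simp add: n_def power_add prod.distrib if_distrib[of "power _"] prod.delta' cong: if_cong)
  then have eq: "gauss_density \<sigma> x * ((x \<bullet> b) * (x \<bullet> c)) = (\<Prod>e\<in>Basis. f e (x \<bullet> e))" for x :: "real^'d"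
    by (simp add: f_def prod.distrib gauss_density_eq_prod)
  have m0: "(LINT t|lborel. normal_density 0 \<sigma> t) = 1" using \<sigma> by simp
  have m1: "(LINT t|lborel. normal_density 0 \<sigma> t * t) = 0"
    using integral_normal_moment_odd[OF \<sigma>, of 0 0] by simp
  have m2: "(LINT t|lborel. normal_density 0 \<sigma> t * t\<^sup>2) = \<sigma>\<^sup>2"
    using integral_normal_moment_even[OF \<sigma>, of 0 1] by (simp add: fact_numeral)
  have "(\<Prod>e\<in>Basis. (LINT t|lborel. f e t)) = (if b = c then \<sigma>\<^sup>2 else 0)"
  proof (cases "b = c")
    case True
    have "(LINT t|lborel. f e t) = (if e = b then \<sigma>\<^sup>2 else 1)" for e
      using True m0 m2 by (auto simp: f_def n_def numeral_2_eq_2)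
    then show ?thesis using True b by simp
  next
    case False
    have "(LINT t|lborel. f b t) = 0"
      using False m1 by (simp add: f_def n_def)
    then show ?thesis using False b by (subst prod_zero) auto
  qed
  then show ?thesis
    unfolding eq has_bochner_integral_iff
    using integrable_lborel_prod[of f, OF int] integral_lborel_prod[of f, OF int] by simp
qed

lemma gauss_second_moment:
  fixes p q :: "real^'d"
  assumes \<sigma>: "\<sigma> > 0"
  shows "has_bochner_integral lborel (\<lambda>x. gauss_density \<sigma> x * ((x \<bullet> p) * (x \<bullet> q))) (\<sigma>\<^sup>2 * (p \<bullet> q))"
proof -
  have eq: "gauss_density \<sigma> x * ((x \<bullet> p) * (x \<bullet> q)) =
     (\<Sum>b\<in>Basis. \<Sum>c\<in>Basis. (gauss_density \<sigma> x * ((x \<bullet> b) * (x \<bullet> c))) * ((p \<bullet> b) * (q \<bullet> c)))" for x :: "real^'d"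
  proof -
    have "(x \<bullet> p) * (x \<bullet> q) = (\<Sum>b\<in>Basis. \<Sum>c\<in>Basis. (x \<bullet> b * (p \<bullet> b)) * (x \<bullet> c * (q \<bullet> c)))"
      unfolding euclidean_inner[of x p] euclidean_inner[of x q] by (rule sum_product)
    then have "gauss_density \<sigma> x * ((x \<bullet> p) * (x \<bullet> q)) =
        (\<Sum>b\<in>Basis. \<Sum>c\<in>Basis. gauss_density \<sigma> x * ((x \<bullet> b * (p \<bullet> b)) * (x \<bullet> c * (q \<bullet> c))))"
      by (simp only: sum_distrib_left)
    then show ?thesis by (simp only: mult_ac)
  qed
  have "has_bochner_integral lborel (\<lambda>x. gauss_density \<sigma> x * ((x \<bullet> p) * (x \<bullet> q)))
     (\<Sum>b\<in>Basis. \<Sum>c\<in>Basis. (if b = c then \<sigma>\<^sup>2 else 0) * ((p \<bullet> b) * (q \<bullet> c)))"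
    unfolding eq
    by (intro has_bochner_integral_sum has_bochner_integral_mult_left has_integral_gauss_coord \<sigma>)
  also have "(\<Sum>b\<in>Basis. \<Sum>c\<in>Basis. (if b = c then \<sigma>\<^sup>2 else 0) * ((p \<bullet> b) * (q \<bullet> c))) = \<sigma>\<^sup>2 * (p \<bullet> q)"
    by (subst euclidean_inner[of p q])
       (simp add: sum_distrib_left if_distrib[of "\<lambda>x. x * _"] cong: if_cong)
  finally show ?thesis .
qed

text \<open>Completing a square bounds the integrand by a multiple of the Gaussian density with
  doubled variance.\<close>

lemma gauss_exp_integrable:
  fixes C :: real
  assumes \<sigma>: "\<sigma> > 0"
  shows "integrable lborel (\<lambda>x::real^'d. gauss_density \<sigma> x * exp (C * norm x))"
proof -
  \<comment> \<open>Doubling the variance keeps half of the quadratic exponent; the other half,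
    \<open>(norm x)\<^sup>2 / (4 * \<sigma>\<^sup>2)\<close>, absorbs \<open>C * norm x\<close> up
    to the constant \<open>C\<^sup>2 * \<sigma>\<^sup>2\<close>.\<close>
  define \<tau> where "\<tau> = sqrt 2 * \<sigma>"
  have \<tau>: "\<tau> > 0" "\<tau>\<^sup>2 = 2 * \<sigma>\<^sup>2" using \<sigma> by (auto simp: \<tau>_def power_mult_distrib)
  define K where "K = exp (C\<^sup>2 * \<sigma>\<^sup>2) * sqrt (2 * pi * \<tau>\<^sup>2) ^ CARD('d) / sqrt (2 * pi * \<sigma>\<^sup>2) ^ CARD('d)"
  have bd: "gauss_density \<sigma> x * exp (C * norm x) \<le> K * gauss_density \<tau> x" for x :: "real^'d"
  proof -
    have "0 \<le> (norm x / (2 * \<sigma>) - C * \<sigma>)\<^sup>2" by simp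
    also have "\<dots> = (norm x)\<^sup>2 / (4 * \<sigma>\<^sup>2) - C * norm x + C\<^sup>2 * \<sigma>\<^sup>2"
      using \<sigma> by (simp add: power2_eq_square field_simps)
    finally have "- (norm x)\<^sup>2 / (2 * \<sigma>\<^sup>2) + C * norm x \<le> C\<^sup>2 * \<sigma>\<^sup>2 + - (norm x)\<^sup>2 / (2 * \<tau>\<^sup>2)"
      unfolding \<tau>(2) by simp
    then have "exp (- (norm x)\<^sup>2 / (2 * \<sigma>\<^sup>2)) * exp (C * norm x)
       \<le> exp (C\<^sup>2 * \<sigma>\<^sup>2) * exp (- (norm x)\<^sup>2 / (2 * \<tau>\<^sup>2))"
      by (simp flip: exp_add)
    then show ?thesis
      unfolding gauss_density_def K_def using \<sigma> \<tau>(1)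
      by (simp add: field_simps)
  qed
  show ?thesis
  proof (rule Bochner_Integration.integrable_bound)
    show "integrable lborel (\<lambda>x::real^'d. K * gauss_density \<tau> x)"
      by (intro integrable_mult_right gauss_integrable \<tau>(1))
    show "AE x in lborel. norm (gauss_density \<sigma> x * exp (C * norm x)) \<le> norm (K * gauss_density \<tau> (x::real^'d))"
    proof (intro AE_I2)
      fix x :: "real^'d"
      have "0 \<le> gauss_density \<sigma> x * exp (C * norm x)"
        using gauss_density_pos[OF \<sigma>, of x] by simp
      then show "norm (gauss_density \<sigma> x * exp (C * norm x)) \<le> norm (K * gauss_density \<tau> x)"
        using bd[of x] by simp
    qed
  qed measurable
qed

section \<open>Reflected, shifted and tilted Gaussians\<close>

lemma lborel_eq_uminus: "(lborel :: 'a::euclidean_space measure) = distr lborel borel uminus"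
  using lborel_affine[of "-1" "0::'a"] by (simp add: density_1 one_ennreal_def[symmetric])

text \<open>The log density ratio at \<open>y\<close> between the Gaussians centred at
  \<open>\<beta> *\<^sub>R u\<close> and at \<open>0\<close>, see
  \<open>gauss_density_shift\<close>.\<close>

definition tilt :: "real \<Rightarrow> real \<Rightarrow> real^'d \<Rightarrow> real^'d \<Rightarrow> real" where
  "tilt \<sigma> \<beta> y u = \<beta> * (y \<bullet> u) / \<sigma>\<^sup>2 - \<beta>\<^sup>2 * (u \<bullet> u) / (2 * \<sigma>\<^sup>2)"

text \<open>The derivative of \<open>tilt\<close> in \<open>u\<close> along
  \<open>u'\<close>.\<close>

definition dtilt :: "real \<Rightarrow> real \<Rightarrow> real^'d \<Rightarrow> real^'d \<Rightarrow> real^'d \<Rightarrow> real" where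
  "dtilt \<sigma> \<beta> y u u' = \<beta> * (y \<bullet> u') / \<sigma>\<^sup>2 - \<beta>\<^sup>2 * (u \<bullet> u') / \<sigma>\<^sup>2"

lemma gauss_density_shift:
  assumes "\<sigma> > 0"
  shows "gauss_density \<sigma> (y - \<beta> *\<^sub>R u) = gauss_density \<sigma> y * exp (tilt \<sigma> \<beta> y u)"
proof -
  have "- (norm (y - \<beta> *\<^sub>R u))\<^sup>2 / (2 * \<sigma>\<^sup>2) = - (norm y)\<^sup>2 / (2 * \<sigma>\<^sup>2) + tilt \<sigma> \<beta> y u"
    using assms unfolding tilt_def power2_norm_eq_inner
    by (simp add: inner_diff_left inner_diff_right inner_commute field_simps power2_eq_square)
  then show ?thesis unfolding gauss_density_def by (simp add: exp_add[symmetric] del: minus_divide_left)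
qed

text \<open>The three tilts combine into a single tilt by \<open>u + v + w\<close> times an
  exponential of cross terms. What remains is the expectation of a product of two affine functions
  under a Gaussian centred at \<open>c\<close>.\<close>

lemma gauss_tilt_moment:
  fixes u v w u' v' :: "real^'d" and \<beta> :: real
  assumes \<sigma>: "\<sigma> > 0"
  defines "s \<equiv> \<beta>\<^sup>2 / \<sigma>\<^sup>2"
  shows "(LINT y|lborel. gauss_density \<sigma> y * exp (tilt \<sigma> \<beta> y w) *
       (dtilt \<sigma> \<beta> y u u' * exp (tilt \<sigma> \<beta> y u)) * (dtilt \<sigma> \<beta> y v v' * exp (tilt \<sigma> \<beta> y v)))
     = exp (s * (u \<bullet> v + u \<bullet> w + v \<bullet> w)) * (s * (u' \<bullet> v') + s\<^sup>2 * (u' \<bullet> (v + w)) * (v' \<bullet> (u + w)))"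
   (is "integral\<^sup>L lborel ?F = ?R")
proof -
  define c where "c = \<beta> *\<^sub>R (u + v + w)"
  define E where "E = exp (s * (u \<bullet> v + u \<bullet> w + v \<bullet> w))"
  \<comment> \<open>After centring at \<open>c\<close>, each \<open>dtilt\<close> is
    \<open>\<beta> / \<sigma>\<^sup>2\<close> times the sum of a linear function of \<open>z\<close>
    and a constant; \<open>a\<close> and \<open>b\<close> are these constants. In \<open>a\<close>
    only \<open>v + w\<close> remains, because \<open>dtilt\<close> subtracts the contribution of
    \<open>u\<close> itself.\<close>
  define a where "a = \<beta> * (u' \<bullet> (v + w))"
  define b where "b = \<beta> * (v' \<bullet> (u + w))"
  define r where "r = E * \<beta>\<^sup>2 / \<sigma>^4"
  have F: "?F (c + z) = r * (gauss_density \<sigma> z * ((z \<bullet> u') * (z \<bullet> v')))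
      + r * b * (gauss_density \<sigma> z * (z \<bullet> u')) + r * a * (gauss_density \<sigma> z * (z \<bullet> v'))
      + r * a * b * gauss_density \<sigma> z" for z
  proof -
    let ?y = "c + z"
    \<comment> \<open>Only the quadratic part of \<open>tilt\<close> fails to be additive in
      \<open>u\<close>, and the defect consists of the cross terms of
      \<open>u + v + w\<close>.\<close>
    have "s * (u \<bullet> v + u \<bullet> w + v \<bullet> w) + tilt \<sigma> \<beta> ?y (u + v + w) = tilt \<sigma> \<beta> ?y u + tilt \<sigma> \<beta> ?y v + tilt \<sigma> \<beta> ?y w"
      using \<sigma> unfolding tilt_def s_def
      by (simp add: inner_add_left inner_add_right inner_commute field_simps)
    then have "exp (tilt \<sigma> \<beta> ?y u) * exp (tilt \<sigma> \<beta> ?y v) * exp (tilt \<sigma> \<beta> ?y w) = E * exp (tilt \<sigma> \<beta> ?y (u + v + w))"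
      unfolding E_def by (simp flip: exp_add)
    moreover have "gauss_density \<sigma> ?y * exp (tilt \<sigma> \<beta> ?y (u + v + w)) = gauss_density \<sigma> z"
      using gauss_density_shift[OF \<sigma>, of ?y \<beta> "u + v + w"] by (simp add: c_def)
    ultimately have e: "gauss_density \<sigma> ?y * (exp (tilt \<sigma> \<beta> ?y u) * exp (tilt \<sigma> \<beta> ?y v) * exp (tilt \<sigma> \<beta> ?y w)) = E * gauss_density \<sigma> z"
      by (metis mult.left_commute)
    have du: "dtilt \<sigma> \<beta> ?y u u' = \<beta> / \<sigma>\<^sup>2 * (z \<bullet> u' + a)"
      using \<sigma> unfolding dtilt_def c_def a_def
      by (simp add: inner_add_left inner_add_right inner_commute field_simps power2_eq_square)
    have dv: "dtilt \<sigma> \<beta> ?y v v' = \<beta> / \<sigma>\<^sup>2 * (z \<bullet> v' + b)"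
      using \<sigma> unfolding dtilt_def c_def b_def
      by (simp add: inner_add_left inner_add_right inner_commute field_simps power2_eq_square)
    have "?F ?y = dtilt \<sigma> \<beta> ?y u u' * dtilt \<sigma> \<beta> ?y v v' * (gauss_density \<sigma> ?y * (exp (tilt \<sigma> \<beta> ?y u) * exp (tilt \<sigma> \<beta> ?y v) * exp (tilt \<sigma> \<beta> ?y w)))"
      by (simp only: mult_ac)
    also have "\<dots> = (\<beta> / \<sigma>\<^sup>2 * (z \<bullet> u' + a)) * (\<beta> / \<sigma>\<^sup>2 * (z \<bullet> v' + b)) * (E * gauss_density \<sigma> z)"
      unfolding e du dv ..
    also have "\<dots> = (z \<bullet> u' + a) * (z \<bullet> v' + b) * (r * gauss_density \<sigma> z)"
      using \<sigma> unfolding r_def by (simp add: field_simps power2_eq_square power4_eq_xxxx)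
    finally show ?thesis by (simp add: algebra_simps)
  qed
  have one: "has_bochner_integral lborel (\<lambda>z::real^'d. gauss_density \<sigma> z) 1"
    using gauss_integrable[OF \<sigma>] gauss_integral[OF \<sigma>] by (simp add: has_bochner_integral_iff)
  have first: "has_bochner_integral lborel (\<lambda>z::real^'d. gauss_density \<sigma> z * (z \<bullet> p)) 0" for p
  proof -
    have i: "integrable lborel (\<lambda>z::real^'d. gauss_density \<sigma> z * (z \<bullet> p))"
    proof (rule Bochner_Integration.integrable_bound)
      show "integrable lborel (\<lambda>z::real^'d. norm p * (gauss_density \<sigma> z * exp (1 * norm z)))"
        by (intro integrable_mult_right gauss_exp_integrable \<sigma>)
      have ineq: "\<bar>z \<bullet> p\<bar> \<le> norm p * exp (norm z)" for z :: "real^'d"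
      proof -
        have "\<bar>z \<bullet> p\<bar> \<le> norm p * norm z"
          using Cauchy_Schwarz_ineq2[of z p] by (simp add: mult.commute)
        also have "\<dots> \<le> norm p * exp (norm z)"
          using exp_ge_add_one_self[of "norm z"] by (intro mult_left_mono norm_ge_zero) linarith
        finally show ?thesis .
      qed
      have le: "norm (gauss_density \<sigma> z * (z \<bullet> p)) \<le> norm (norm p * (gauss_density \<sigma> z * exp (1 * norm z)))"
        if "\<bar>z \<bullet> p\<bar> \<le> norm p * exp (norm z)" for z :: "real^'d"
      proof -
        have "gauss_density \<sigma> z * \<bar>z \<bullet> p\<bar> \<le> gauss_density \<sigma> z * (norm p * exp (norm z))"
          using that gauss_density_pos[OF \<sigma>, of z] by (intro mult_left_mono) auto
        also have "\<dots> = norm p * (gauss_density \<sigma> z * exp (1 * norm z))" by simp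
        finally show ?thesis using gauss_density_pos[OF \<sigma>, of z] by (simp only: real_norm_def abs_mult abs_of_pos abs_of_nonneg norm_ge_zero abs_exp_cancel)
      qed
      show "AE z in lborel. norm (gauss_density \<sigma> z * (z \<bullet> p)) \<le> norm (norm p * (gauss_density \<sigma> (z::real^'d) * exp (1 * norm z)))"
        by (intro AE_I2 le ineq)
    qed measurable
    \<comment> \<open>The density is even, so the reflection of \<open>z\<close> changes the sign of
      the first moment.\<close>
    have "(LINT z|lborel. gauss_density \<sigma> z * (z \<bullet> p)) = (LINT z|lborel. gauss_density \<sigma> (-z::real^'d) * (-z \<bullet> p))"
      by (subst (1) lborel_eq_uminus, rule integral_distr) measurable
    also have "\<dots> = - (LINT z|lborel. gauss_density \<sigma> (z::real^'d) * (z \<bullet> p))"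
      by simp
    finally have "(LINT z|lborel. gauss_density \<sigma> z * (z \<bullet> p)) = 0" by simp
    then show ?thesis using i by (simp add: has_bochner_integral_iff)
  qed
  have "integral\<^sup>L lborel ?F = (LINT z|lborel. ?F (c + z))"
    by (subst (1) lborel_distr_plus[of c, symmetric], rule integral_distr)
       (unfold tilt_def dtilt_def, measurable)
  also have "\<dots> = r * (\<sigma>\<^sup>2 * (u' \<bullet> v')) + r * b * 0 + r * a * 0 + r * a * b * 1"
    unfolding F
    by (intro has_bochner_integral_integral_eq has_bochner_integral_add has_bochner_integral_mult_right
        one first gauss_second_moment \<sigma>)
  also have "\<dots> = E * (s * (u' \<bullet> v') + s\<^sup>2 * (u' \<bullet> (v + w)) * (v' \<bullet> (u + w)))"
    using \<sigma> unfolding r_def a_def b_def s_def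
    by (simp add: field_simps power2_eq_square power4_eq_xxxx)
  finally show ?thesis by (simp add: E_def)
qed

section \<open>Homogeneous polynomials and their directional derivatives\<close>

lemma finite_lists_length [simp]: "finite {is :: 'd::finite list. length is = n}"
  using finite_lists_length_eq[of "UNIV :: 'd set" n] by simp

lemma sum_lists_Suc:
  fixes f :: "'d::finite list \<Rightarrow> 'b::comm_monoid_add"
  shows "(\<Sum>is | length is = Suc n. f is) = (\<Sum>i\<in>UNIV. \<Sum>is | length is = n. f (i # is))"
proof -
  have eq: "{is :: 'd list. length is = Suc n} = (\<lambda>(i, is). i # is) ` (UNIV \<times> {is. length is = n})"
    by (auto simp: length_Suc_conv image_iff)
  have "inj_on (\<lambda>(i, is). i # is) (UNIV \<times> {is :: 'd list. length is = n})"
    by (auto simp: inj_on_def)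
  then show ?thesis
    unfolding eq sum.cartesian_product by (subst sum.reindex) (auto intro!: sum.cong)
qed

text \<open>Indexing by words instead of exponent vectors makes the values the entries of a tensor
  power, and sums over words become Frobenius products.\<close>

definition monom_at :: "real^'d \<Rightarrow> 'd list \<Rightarrow> real" where
  "monom_at u is = (\<Prod>i\<leftarrow>is. u $ i)"

text \<open>The derivative of \<open>monom_at\<close> in \<open>u\<close> along \<open>u'\<close>,
  with the product rule unfolded letter by letter.\<close>

fun dmonom_at :: "real^'d \<Rightarrow> real^'d \<Rightarrow> 'd list \<Rightarrow> real" where
  "dmonom_at u u' [] = 0"
| "dmonom_at u u' (i # is) = u' $ i * monom_at u is + u $ i * dmonom_at u u' is"

lemma monom_at_simps [simp]:
  "monom_at u [] = 1" "monom_at u (i # is) = u $ i * monom_at u is"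
  by (simp_all add: monom_at_def)

lemma continuous_on_monom_at [continuous_intros]:
  "continuous_on S f \<Longrightarrow> continuous_on S (\<lambda>x. monom_at (f x) is)"
  by (induction "is") (auto intro!: continuous_intros)

lemma continuous_on_dmonom_at [continuous_intros]:
  "continuous_on S f \<Longrightarrow> continuous_on S g \<Longrightarrow> continuous_on S (\<lambda>x. dmonom_at (f x) (g x) is)"
  by (induction "is") (auto intro!: continuous_intros)

text \<open>\<open>F'\<close> is the directional derivative \<open>F' u u'\<close> of the homogeneous polynomial \<open>F\<close> at \<open>u\<close>.\<close>

definition hom_poly :: "nat \<Rightarrow> (real^'d \<Rightarrow> real) \<Rightarrow> (real^'d \<Rightarrow> real^'d \<Rightarrow> real) \<Rightarrow> bool" where
  "hom_poly n F F' \<longleftrightarrow> (\<exists>c. F = (\<lambda>u. \<Sum>is | length is = n. c is * monom_at u is) \<and>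
     F' = (\<lambda>u u'. \<Sum>is | length is = n. c is * dmonom_at u u' is))"

lemma hom_poly_const: "hom_poly 0 (\<lambda>_. c) (\<lambda>_ _. 0)"
  unfolding hom_poly_def by (rule exI[of _ "\<lambda>_. c"]) simp

lemma hom_poly_zero: "hom_poly n (\<lambda>_. 0) (\<lambda>_ _. 0)"
  unfolding hom_poly_def by (rule exI[of _ "\<lambda>_. 0"]) simp

lemma hom_poly_add:
  assumes "hom_poly n F F'" "hom_poly n G G'"
  shows "hom_poly n (\<lambda>u. F u + G u) (\<lambda>u u'. F' u u' + G' u u')"
proof -
  from assms obtain c d where
    "F = (\<lambda>u. \<Sum>is | length is = n. c is * monom_at u is)"
    "F' = (\<lambda>u u'. \<Sum>is | length is = n. c is * dmonom_at u u' is)"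
    "G = (\<lambda>u. \<Sum>is | length is = n. d is * monom_at u is)"
    "G' = (\<lambda>u u'. \<Sum>is | length is = n. d is * dmonom_at u u' is)"
    unfolding hom_poly_def by blast
  then show ?thesis
    unfolding hom_poly_def
    by (intro exI[of _ "\<lambda>is. c is + d is"]) (simp add: algebra_simps sum.distrib)
qed

lemma hom_poly_sum:
  assumes "finite I" "\<And>i. i \<in> I \<Longrightarrow> hom_poly n (F i) (F' i)"
  shows "hom_poly n (\<lambda>u. \<Sum>i\<in>I. F i u) (\<lambda>u u'. \<Sum>i\<in>I. F' i u u')"
  using assms by (induction I) (simp_all add: hom_poly_zero hom_poly_add)

lemma hom_poly_scale:
  assumes "hom_poly n F F'"
  shows "hom_poly n (\<lambda>u. a * F u) (\<lambda>u u'. a * F' u u')"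
proof -
  from assms obtain c where
    "F = (\<lambda>u. \<Sum>is | length is = n. c is * monom_at u is)"
    "F' = (\<lambda>u u'. \<Sum>is | length is = n. c is * dmonom_at u u' is)"
    unfolding hom_poly_def by blast
  then show ?thesis
    unfolding hom_poly_def
    by (intro exI[of _ "\<lambda>is. a * c is"]) (simp add: sum_distrib_left mult.assoc)
qed

text \<open>Prepending the letter \<open>i\<close> to every word multiplies by the coordinate; on
  derivatives the recursion of \<open>dmonom_at\<close> is the product rule.\<close>

lemma hom_poly_coord:
  assumes "hom_poly n F F'"
  shows "hom_poly (Suc n) (\<lambda>u. u $ i * F u) (\<lambda>u u'. u' $ i * F u + u $ i * F' u u')"
proof -
  from assms obtain c where
    c: "F = (\<lambda>u. \<Sum>is | length is = n. c is * monom_at u is)"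
    "F' = (\<lambda>u u'. \<Sum>is | length is = n. c is * dmonom_at u u' is)"
    unfolding hom_poly_def by blast
  \<comment> \<open>The old coefficients, moved to the words that start with \<open>i\<close>; all
    other words get \<open>0\<close>.\<close>
  define d where "d js = (if hd js = i then c (tl js) else 0)" for js
  have delta: "(\<Sum>is | length is = n. c is * f (i # is)) = (\<Sum>js | length js = Suc n. d js * f js)" for f
  proof -
    have "(\<Sum>js | length js = Suc n. d js * f js)
       = (\<Sum>j\<in>UNIV. if j = i then (\<Sum>is | length is = n. c is * f (j # is)) else 0)"
      unfolding sum_lists_Suc d_def by (intro sum.cong refl) auto
    then show ?thesis by simp
  qed
  have 1: "u $ i * F u = (\<Sum>js | length js = Suc n. d js * monom_at u js)" for u
    unfolding delta[symmetric] c by (simp add: sum_distrib_left mult.left_commute)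
  have 2: "u' $ i * F u + u $ i * F' u u' = (\<Sum>js | length js = Suc n. d js * dmonom_at u u' js)" for u u'
    unfolding delta[symmetric] c
    by (simp add: sum_distrib_left mult.left_commute distrib_left sum.distrib)
  show ?thesis
    unfolding hom_poly_def 1 2 by blast
qed

lemma hom_poly_inner:
  assumes "hom_poly n F F'"
  shows "hom_poly (Suc n) (\<lambda>u. (u \<bullet> a) * F u) (\<lambda>u u'. (u' \<bullet> a) * F u + (u \<bullet> a) * F' u u')"
proof -
  have "hom_poly (Suc n) (\<lambda>u. \<Sum>i\<in>UNIV. a $ i * (u $ i * F u))
     (\<lambda>u u'. \<Sum>i\<in>UNIV. a $ i * (u' $ i * F u + u $ i * F' u u'))"
    by (intro hom_poly_sum hom_poly_scale hom_poly_coord assms) simp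
  also have "(\<lambda>u. \<Sum>i\<in>UNIV. a $ i * (u $ i * F u)) = (\<lambda>u. (u \<bullet> a) * F u)"
    by (simp add: inner_vec_def sum_distrib_right sum_distrib_left mult_ac)
  also have "(\<lambda>u u'. \<Sum>i\<in>UNIV. a $ i * (u' $ i * F u + u $ i * F' u u'))
      = (\<lambda>u u'. (u' \<bullet> a) * F u + (u \<bullet> a) * F' u u')"
    by (simp add: inner_vec_def sum_distrib_right sum_distrib_left distrib_left sum.distrib mult_ac)
  finally show ?thesis .
qed

text \<open>\<open>hom_poly_inner\<close> and this lemma serve the two parts of \<open>tilt\<close>:
  the linear part carries \<open>\<beta>\<close> and raises the degree by one, the quadratic part
  carries \<open>\<beta>\<^sup>2\<close> and raises it by two.\<close>

lemma hom_poly_inner_self: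
  assumes "hom_poly n F F'"
  shows "hom_poly (n + 2) (\<lambda>u. (u \<bullet> u) * F u) (\<lambda>u u'. 2 * (u \<bullet> u') * F u + (u \<bullet> u) * F' u u')"
proof -
  have "hom_poly (Suc (Suc n)) (\<lambda>u. \<Sum>i\<in>UNIV. u $ i * (u $ i * F u))
     (\<lambda>u u'. \<Sum>i\<in>UNIV. u' $ i * (u $ i * F u) + u $ i * (u' $ i * F u + u $ i * F' u u'))"
    by (intro hom_poly_sum hom_poly_coord assms) simp
  also have "(\<lambda>u. \<Sum>i\<in>UNIV. u $ i * (u $ i * F u)) = (\<lambda>u. (u \<bullet> u) * F u)"
    by (simp add: inner_vec_def sum_distrib_right sum_distrib_left mult_ac)
  also have "(\<lambda>u u'. \<Sum>i\<in>UNIV. u' $ i * (u $ i * F u) + u $ i * (u' $ i * F u + u $ i * F' u u'))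
      = (\<lambda>u u'. 2 * (u \<bullet> u') * F u + (u \<bullet> u) * F' u u')"
    by (simp add: inner_vec_def sum_distrib_right sum_distrib_left distrib_left sum.distrib mult_ac)
  finally show ?thesis by simp
qed

lemma continuous_on_hom_poly:
  assumes "hom_poly n F F'"
  shows "continuous_on S f \<Longrightarrow> continuous_on S (\<lambda>x. F (f x))"
    and "continuous_on S f \<Longrightarrow> continuous_on S g \<Longrightarrow> continuous_on S (\<lambda>x. F' (f x) (g x))"
  using assms unfolding hom_poly_def by (auto intro!: continuous_intros)

text \<open>Without derivatives the sum is \<open>(u \<bullet> v) ^ n\<close>, and the right-hand
  side is its mixed derivative. Splitting off the first letter gives a joint recursion for the sums
  with neither, one or both factors differentiated. The truncated exponents are harmless for small
  \<open>n\<close> because their coefficients vanish.\<close>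

lemma sum_dmonom_at_mult:
  fixes u u' v v' :: "real^'d"
  shows "(\<Sum>is | length is = n. dmonom_at u u' is * dmonom_at v v' is)
      = real n * real (n - 1) * (u \<bullet> v) ^ (n - 2) * (u' \<bullet> v) * (u \<bullet> v') + real n * (u \<bullet> v) ^ (n - 1) * (u' \<bullet> v')"
proof -
  define S where "S n = (\<Sum>is | length is = n. monom_at u is * monom_at v is)" for n
  define A where "A n = (\<Sum>is | length is = n. dmonom_at u u' is * monom_at v is)" for n
  define B where "B n = (\<Sum>is | length is = n. monom_at u is * dmonom_at v v' is)" for n
  define D where "D n = (\<Sum>is | length is = n. dmonom_at u u' is * dmonom_at v v' is)" for n
  have S_Suc: "S (Suc n) = (u \<bullet> v) * S n" for n
    unfolding S_def sum_lists_Suc inner_vec_def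
    by (simp add: sum_product mult_ac)
  have A_Suc: "A (Suc n) = (u' \<bullet> v) * S n + (u \<bullet> v) * A n" for n
    unfolding S_def A_def sum_lists_Suc inner_vec_def
    by (simp add: sum_product algebra_simps sum.distrib)
  have B_Suc: "B (Suc n) = (u \<bullet> v') * S n + (u \<bullet> v) * B n" for n
    unfolding S_def B_def sum_lists_Suc inner_vec_def
    by (simp add: sum_product algebra_simps sum.distrib)
  have D_Suc: "D (Suc n) = (u' \<bullet> v') * S n + (u' \<bullet> v) * B n + (u \<bullet> v') * A n + (u \<bullet> v) * D n" for n
    unfolding S_def A_def B_def D_def sum_lists_Suc inner_vec_def
    by (simp add: sum_product algebra_simps sum.distrib)
  have zero: "S 0 = 1" "A 0 = 0" "B 0 = 0" "D 0 = 0"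
    by (simp_all add: S_def A_def B_def D_def)
  have S: "S n = (u \<bullet> v) ^ n" for n
    by (induction n) (simp_all add: zero S_Suc)
  have A: "A n = real n * (u \<bullet> v) ^ (n - 1) * (u' \<bullet> v)" for n
  proof (induction n)
    case (Suc n)
    then show ?case by (cases n) (simp_all add: zero A_Suc S algebra_simps)
  qed (simp add: zero)
  have B: "B n = real n * (u \<bullet> v) ^ (n - 1) * (u \<bullet> v')" for n
  proof (induction n)
    case (Suc n)
    then show ?case by (cases n) (simp_all add: zero B_Suc S algebra_simps)
  qed (simp add: zero)
  have D: "D n = real n * real (n - 1) * (u \<bullet> v) ^ (n - 2) * (u' \<bullet> v) * (u \<bullet> v')
      + real n * (u \<bullet> v) ^ (n - 1) * (u' \<bullet> v')" for n
  proof (induction n)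
    case (Suc n)
    show ?case
    proof (cases n)
      case (Suc m)
      then show ?thesis
        unfolding D_Suc Suc.IH S A B by (cases m) (simp_all add: algebra_simps)
    qed (simp add: D_Suc zero)
  qed (simp add: zero)
  show ?thesis
    using D[of n] unfolding D_def .
qed

section \<open>Vanishing moment derivatives\<close>

text \<open>A single term of the exponential series; used to trade powers of \<open>norm y\<close>
  for exponential growth.\<close>

lemma power_le_fact_exp:
  fixes t :: real
  assumes "0 \<le> t"
  shows "t ^ n \<le> fact n * exp t"
proof -
  have "(\<Sum>i\<in>{n}. t ^ i /\<^sub>R fact i) \<le> (\<Sum>i. t ^ i /\<^sub>R fact i)"
    by (intro sum_le_suminf summable_exp_generic) (use assms in auto)
  then show ?thesis by (simp add: exp_def field_simps)
qed

lemma exp_taylor_bound: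
  fixes t :: real
  shows "\<bar>exp t - (\<Sum>i<n. t ^ i / fact i)\<bar> \<le> \<bar>t\<bar> ^ n * exp \<bar>t\<bar>"
proof (cases n)
  case 0
  then show ?thesis by simp
next
  case (Suc m)
  have "\<bar>exp t - (\<Sum>i<n. t ^ i / fact i)\<bar> \<le> exp \<bar>t\<bar> * \<bar>t\<bar> ^ n / fact m"
    using Taylor_exp_field[of t m] by (simp add: Suc lessThan_Suc_atMost)
  also have "\<dots> \<le> exp \<bar>t\<bar> * \<bar>t\<bar> ^ n / 1"
    by (intro divide_left_mono) (auto simp: fact_ge_1)
  finally show ?thesis by (simp add: mult.commute)
qed

section \<open>Bounded random vectors with a tangent direction\<close>

lemma (in prob_space) integrable_continuous_bounded:
  fixes X :: "'a \<Rightarrow> 'b::euclidean_space" and f :: "'b \<Rightarrow> real"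
  assumes X [measurable]: "X \<in> borel_measurable M" and bd: "\<And>z. norm (X z) \<le> B"
    and f: "continuous_on UNIV f"
  shows "integrable M (\<lambda>z. f (X z))"
proof -
  have [measurable]: "f \<in> borel_measurable borel"
    using f by (rule borel_measurable_continuous_onI)
  have "bounded (f ` cball 0 B)"
    using f by (intro compact_imp_bounded compact_continuous_image) (auto intro: continuous_on_subset)
  then obtain K where "\<forall>v\<in>cball 0 B. norm (f v) \<le> K"
    by (auto simp: bounded_iff)
  then show ?thesis
    by (intro integrable_const_bound[of _ K]) (use bd in \<open>auto simp: mem_cball_0\<close>)
qed

lemma (in prob_space) abs_expectation_le:
  fixes f :: "'a \<Rightarrow> real"
  assumes "\<And>z. \<bar>f z\<bar> \<le> K"
  shows "\<bar>expectation f\<bar> \<le> K"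
proof (cases "integrable M f")
  case True
  have "\<bar>expectation f\<bar> \<le> expectation (\<lambda>z. \<bar>f z\<bar>)"
    by (rule integral_abs_bound)
  also have "\<dots> \<le> expectation (\<lambda>_. K)"
    using True assms by (intro Bochner_Integration.integral_mono) auto
  finally show ?thesis by (simp add: prob_space)
next
  \<comment> \<open>The integral of a non-integrable function is \<open>0\<close>, and
    \<open>K\<close> is nonnegative because it bounds an absolute value.\<close>
  case False
  then show ?thesis using assms[of undefined] by (simp add: not_integrable_integral_eq) 
qed

text \<open>Stands for \<open>x = A(Z) \<theta>\<close> and \<open>x' = A(Z) h\<close>. The bound
  holds everywhere rather than almost surely, so that compactness and sup bounds can be applied at
  each \<open>z\<close>.\<close>

locale random_tangent = prob_space M for M :: "'z measure" +
  fixes x x' :: "'z \<Rightarrow> real^'d" and B :: real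
  assumes x_measurable [measurable]: "x \<in> borel_measurable M"
    and x'_measurable [measurable]: "x' \<in> borel_measurable M"
    and x_bound: "norm (x z) \<le> B" and x'_bound: "norm (x' z) \<le> B"
begin

lemma B_nonneg: "0 \<le> B"
  using x_bound[of undefined] norm_ge_zero[of "x undefined"] by linarith

lemma integrable_tangent:
  fixes f :: "real^'d \<Rightarrow> real^'d \<Rightarrow> real"
  assumes "continuous_on UNIV (\<lambda>p. f (fst p) (snd p))"
  shows "integrable M (\<lambda>z. f (x z) (x' z))"
proof -
  have "norm (x z, x' z) \<le> B + B" for z
    using norm_Pair_le[of "x z" "x' z"] x_bound[of z] x'_bound[of z] by linarith
  from integrable_continuous_bounded[OF _ this assms] show ?thesis by simp
qed

text \<open>The vanishing of the moment derivatives of order below \<open>k\<close> along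
  \<open>x'\<close>, entry by entry. The empty word satisfies the condition automatically, since its
  derivative is \<open>0\<close>.\<close>

definition flat :: "nat \<Rightarrow> bool" where
  "flat k \<longleftrightarrow> (\<forall>is. length is < k \<longrightarrow> expectation (\<lambda>z. dmonom_at (x z) (x' z) is) = 0)"

lemma flat_hom_poly:
  assumes "flat k" "hom_poly n F F'" "n < k"
  shows "expectation (\<lambda>z. F' (x z) (x' z)) = 0"
proof -
  obtain c where c: "F' = (\<lambda>u u'. \<Sum>is | length is = n. c is * dmonom_at u u' is)"
    using assms(2) unfolding hom_poly_def by blast
  have "integrable M (\<lambda>z. dmonom_at (x z) (x' z) is)" for "is"
    by (intro integrable_tangent continuous_intros)
  then show ?thesis
    using assms(1,3) by (simp add: c flat_def)
qed

text \<open>Under the expectation stands the derivative along \<open>x'\<close> of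
  \<open>(u \<bullet> a + e) ^ m * F u\<close>. Each power of \<open>e\<close> in its expansion
  lowers the degree in \<open>u\<close>, and degrees below \<open>k\<close> have expectation
  \<open>0\<close>. So at total degree \<open>k\<close> only the part with \<open>e = 0\<close>
  survives.\<close>

lemma flat_affine_power:
  assumes "flat k" "hom_poly j F F'" "m + j \<le> k"
  shows "expectation (\<lambda>z. real m * (x z \<bullet> a + e) ^ (m - 1) * (x' z \<bullet> a) * F (x z) + (x z \<bullet> a + e) ^ m * F' (x z) (x' z))
    = (if m + j < k then 0 else
       expectation (\<lambda>z. real m * (x z \<bullet> a) ^ (m - 1) * (x' z \<bullet> a) * F (x z) + (x z \<bullet> a) ^ m * F' (x z) (x' z)))"
  using assms(2,3)
proof (induction m arbitrary: j F F' e)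
  case 0
  then show ?case using flat_hom_poly[OF assms(1) 0(1)] by simp
next
  case (Suc m)
  define L where "L m e F F' = (\<lambda>z. real m * (x z \<bullet> a + e) ^ (m - 1) * (x' z \<bullet> a) * F (x z) + (x z \<bullet> a + e) ^ m * F' (x z) (x' z))"
    for m e and F :: "real^'d \<Rightarrow> real" and F' :: "real^'d \<Rightarrow> real^'d \<Rightarrow> real"
  let ?F = "\<lambda>u. (u \<bullet> a) * F u" and ?F' = "\<lambda>u u'. (u' \<bullet> a) * F u + (u \<bullet> a) * F' u u'"
  have hp: "hom_poly (Suc j) ?F ?F'" using Suc.prems(1) by (rule hom_poly_inner)
  have int: "integrable M (L m e F F')" if "hom_poly j F F'" for j m e F F'
    unfolding L_def
    by (rule integrable_tangent[of "\<lambda>u u'. real m * (u \<bullet> a + e) ^ (m - 1) * (u' \<bullet> a) * F u + (u \<bullet> a + e) ^ m * F' u u'"])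
       (intro continuous_intros continuous_on_hom_poly[OF that])
  \<comment> \<open>One factor \<open>u \<bullet> a + e\<close> is split:
    \<open>u \<bullet> a\<close> goes into the polynomial and raises its degree, \<open>e\<close>
    stays outside as a scalar.\<close>
  have step: "L (Suc m) e F F' = (\<lambda>z. L m e ?F ?F' z + e * L m e F F' z)" for e
  proof
    fix z
    show "L (Suc m) e F F' z = L m e ?F ?F' z + e * L m e F F' z"
      unfolding L_def by (cases m) (simp_all add: algebra_simps)
  qed
  have E: "expectation (L (Suc m) e F F') = expectation (L m e ?F ?F') + e * expectation (L m e F F')" for e
    unfolding step using int[OF hp] int[OF Suc.prems(1)] by simp
  have IH: "expectation (L m e F F') = (if m + j < k then 0 else expectation (L m 0 F F'))"
    if "hom_poly j F F'" "m + j \<le> k" for j e F F'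
    using Suc.IH[OF that] unfolding L_def add_0_right .
  \<comment> \<open>The part multiplied by \<open>e\<close> has total degree \<open>m + j\<close>,
    one less than the bound in the premise, hence below \<open>k\<close>.\<close>
  have "expectation (L m e F F') = 0" for e
    using IH[OF Suc.prems(1), of e] Suc.prems(2) by simp
  then have E': "expectation (L (Suc m) e F F') = expectation (L m e ?F ?F')" for e
    using E by simp
  have "expectation (L (Suc m) e F F') = (if Suc m + j < k then 0 else expectation (L (Suc m) 0 F F'))"
    unfolding E' using IH[OF hp, of e] Suc.prems(2) by simp
  then show ?case unfolding L_def by simp
qed

text \<open>The left-hand integrand is the derivative along \<open>x'\<close> of
  \<open>n * (u \<bullet> a + e) ^ (n - 1) * (u \<bullet> b + c)\<close>, the shape in which
  \<open>mixed_power\<close> depends on \<open>u\<close>. \<open>flat_affine_power\<close> treats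
  the term with \<open>u \<bullet> b\<close> at degree \<open>n\<close>; the term with
  \<open>c\<close> has degree \<open>n - 1\<close> and disappears.\<close>

lemma flat_second:
  assumes "flat k" "n \<le> k"
  shows "expectation (\<lambda>z. real n * real (n - 1) * (x z \<bullet> a + e) ^ (n - 2) * (x' z \<bullet> a) * (x z \<bullet> b + c)
        + real n * (x z \<bullet> a + e) ^ (n - 1) * (x' z \<bullet> b))
    = (if n < k then 0 else
       expectation (\<lambda>z. real n * real (n - 1) * (x z \<bullet> a) ^ (n - 2) * (x' z \<bullet> a) * (x z \<bullet> b)
        + real n * (x z \<bullet> a) ^ (n - 1) * (x' z \<bullet> b)))"
proof (cases n)
  case 0
  then show ?thesis by simp
next
  case (Suc m)
  \<comment> \<open>The factors \<open>1\<close> and \<open>0\<close> keep the form that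
    \<open>hom_poly_inner\<close> produces from a constant polynomial.\<close>
  let ?F = "\<lambda>u::real^'d. (u \<bullet> b) * 1" and ?F' = "\<lambda>u u'::real^'d. (u' \<bullet> b) * 1 + (u \<bullet> b) * 0"
  let ?L = "\<lambda>z. real m * (x z \<bullet> a + e) ^ (m - 1) * (x' z \<bullet> a) * ?F (x z) + (x z \<bullet> a + e) ^ m * ?F' (x z) (x' z)"
  let ?N = "\<lambda>z. real m * (x z \<bullet> a) ^ (m - 1) * (x' z \<bullet> a) * ?F (x z) + (x z \<bullet> a) ^ m * ?F' (x z) (x' z)"
  let ?M = "\<lambda>z. real m * (x z \<bullet> a + e) ^ (m - 1) * (x' z \<bullet> a) * 1 + (x z \<bullet> a + e) ^ m * 0"
  have L: "expectation ?L = (if n < k then 0 else expectation ?N)"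
  proof -
    have "hom_poly (Suc 0) ?F ?F'" by (intro hom_poly_inner hom_poly_const)
    from flat_affine_power[OF assms(1) this, of m a e] assms(2) Suc show ?thesis
      by (cases "Suc m < k") simp_all
  qed
  have M: "expectation ?M = 0"
    using flat_affine_power[OF assms(1) hom_poly_const[of 1], of m a e] assms(2) Suc by simp
  have iL: "integrable M ?L"
    by (rule integrable_tangent[of "\<lambda>u u'. real m * (u \<bullet> a + e) ^ (m - 1) * (u' \<bullet> a) * ?F u + (u \<bullet> a + e) ^ m * ?F' u u'"])
       (intro continuous_intros)
  have iM: "integrable M ?M"
    by (rule integrable_tangent[of "\<lambda>u u'. real m * (u \<bullet> a + e) ^ (m - 1) * (u' \<bullet> a) * 1 + (u \<bullet> a + e) ^ m * 0"])
       (intro continuous_intros)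
  have eq: "n - 2 = m - 1" "n - 1 = m" using Suc by auto
  have "expectation (\<lambda>z. real n * real (n - 1) * (x z \<bullet> a + e) ^ (n - 2) * (x' z \<bullet> a) * (x z \<bullet> b + c)
        + real n * (x z \<bullet> a + e) ^ (n - 1) * (x' z \<bullet> b)) = expectation (\<lambda>z. real n * ?L z + real n * c * ?M z)"
    unfolding eq by (intro Bochner_Integration.integral_cong refl) (simp add: algebra_simps)
  also have "\<dots> = real n * expectation ?L + real n * c * expectation ?M"
    using iL iM by (subst Bochner_Integration.integral_add) (auto simp del: mult_1_right mult_zero_right)
  also have "\<dots> = (if n < k then 0 else expectation (\<lambda>z. real n * ?N z))"
    unfolding L M by (simp del: mult_1_right mult_zero_right add_0_right)
  also have "(\<lambda>z. real n * ?N z) = (\<lambda>z. real n * real (n - 1) * (x z \<bullet> a) ^ (n - 2) * (x' z \<bullet> a) * (x z \<bullet> b)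
        + real n * (x z \<bullet> a) ^ (n - 1) * (x' z \<bullet> b))"
    unfolding eq by (intro ext) (simp add: algebra_simps)
  finally show ?thesis .
qed

text \<open>The expectation is that of the derivative of \<open>tilt ^ m * F\<close>. Every degree
  in \<open>u\<close> coming from \<open>tilt\<close> is accompanied by one power of
  \<open>\<beta>\<close>, so with the prefactor \<open>\<beta> ^ j\<close> a term of degree
  \<open>i\<close> carries \<open>\<beta> ^ i\<close>. Flatness removes the terms with
  \<open>i < k\<close>, and the others are small enough. Each of the \<open>m + t\<close> factors is
  bounded by \<open>T\<close>; the two parts of \<open>tilt\<close> account for
  \<open>2 ^ m\<close>, the product rule for \<open>m + t\<close>.\<close>

lemma tilt_power_bound:
  assumes k: "flat k" and F: "hom_poly j F F'"
    and \<beta>: "0 < \<beta>" "\<beta> \<le> 1" and \<sigma>: "\<sigma> > 0"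
    and T1: "\<And>z. \<bar>y \<bullet> x z\<bar> / \<sigma>\<^sup>2 \<le> T" "\<And>z. \<bar>y \<bullet> x' z\<bar> / \<sigma>\<^sup>2 \<le> T"
    and T2: "\<And>z. (x z \<bullet> x z) / (2 * \<sigma>\<^sup>2) \<le> T" "\<And>z. \<bar>x z \<bullet> x' z\<bar> / \<sigma>\<^sup>2 \<le> T"
    and bF: "\<And>z. \<bar>F (x z)\<bar> \<le> T ^ t" "\<And>z. \<bar>F' (x z) (x' z)\<bar> \<le> real t * T ^ t"
  shows "\<beta> ^ j * \<bar>expectation (\<lambda>z. real m * tilt \<sigma> \<beta> y (x z) ^ (m - 1) * dtilt \<sigma> \<beta> y (x z) (x' z) * F (x z)
        + tilt \<sigma> \<beta> y (x z) ^ m * F' (x z) (x' z))\<bar> \<le> \<beta> ^ k * 2 ^ m * real (m + t) * T ^ (m + t)"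
  using F bF
proof (induction m arbitrary: j F F' t)
  case 0
  have "0 \<le> T" using T1(1)[of undefined] by (rule order_trans[rotated]) simp
  show ?case
  proof (cases "j < k")
    case True
    then show ?thesis using flat_hom_poly[OF k 0(1)] \<open>0 \<le> T\<close> \<beta> by simp
  next
    \<comment> \<open>No cancellation is available in degree \<open>k\<close> or more, but then
      enough powers of \<open>\<beta>\<close> have been collected.\<close>
    case False
    then have "\<beta> ^ j \<le> \<beta> ^ k" using \<beta> by (intro power_decreasing) auto
    moreover have "\<bar>expectation (\<lambda>z. F' (x z) (x' z))\<bar> \<le> real t * T ^ t"
      by (rule abs_expectation_le) (rule 0(3))
    ultimately have "\<beta> ^ j * \<bar>expectation (\<lambda>z. F' (x z) (x' z))\<bar> \<le> \<beta> ^ k * (real t * T ^ t)"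
      using \<beta> by (intro mult_mono) auto
    then show ?thesis by (simp add: mult.assoc)
  qed
next
  case (Suc m)
  have T0: "0 \<le> T" using T1(1)[of undefined] by (rule order_trans[rotated]) simp
  define L where "L m F F' = (\<lambda>z. real m * tilt \<sigma> \<beta> y (x z) ^ (m - 1) * dtilt \<sigma> \<beta> y (x z) (x' z) * F (x z)
      + tilt \<sigma> \<beta> y (x z) ^ m * F' (x z) (x' z))"
    for m and F :: "real^'d \<Rightarrow> real" and F' :: "real^'d \<Rightarrow> real^'d \<Rightarrow> real"
  \<comment> \<open>With these \<open>p\<close> and \<open>r\<close>, \<open>tilt\<close> is
    \<open>\<beta> * (u \<bullet> p) + \<beta>\<^sup>2 * (r * (u \<bullet> u))\<close>. One factor
    \<open>tilt\<close> is moved into the polynomial, giving \<open>F1\<close> of degree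
    \<open>j + 1\<close> and \<open>F2\<close> of degree \<open>j + 2\<close>.\<close>
  define p where "p = y /\<^sub>R \<sigma>\<^sup>2"
  define F1 where "F1 u = (u \<bullet> p) * F u" for u
  define F1' where "F1' u u' = (u' \<bullet> p) * F u + (u \<bullet> p) * F' u u'" for u u'
  define r where "r = - 1 / (2 * \<sigma>\<^sup>2)"
  define F2 where "F2 u = r * ((u \<bullet> u) * F u)" for u
  define F2' where "F2' u u' = r * (2 * (u \<bullet> u') * F u + (u \<bullet> u) * F' u u')" for u u'
  have hp1: "hom_poly (Suc j) F1 F1'"
    unfolding F1_def F1'_def by (intro hom_poly_inner Suc.prems)
  have hp2: "hom_poly (j + 2) F2 F2'"
    unfolding F2_def F2'_def by (intro hom_poly_scale hom_poly_inner_self Suc.prems)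
  have int: "integrable M (L m F F')" if "hom_poly j F F'" for j m F F'
    unfolding L_def
    by (rule integrable_tangent[of "\<lambda>u u'. real m * tilt \<sigma> \<beta> y u ^ (m - 1) * dtilt \<sigma> \<beta> y u u' * F u + tilt \<sigma> \<beta> y u ^ m * F' u u'"])
       (unfold tilt_def dtilt_def, intro continuous_intros continuous_on_hom_poly[OF that]; use \<sigma> in simp)
  have xp: "u \<bullet> p = (y \<bullet> u) / \<sigma>\<^sup>2" for u
    by (simp add: p_def inner_commute divide_inverse mult.commute)
  have tilt: "tilt \<sigma> \<beta> y u = \<beta> * (u \<bullet> p) + \<beta>\<^sup>2 * (r * (u \<bullet> u))"
    and dtilt: "dtilt \<sigma> \<beta> y u u' = \<beta> * (u' \<bullet> p) + \<beta>\<^sup>2 * (r * (2 * (u \<bullet> u')))" for u u'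
    unfolding tilt_def dtilt_def xp r_def by (simp_all add: field_simps)
  have step: "L (Suc m) F F' = (\<lambda>z. \<beta> * L m F1 F1' z + \<beta>\<^sup>2 * L m F2 F2' z)"
  proof
    fix z
    define V where "V = tilt \<sigma> \<beta> y (x z)"
    define V' where "V' = dtilt \<sigma> \<beta> y (x z) (x' z)"
    have "\<beta> * L m F1 F1' z + \<beta>\<^sup>2 * L m F2 F2' z =
       real m * V ^ (m - 1) * V' * (\<beta> * F1 (x z) + \<beta>\<^sup>2 * F2 (x z))
        + V ^ m * (\<beta> * F1' (x z) (x' z) + \<beta>\<^sup>2 * F2' (x z) (x' z))"
      unfolding L_def V_def V'_def by (simp add: algebra_simps)
    also have "\<beta> * F1 (x z) + \<beta>\<^sup>2 * F2 (x z) = V * F (x z)"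
      unfolding F1_def F2_def V_def tilt by (simp add: algebra_simps)
    also have "\<beta> * F1' (x z) (x' z) + \<beta>\<^sup>2 * F2' (x z) (x' z) = V' * F (x z) + V * F' (x z) (x' z)"
      unfolding F1'_def F2'_def V'_def V_def tilt dtilt by (simp add: algebra_simps)
    also have "real m * V ^ (m - 1) * V' * (V * F (x z)) + V ^ m * (V' * F (x z) + V * F' (x z) (x' z)) = L (Suc m) F F' z"
      unfolding L_def V_def[symmetric] V'_def[symmetric] by (cases m) (simp_all add: algebra_simps)
    finally show "L (Suc m) F F' z = \<beta> * L m F1 F1' z + \<beta>\<^sup>2 * L m F2 F2' z" by simp
  qed
  have b1: "\<bar>x z \<bullet> p\<bar> \<le> T" "\<bar>x' z \<bullet> p\<bar> \<le> T" for z
    using T1[of z] unfolding xp by simp_all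
  have b2: "\<bar>r * (x z \<bullet> x z)\<bar> \<le> T" "\<bar>r * (2 * (x z \<bullet> x' z))\<bar> \<le> T" for z
    using T2[of z] \<sigma> unfolding r_def by (simp_all add: abs_mult)
  have bound: "\<bar>A * F (x z)\<bar> \<le> T ^ Suc t" "\<bar>A' * F (x z) + A * F' (x z) (x' z)\<bar> \<le> real (Suc t) * T ^ Suc t"
    if "\<bar>A\<bar> \<le> T" "\<bar>A'\<bar> \<le> T" for A A' z
  proof -
    show "\<bar>A * F (x z)\<bar> \<le> T ^ Suc t"
      unfolding abs_mult power_Suc using that T0 Suc.prems(2)[of z] by (intro mult_mono) auto
    have "\<bar>A' * F (x z)\<bar> \<le> T * T ^ t"
      unfolding abs_mult using that T0 Suc.prems(2)[of z] by (intro mult_mono) auto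
    moreover have "\<bar>A * F' (x z) (x' z)\<bar> \<le> T * (real t * T ^ t)"
      unfolding abs_mult using that T0 Suc.prems(3)[of z] by (intro mult_mono) auto
    ultimately show "\<bar>A' * F (x z) + A * F' (x z) (x' z)\<bar> \<le> real (Suc t) * T ^ Suc t"
      by (simp add: algebra_simps) 
  qed
  have IH: "\<beta> ^ j * \<bar>expectation (L m F F')\<bar> \<le> \<beta> ^ k * 2 ^ m * real (m + Suc t) * T ^ (m + Suc t)"
    if "hom_poly j F F'" "\<And>z. \<bar>F (x z)\<bar> \<le> T ^ Suc t" "\<And>z. \<bar>F' (x z) (x' z)\<bar> \<le> real (Suc t) * T ^ Suc t" for j F F'
    using Suc.IH[OF that] unfolding L_def .
  have 1: "\<beta> ^ Suc j * \<bar>expectation (L m F1 F1')\<bar> \<le> \<beta> ^ k * 2 ^ m * real (m + Suc t) * T ^ (m + Suc t)"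
    using bound(1)[OF b1] bound(2)[OF b1] by (intro IH hp1) (simp_all add: F1_def F1'_def)
  have 2: "\<beta> ^ (j + 2) * \<bar>expectation (L m F2 F2')\<bar> \<le> \<beta> ^ k * 2 ^ m * real (m + Suc t) * T ^ (m + Suc t)"
    using bound(1)[OF b2] bound(2)[OF b2] by (intro IH hp2) (simp_all add: F2_def F2'_def algebra_simps)
  have "\<bar>expectation (L (Suc m) F F')\<bar> \<le> \<beta> * \<bar>expectation (L m F1 F1')\<bar> + \<beta>\<^sup>2 * \<bar>expectation (L m F2 F2')\<bar>"
    unfolding step using int[OF hp1] int[OF hp2] \<beta>
      abs_triangle_ineq[of "\<beta> * expectation (L m F1 F1')" "\<beta>\<^sup>2 * expectation (L m F2 F2')"]
    by (simp add: abs_mult)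
  then have "\<beta> ^ j * \<bar>expectation (L (Suc m) F F')\<bar> \<le> \<beta> ^ j * (\<beta> * \<bar>expectation (L m F1 F1')\<bar> + \<beta>\<^sup>2 * \<bar>expectation (L m F2 F2')\<bar>)"
    using \<beta> by (intro mult_left_mono) auto
  also have "\<dots> = \<beta> ^ Suc j * \<bar>expectation (L m F1 F1')\<bar> + \<beta> ^ (j + 2) * \<bar>expectation (L m F2 F2')\<bar>"
    by (simp add: power2_eq_square algebra_simps)
  also have "\<dots> \<le> \<beta> ^ k * 2 ^ Suc m * real (Suc m + t) * T ^ (Suc m + t)"
    using 1 2 by simp
  finally show ?case unfolding L_def .
qed

text \<open>The derivative along \<open>x'\<close> of the likelihood ratio \<open>lik\<close>
  introduced below.\<close>

definition dlik :: "real \<Rightarrow> real \<Rightarrow> real^'d \<Rightarrow> real" where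
  "dlik \<sigma> \<beta> y = expectation (\<lambda>z. dtilt \<sigma> \<beta> y (x z) (x' z) * exp (tilt \<sigma> \<beta> y (x z)))"

text \<open>In the Taylor expansion of the exponential the terms of order below \<open>k\<close> are
  handled by \<open>tilt_power_bound\<close>. The remainder is pointwise small because it contains
  \<open>k\<close> factors \<open>tilt\<close> and one factor \<open>dtilt\<close>, each of order
  \<open>\<beta>\<close>.\<close>

lemma dlik_bound:
  assumes k: "flat k" and \<sigma>: "\<sigma> > 0"
  obtains K C where "0 \<le> K"
    "\<And>\<beta> y. 0 < \<beta> \<Longrightarrow> \<beta> \<le> 1 \<Longrightarrow> \<bar>dlik \<sigma> \<beta> y\<bar> \<le> K * \<beta> ^ k * exp (C * norm y)"
proof
  \<comment> \<open>Chosen so that \<open>T = c * (1 + norm y)\<close> dominates all inner products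
    that occur: \<open>B\<close> serves those with \<open>y\<close>, \<open>B\<^sup>2\<close> those
    among the values of \<open>x\<close> and \<open>x'\<close>.\<close>
  define c where "c = (B + B\<^sup>2) / \<sigma>\<^sup>2"
  have c: "0 \<le> c" using B_nonneg by (simp add: c_def)
  define K where "K = (real k * real k + fact (Suc k)) * exp (4 * c)"
  show "0 \<le> K" by (simp add: K_def)
  show "\<bar>dlik \<sigma> \<beta> y\<bar> \<le> K * \<beta> ^ k * exp ((4 * c) * norm y)" if \<beta>: "0 < \<beta>" "\<beta> \<le> 1" for \<beta> y
  proof -
    define T where "T = c * (1 + norm y)"
    have T: "0 \<le> T" using c by (simp add: T_def)
    have yb: "\<bar>y \<bullet> v\<bar> / \<sigma>\<^sup>2 \<le> T" if "norm v \<le> B" for v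
    proof -
      have "\<bar>y \<bullet> v\<bar> \<le> norm y * B"
        using Cauchy_Schwarz_ineq2[of y v] mult_left_mono[OF that norm_ge_zero[of y]] by linarith
      also have "\<dots> \<le> (1 + norm y) * (B + B\<^sup>2)"
        using B_nonneg by (intro mult_mono) auto
      finally show ?thesis using \<sigma> by (simp add: T_def c_def field_simps)
    qed
    have xb: "\<bar>v \<bullet> w\<bar> / \<sigma>\<^sup>2 \<le> T" if "norm v \<le> B" "norm w \<le> B" for v w :: "real^'d"
    proof -
      have "\<bar>v \<bullet> w\<bar> \<le> B * B"
        using Cauchy_Schwarz_ineq2[of v w] mult_mono[OF that B_nonneg norm_ge_zero] by linarith
      also have "\<dots> \<le> (1 + norm y) * (B + B\<^sup>2)"
        using B_nonneg mult_mono[of 1 "1 + norm y" "B * B" "B + B\<^sup>2"] by (simp add: power2_eq_square)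
      finally show ?thesis using \<sigma> by (simp add: T_def c_def field_simps)
    qed
    have T1: "\<bar>y \<bullet> x z\<bar> / \<sigma>\<^sup>2 \<le> T" "\<bar>y \<bullet> x' z\<bar> / \<sigma>\<^sup>2 \<le> T" "\<bar>x z \<bullet> x' z\<bar> / \<sigma>\<^sup>2 \<le> T" for z
      using x_bound x'_bound by (auto intro: xb yb)
    have T2: "(x z \<bullet> x z) / (2 * \<sigma>\<^sup>2) \<le> T" for z
    proof -
      have "(x z \<bullet> x z) / (2 * \<sigma>\<^sup>2) \<le> \<bar>x z \<bullet> x z\<bar> / \<sigma>\<^sup>2"
        using \<sigma> by (simp add: field_simps)
      then show ?thesis using xb[OF x_bound x_bound, of z z] by linarith
    qed
    define W where "W z = tilt \<sigma> \<beta> y (x z)" for z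
    define V where "V z = dtilt \<sigma> \<beta> y (x z) (x' z)" for z
    have \<beta>2: "\<beta>\<^sup>2 \<le> \<beta>" using \<beta> by (simp add: power2_eq_square)
    have comb: "\<bar>\<beta> * p - \<beta>\<^sup>2 * q\<bar> \<le> \<beta> * (2 * T)" if "\<bar>p\<bar> \<le> T" "\<bar>q\<bar> \<le> T" for p q
    proof -
      have "\<bar>\<beta> * p\<bar> \<le> \<beta> * T" "\<bar>\<beta>\<^sup>2 * q\<bar> \<le> \<beta> * T"
        unfolding abs_mult using \<beta> \<beta>2 T that by (intro mult_mono; simp)+
      then show ?thesis by (simp add: algebra_simps)
    qed
    have Wb: "\<bar>W z\<bar> \<le> \<beta> * (2 * T)" for z
      using comb[of "(y \<bullet> x z) / \<sigma>\<^sup>2" "(x z \<bullet> x z) / (2 * \<sigma>\<^sup>2)"] T1(1)[of z] T2[of z]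
      by (simp add: W_def tilt_def)
    have Vb: "\<bar>V z\<bar> \<le> \<beta> * (2 * T)" for z
      using comb[of "(y \<bullet> x' z) / \<sigma>\<^sup>2" "(x z \<bullet> x' z) / \<sigma>\<^sup>2"] T1(2,3)[of z]
      by (simp add: V_def dtilt_def)
    have int: "integrable M (\<lambda>z. V z * W z ^ i)" for i
      unfolding V_def W_def
      by (rule integrable_tangent[of "\<lambda>u u'. dtilt \<sigma> \<beta> y u u' * tilt \<sigma> \<beta> y u ^ i"])
         (unfold tilt_def dtilt_def, intro continuous_intros; use \<sigma> in simp)
    have int_exp: "integrable M (\<lambda>z. V z * exp (W z))"
      unfolding V_def W_def
      by (rule integrable_tangent[of "\<lambda>u u'. dtilt \<sigma> \<beta> y u u' * exp (tilt \<sigma> \<beta> y u)"])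
         (unfold tilt_def dtilt_def, intro continuous_intros; use \<sigma> in simp)
    define r where "r z = exp (W z) - (\<Sum>i<k. W z ^ i / fact i)" for z
    have summand: "\<bar>expectation (\<lambda>z. V z * W z ^ i) / fact i\<bar> \<le> \<beta> ^ k * (real k * exp (2 * T))" if "i < k" for i
    proof -
      \<comment> \<open>Up to the factor \<open>Suc i\<close>, \<open>V z * W z ^ i\<close> is the
        derivative of \<open>W z ^ Suc i\<close>; so the polynomial is the constant
        \<open>1\<close>, with \<open>j = t = 0\<close>.\<close>
      have "\<bar>real (Suc i) * expectation (\<lambda>z. V z * W z ^ i)\<bar> \<le> \<beta> ^ k * 2 ^ Suc i * real (Suc i) * T ^ Suc i"
        using tilt_power_bound[OF k hom_poly_const[of 1] \<beta> \<sigma> T1(1,2) T2 T1(3), of 0 "Suc i"]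
        by (simp add: V_def W_def mult_ac del: of_nat_Suc power_Suc)
      then have "real (Suc i) * \<bar>expectation (\<lambda>z. V z * W z ^ i)\<bar> \<le> real (Suc i) * (\<beta> ^ k * (2 * T) ^ Suc i)"
        by (simp add: abs_mult power_mult_distrib mult_ac del: of_nat_Suc power_Suc)
      then have "\<bar>expectation (\<lambda>z. V z * W z ^ i)\<bar> \<le> \<beta> ^ k * (2 * T) ^ Suc i"
        by (rule mult_left_le_imp_le) simp
      also have "\<dots> \<le> \<beta> ^ k * (fact (Suc i) * exp (2 * T))"
        using \<beta> T by (intro mult_left_mono power_le_fact_exp) auto
      also have "\<dots> = \<beta> ^ k * (real (Suc i) * exp (2 * T)) * fact i"
        by (simp add: algebra_simps)
      also have "\<dots> \<le> \<beta> ^ k * (real k * exp (2 * T)) * fact i"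
        using that \<beta> by (intro mult_right_mono mult_left_mono) auto
      finally show ?thesis by (simp add: field_simps)
    qed
    have rb: "\<bar>V z * r z\<bar> \<le> \<beta> ^ k * (fact (Suc k) * exp (4 * T))" for z
    proof -
      have bT: "\<beta> * (2 * T) \<le> 2 * T" using \<beta> T by (intro mult_left_le_one_le) auto
      have "\<bar>V z * r z\<bar> \<le> (\<beta> * (2 * T)) * ((\<beta> * (2 * T)) ^ k * exp (2 * T))"
        unfolding abs_mult
      proof (rule mult_mono[OF Vb])
        have "\<bar>r z\<bar> \<le> \<bar>W z\<bar> ^ k * exp \<bar>W z\<bar>" unfolding r_def by (rule exp_taylor_bound)
        also have "\<dots> \<le> (\<beta> * (2 * T)) ^ k * exp (2 * T)"
          using Wb[of z] bT \<beta> T by (intro mult_mono power_mono) auto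
        finally show "\<bar>r z\<bar> \<le> (\<beta> * (2 * T)) ^ k * exp (2 * T)" .
      qed (use \<beta> T in auto)
      also have "\<dots> = \<beta> ^ Suc k * ((2 * T) ^ Suc k * exp (2 * T))"
        by (simp add: power_mult_distrib)
      also have "\<dots> \<le> \<beta> ^ k * ((fact (Suc k) * exp (2 * T)) * exp (2 * T))"
        using \<beta> T by (intro mult_mono power_decreasing power_le_fact_exp) auto
      also have "\<dots> = \<beta> ^ k * (fact (Suc k) * exp (4 * T))"
        by (simp add: mult_exp_exp)
      finally show ?thesis .
    qed
    have "V z * exp (W z) = (\<Sum>i<k. V z * W z ^ i / fact i) + V z * r z" for z
      by (simp add: r_def algebra_simps sum_distrib_left)
    then have "V z * r z = V z * exp (W z) - (\<Sum>i<k. V z * W z ^ i / fact i)" for z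
      by (simp add: algebra_simps)
    then have "expectation (\<lambda>z. V z * r z) = dlik \<sigma> \<beta> y - (\<Sum>i<k. expectation (\<lambda>z. V z * W z ^ i) / fact i)"
      using int int_exp unfolding dlik_def by (simp add: V_def W_def)
    then have "dlik \<sigma> \<beta> y = (\<Sum>i<k. expectation (\<lambda>z. V z * W z ^ i) / fact i) + expectation (\<lambda>z. V z * r z)"
      by simp
    also have "\<bar>\<dots>\<bar> \<le> (\<Sum>i<k. \<bar>expectation (\<lambda>z. V z * W z ^ i) / fact i\<bar>) + \<bar>expectation (\<lambda>z. V z * r z)\<bar>"
      by (intro order_trans[OF abs_triangle_ineq] add_mono sum_abs order_refl)
    also have "\<dots> \<le> (\<Sum>i<k. \<beta> ^ k * (real k * exp (2 * T))) + \<beta> ^ k * (fact (Suc k) * exp (4 * T))"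
      by (intro add_mono sum_mono summand abs_expectation_le rb) auto
    also have "\<dots> \<le> (\<Sum>i<k. \<beta> ^ k * (real k * exp (4 * T))) + \<beta> ^ k * (fact (Suc k) * exp (4 * T))"
      using \<beta> T by (intro add_mono sum_mono mult_left_mono) auto
    also have "\<dots> = K * \<beta> ^ k * exp ((4 * c) * norm y)"
      by (simp add: K_def T_def algebra_simps exp_add)
    finally show ?thesis .
  qed
qed

end

section \<open>Functions of at most exponential growth\<close>

text \<open>The constants are uniform in the index. Taking \<open>\<beta>\<close> as index gives
  bounds that persist as \<open>\<beta>\<close> tends to \<open>0\<close>; taking points of the
  probability space gives the domination needed for Fubini.\<close>

definition exp_bounded :: "'i set \<Rightarrow> ('i \<Rightarrow> 'b::real_normed_vector \<Rightarrow> real) \<Rightarrow> bool" where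
  "exp_bounded I f \<longleftrightarrow> (\<exists>K\<ge>0. \<exists>C\<ge>0. \<forall>i\<in>I. \<forall>y. \<bar>f i y\<bar> \<le> K * exp (C * norm y))"

lemma exp_boundedI:
  assumes "\<And>i y. i \<in> I \<Longrightarrow> \<bar>f i y\<bar> \<le> K * exp (C * norm y)"
  shows "exp_bounded I f"
proof -
  have "\<bar>f i y\<bar> \<le> \<bar>K\<bar> * exp (\<bar>C\<bar> * norm y)" if "i \<in> I" for i y
  proof -
    have "\<bar>f i y\<bar> \<le> K * exp (C * norm y)" using assms[OF that] .
    also have "\<dots> \<le> \<bar>K\<bar> * exp (\<bar>C\<bar> * norm y)"
      by (intro mult_mono) (auto intro!: mult_right_mono)
    finally show ?thesis .
  qed
  then show ?thesis unfolding exp_bounded_def by (meson abs_ge_zero)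
qed

lemma exp_bounded_mono:
  assumes "exp_bounded I g" "\<And>i y. i \<in> I \<Longrightarrow> \<bar>f i y\<bar> \<le> \<bar>g i y\<bar>"
  shows "exp_bounded I f"
  using assms unfolding exp_bounded_def by (meson order_trans)

lemma exp_bounded_reindex:
  assumes "exp_bounded I f" "\<And>j. j \<in> J \<Longrightarrow> \<phi> j \<in> I"
  shows "exp_bounded J (\<lambda>j. f (\<phi> j))"
  using assms unfolding exp_bounded_def by meson

lemma exp_bounded_const: "exp_bounded I (\<lambda>_ _. c)"
  by (rule exp_boundedI[of _ _ "\<bar>c\<bar>" 0]) simp

lemma exp_bounded_mult:
  assumes "exp_bounded I f" "exp_bounded I g"
  shows "exp_bounded I (\<lambda>i y. f i y * g i y)"
proof -
  obtain K C K' C' where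
    "0 \<le> K" "0 \<le> K'" "\<And>i y. i \<in> I \<Longrightarrow> \<bar>f i y\<bar> \<le> K * exp (C * norm y)"
    "\<And>i y. i \<in> I \<Longrightarrow> \<bar>g i y\<bar> \<le> K' * exp (C' * norm y)"
    using assms unfolding exp_bounded_def by meson
  then have "\<bar>f i y * g i y\<bar> \<le> (K * exp (C * norm y)) * (K' * exp (C' * norm y))" if "i \<in> I" for i y
    unfolding abs_mult using that by (intro mult_mono) auto
  then show ?thesis
    by (intro exp_boundedI[of _ _ "K * K'" "C + C'"]) (simp add: algebra_simps exp_add)
qed

lemma exp_bounded_power: "exp_bounded I f \<Longrightarrow> exp_bounded I (\<lambda>i y. f i y ^ n)"
  by (induction n) (simp_all add: exp_bounded_const exp_bounded_mult)

lemma (in prob_space) exp_bounded_expectation: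
  assumes "exp_bounded (I \<times> UNIV) f"
  shows "exp_bounded I (\<lambda>i y. expectation (\<lambda>z. f (i, z) y))"
proof -
  obtain K C where "\<And>p y. p \<in> I \<times> UNIV \<Longrightarrow> \<bar>f p y\<bar> \<le> K * exp (C * norm y)"
    using assms unfolding exp_bounded_def by meson
  then show ?thesis
    by (intro exp_boundedI[of _ _ K C] abs_expectation_le) auto
qed

text \<open>Up to the factor \<open>b i\<close> the bounded expression is \<open>dtilt\<close>; with
  \<open>u' = u\<close> and \<open>b i / 2\<close> in place of \<open>b i\<close> it is
  \<open>tilt\<close>.\<close>

lemma exp_bounded_tilt_aux:
  fixes u u' :: "'i \<Rightarrow> real^'d"
  assumes b: "\<And>i. i \<in> I \<Longrightarrow> \<bar>b i\<bar> \<le> 1" and u: "\<And>i. i \<in> I \<Longrightarrow> norm (u i) \<le> B"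
    and u': "\<And>i. i \<in> I \<Longrightarrow> norm (u' i) \<le> B"
  obtains c where "0 \<le> c" "\<And>i y. i \<in> I \<Longrightarrow> \<bar>(y \<bullet> u' i) / \<sigma>\<^sup>2 - b i * (u i \<bullet> u' i) / \<sigma>\<^sup>2\<bar> \<le> c * (1 + norm y)"
proof
  define B' where "B' = \<bar>B\<bar>"
  let ?c = "(B' + B'\<^sup>2) / \<sigma>\<^sup>2"
  have B': "0 \<le> B'" by (simp add: B'_def)
  show "0 \<le> ?c" using B' by simp
  fix i and y :: "real^'d" assume i: "i \<in> I"
  have n: "norm (u i) \<le> B'" "norm (u' i) \<le> B'" using u[OF i] u'[OF i] by (auto simp: B'_def)
  have "\<bar>y \<bullet> u' i\<bar> \<le> norm y * B'"
    using Cauchy_Schwarz_ineq2[of y "u' i"] mult_left_mono[OF n(2) norm_ge_zero[of y]] by linarith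
  moreover have "\<bar>b i * (u i \<bullet> u' i)\<bar> \<le> 1 * (B' * B')"
    unfolding abs_mult using b[OF i] n B' mult_mono[OF n B' norm_ge_zero]
      Cauchy_Schwarz_ineq2[of "u i" "u' i"] by (intro mult_mono) auto
  ultimately have "\<bar>y \<bullet> u' i - b i * (u i \<bullet> u' i)\<bar> \<le> norm y * B' + B' * B'" by linarith
  also have "\<dots> \<le> (B' + B'\<^sup>2) * (1 + norm y)"
    using B' by (simp add: algebra_simps power2_eq_square)
  finally have "\<bar>y \<bullet> u' i - b i * (u i \<bullet> u' i)\<bar> / \<sigma>\<^sup>2 \<le> (B' + B'\<^sup>2) * (1 + norm y) / \<sigma>\<^sup>2"
    by (intro divide_right_mono) auto
  then show "\<bar>(y \<bullet> u' i) / \<sigma>\<^sup>2 - b i * (u i \<bullet> u' i) / \<sigma>\<^sup>2\<bar> \<le> ?c * (1 + norm y)"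
    by (simp add: diff_divide_distrib[symmetric])
qed

lemma
  fixes u u' :: "'i \<Rightarrow> real^'d"
  assumes b: "\<And>i. i \<in> I \<Longrightarrow> \<bar>b i\<bar> \<le> 1" and u: "\<And>i. i \<in> I \<Longrightarrow> norm (u i) \<le> B"
  shows exp_bounded_exp_tilt: "exp_bounded I (\<lambda>i y. exp \<bar>tilt \<sigma> (b i) y (u i)\<bar>)"
    and exp_bounded_tilt_div: "exp_bounded I (\<lambda>i y. tilt \<sigma> (b i) y (u i) / b i)"
    and exp_bounded_dtilt: "(\<And>i. i \<in> I \<Longrightarrow> norm (u' i) \<le> B) \<Longrightarrow> exp_bounded I (\<lambda>i y. dtilt \<sigma> (b i) y (u i) (u' i))"
proof -
  have lin: "c * (1 + norm y) \<le> c * exp (1 * norm y)" if "0 \<le> c" for c and y :: "real^'d"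
    using exp_ge_add_one_self[of "norm y"] that by (intro mult_left_mono) auto
  have b2: "\<bar>b i / 2\<bar> \<le> 1" if "i \<in> I" for i using b[OF that] by simp
  obtain c where c: "0 \<le> c" "\<And>i y. i \<in> I \<Longrightarrow> \<bar>(y \<bullet> u i) / \<sigma>\<^sup>2 - (b i / 2) * (u i \<bullet> u i) / \<sigma>\<^sup>2\<bar> \<le> c * (1 + norm y)"
    using exp_bounded_tilt_aux[of I "\<lambda>i. b i / 2" u B u \<sigma>, OF b2 u u] by blast
  have t: "tilt \<sigma> (b i) y (u i) = b i * ((y \<bullet> u i) / \<sigma>\<^sup>2 - (b i / 2) * (u i \<bullet> u i) / \<sigma>\<^sup>2)" for i y
    unfolding tilt_def by (simp add: right_diff_distrib power2_eq_square)
  have "\<bar>tilt \<sigma> (b i) y (u i)\<bar> \<le> 1 * (c * (1 + norm y))" if "i \<in> I" for i y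
    unfolding t abs_mult using b[OF that] c(2)[OF that] by (intro mult_mono) auto
  then show "exp_bounded I (\<lambda>i y. exp \<bar>tilt \<sigma> (b i) y (u i)\<bar>)"
    by (intro exp_boundedI[of _ _ "exp c" c]) (simp add: algebra_simps flip: exp_add)
  have "\<bar>tilt \<sigma> (b i) y (u i) / b i\<bar> \<le> c * (1 + norm y)" if "i \<in> I" for i y
    unfolding t using c(1) c(2)[OF that, of y] by (cases "b i = 0") auto
  then show "exp_bounded I (\<lambda>i y. tilt \<sigma> (b i) y (u i) / b i)"
    using lin[OF c(1)] by (intro exp_boundedI[of _ _ c 1]) (meson order_trans)
  show "exp_bounded I (\<lambda>i y. dtilt \<sigma> (b i) y (u i) (u' i))" if u': "\<And>i. i \<in> I \<Longrightarrow> norm (u' i) \<le> B"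
  proof -
    obtain c where c: "0 \<le> c" "\<And>i y. i \<in> I \<Longrightarrow> \<bar>(y \<bullet> u' i) / \<sigma>\<^sup>2 - b i * (u i \<bullet> u' i) / \<sigma>\<^sup>2\<bar> \<le> c * (1 + norm y)"
      using exp_bounded_tilt_aux[of I b u B u' \<sigma>, OF b u u'] by blast
    have t: "dtilt \<sigma> (b i) y (u i) (u' i) = b i * ((y \<bullet> u' i) / \<sigma>\<^sup>2 - b i * (u i \<bullet> u' i) / \<sigma>\<^sup>2)" for i y
      unfolding dtilt_def by (simp add: right_diff_distrib power2_eq_square)
    have "\<bar>dtilt \<sigma> (b i) y (u i) (u' i)\<bar> \<le> 1 * (c * (1 + norm y))" if "i \<in> I" for i y
      unfolding t abs_mult using b[OF that] c(2)[OF that] by (intro mult_mono) auto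
    then show ?thesis
      using lin[OF c(1)] by (intro exp_boundedI[of _ _ c 1]) (metis mult_1 order_trans)
  qed
qed

lemma exp_bounded_abs_le_exp:
  "exp_bounded I (\<lambda>i y. exp \<bar>f i y\<bar>) \<Longrightarrow> exp_bounded I (\<lambda>i y. exp (f i y))"
  by (erule exp_bounded_mono) simp

lemma gauss_exp_bounded_integrable:
  fixes f :: "'i \<Rightarrow> real^'d \<Rightarrow> real"
  assumes \<sigma>: "\<sigma> > 0" and f: "exp_bounded I f" "i \<in> I" and [measurable]: "f i \<in> borel_measurable borel"
  shows "integrable lborel (\<lambda>y. gauss_density \<sigma> y * f i y)"
proof -
  obtain K C where "\<And>y. \<bar>f i y\<bar> \<le> K * exp (C * norm y)"
    using f unfolding exp_bounded_def by meson
  then have "gauss_density \<sigma> y * \<bar>f i y\<bar> \<le> gauss_density \<sigma> y * (K * exp (C * norm y))" for y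
    using gauss_density_pos[OF \<sigma>, of y] by (intro mult_left_mono) auto
  then have b: "norm (gauss_density \<sigma> y * f i y) \<le> K * (gauss_density \<sigma> y * exp (C * norm y))" for y
    using gauss_density_pos[OF \<sigma>, of y] by (simp add: abs_mult mult.left_commute)
  have int: "integrable lborel (\<lambda>y::real^'d. K * (gauss_density \<sigma> y * exp (C * norm y)))"
    by (intro integrable_mult_right gauss_exp_integrable \<sigma>)
  have "norm (gauss_density \<sigma> y * f i y) \<le> norm (K * (gauss_density \<sigma> y * exp (C * norm y)))" for y
    using b[of y] by (simp only: real_norm_def abs_le_D1 order_trans[OF _ abs_ge_self])
  then show ?thesis
    by (intro Bochner_Integration.integrable_bound[OF int] AE_I2) measurable
qed

text \<open>One Gaussian-integrable envelope dominates the whole family, so its integral serves for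
  all \<open>i\<close>.\<close>

lemma gauss_exp_bounded_integral:
  fixes f :: "'i \<Rightarrow> real^'d \<Rightarrow> real"
  assumes \<sigma>: "\<sigma> > 0" and f: "exp_bounded I f" and m: "\<And>i. i \<in> I \<Longrightarrow> f i \<in> borel_measurable borel"
  obtains C where "0 \<le> C" "\<And>i. i \<in> I \<Longrightarrow> \<bar>LINT y|lborel. gauss_density \<sigma> y * f i y\<bar> \<le> C"
proof -
  obtain K C where K: "0 \<le> K" "\<And>i y. i \<in> I \<Longrightarrow> \<bar>f i y\<bar> \<le> K * exp (C * norm y)"
    using f unfolding exp_bounded_def by meson
  have int: "integrable lborel (\<lambda>y::real^'d. gauss_density \<sigma> y * (K * exp (C * norm y)))"
    using integrable_mult_right[OF gauss_exp_integrable[OF \<sigma>, of C], of K] by (simp add: mult.left_commute)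
  show thesis
  proof
    show "0 \<le> (LINT y|lborel. gauss_density \<sigma> (y::real^'d) * (K * exp (C * norm y)))"
      by (intro integral_nonneg_AE AE_I2 mult_nonneg_nonneg K(1) less_imp_le[OF gauss_density_pos[OF \<sigma>]] exp_ge_zero)
    fix i assume i: "i \<in> I"
    have "\<bar>LINT y|lborel. gauss_density \<sigma> y * f i y\<bar> \<le> (LINT y|lborel. \<bar>gauss_density \<sigma> y * f i y\<bar>)"
      by (rule integral_abs_bound)
    also have "\<dots> \<le> (LINT y|lborel. gauss_density \<sigma> (y::real^'d) * (K * exp (C * norm y)))"
    proof (rule Bochner_Integration.integral_mono[OF _ int])
      show "integrable lborel (\<lambda>y. \<bar>gauss_density \<sigma> y * f i y\<bar>)"
        using gauss_exp_bounded_integrable[OF \<sigma> f i m[OF i]] by (rule Bochner_Integration.integrable_abs)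
      fix y :: "real^'d"
      show "\<bar>gauss_density \<sigma> y * f i y\<bar> \<le> gauss_density \<sigma> y * (K * exp (C * norm y))"
        unfolding abs_mult using K(2)[OF i] gauss_density_pos[OF \<sigma>, of y]
        by (intro mult_mono) (auto simp: less_imp_le)
    qed
    finally show "\<bar>LINT y|lborel. gauss_density \<sigma> y * f i y\<bar> \<le> (LINT y|lborel. gauss_density \<sigma> (y::real^'d) * (K * exp (C * norm y)))" .
  qed
qed

text \<open>The envelope depends on \<open>y\<close> alone, so its integrability carries over to the
  product with a probability space.\<close>

lemma (in prob_space) gauss_fubini:
  fixes f :: "'a \<Rightarrow> real^'d \<Rightarrow> real"
  assumes \<sigma>: "\<sigma> > 0" and f: "exp_bounded UNIV f"
    and [measurable]: "case_prod f \<in> borel_measurable (M \<Otimes>\<^sub>M borel)"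
  shows "(LINT y|lborel. gauss_density \<sigma> y * expectation (\<lambda>z. f z y))
    = expectation (\<lambda>z. LINT y|lborel. gauss_density \<sigma> y * f z y)"
proof -
  interpret pair_sigma_finite M "lborel :: (real^'d) measure" ..
  let ?f = "\<lambda>z y. gauss_density \<sigma> y * f z y"
  \<comment> \<open>Measurability is assumed with respect to \<open>borel\<close>, while Fubini
    works with \<open>lborel\<close>; the two have the same sets.\<close>
  have sets: "sets (M \<Otimes>\<^sub>M (lborel :: (real^'d) measure)) = sets (M \<Otimes>\<^sub>M borel)"
    by (intro sets_pair_measure_cong) auto
  have m [measurable]: "case_prod ?f \<in> borel_measurable (M \<Otimes>\<^sub>M lborel)"
    unfolding measurable_cong_sets[OF sets refl] by measurable
  obtain K C where K: "0 \<le> K" "\<And>z y. \<bar>f z y\<bar> \<le> K * exp (C * norm y)"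
    using f unfolding exp_bounded_def by auto
  define g where "g y = K * (gauss_density \<sigma> y * exp (C * norm y))" for y :: "real^'d"
  have g: "integrable lborel g"
    unfolding g_def by (intro integrable_mult_right gauss_exp_integrable \<sigma>)
  have bd: "norm (?f z y) \<le> g y" for z y
  proof -
    have "\<bar>gauss_density \<sigma> y * f z y\<bar> \<le> gauss_density \<sigma> y * (K * exp (C * norm y))"
      unfolding abs_mult using K gauss_density_pos[OF \<sigma>, of y] by (intro mult_mono) (auto simp: less_imp_le)
    then show ?thesis by (simp add: g_def mult_ac)
  qed
  have "integrable (M \<Otimes>\<^sub>M lborel) (\<lambda>p. g (snd p))"
  proof (rule Fubini_integrable)
    show "(\<lambda>p. g (snd p)) \<in> borel_measurable (M \<Otimes>\<^sub>M lborel)"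
      using borel_measurable_integrable[OF g] by measurable
  qed (use g in auto)
  then have "integrable (M \<Otimes>\<^sub>M lborel) (case_prod ?f)"
  proof (rule Bochner_Integration.integrable_bound)
    show "AE p in M \<Otimes>\<^sub>M lborel. norm (case_prod ?f p) \<le> norm (g (snd p))"
      by (intro AE_I2) (metis (mono_tags, lifting) bd case_prod_unfold order_trans abs_ge_self real_norm_def)
  qed measurable
  from Fubini_integral[OF this] show ?thesis by simp
qed

section \<open>Products of two tilted likelihood derivatives\<close>

text \<open>The mixed derivative of \<open>exp (s * (u \<bullet> v + u \<bullet> w + v \<bullet> w))\<close> in \<open>u\<close> and \<open>v\<close>, in directions \<open>u'\<close> and \<open>v'\<close>.\<close>

definition mixed_exp :: "real \<Rightarrow> real^'d \<Rightarrow> real^'d \<Rightarrow> real^'d \<Rightarrow> real^'d \<Rightarrow> real^'d \<Rightarrow> real" where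
  "mixed_exp s w u u' v v' = exp (s * (u \<bullet> v + u \<bullet> w + v \<bullet> w)) *
     (s * (u' \<bullet> v') + s\<^sup>2 * (u' \<bullet> (v + w)) * (v' \<bullet> (u + w)))"

text \<open>The same for the \<open>n\<close>-th power of \<open>u \<bullet> v + u \<bullet> w + v \<bullet> w\<close>.\<close>

definition mixed_power :: "nat \<Rightarrow> real^'d \<Rightarrow> real^'d \<Rightarrow> real^'d \<Rightarrow> real^'d \<Rightarrow> real^'d \<Rightarrow> real" where
  "mixed_power n w u u' v v' =
     real n * real (n - 1) * (u \<bullet> v + u \<bullet> w + v \<bullet> w) ^ (n - 2) * (u' \<bullet> (v + w)) * (v' \<bullet> (u + w))
     + real n * (u \<bullet> v + u \<bullet> w + v \<bullet> w) ^ (n - 1) * (u' \<bullet> v')"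

text \<open>The \<open>mixed_power\<close> terms are the termwise mixed derivatives of the
  exponential series. Separating the term with \<open>u' \<bullet> v'\<close> from the one with
  \<open>P * Q\<close> leaves two tails of the scalar exponential series.\<close>

lemma mixed_exp_taylor:
  fixes B :: real
  assumes k: "1 \<le> k" and s: "0 \<le> s" "s \<le> s0"
    and n: "norm w \<le> B" "norm u \<le> B" "norm u' \<le> B" "norm v \<le> B" "norm v' \<le> B"
  shows "\<bar>mixed_exp s w u u' v v' - (\<Sum>n\<le>k. s ^ n / fact n * mixed_power n w u u' v v')\<bar>
    \<le> s ^ Suc k * (exp (s0 * (3 * B\<^sup>2)) * (B\<^sup>2 * (3 * B\<^sup>2) ^ k + (2 * B\<^sup>2)\<^sup>2 * (3 * B\<^sup>2) ^ (k - 1)))"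
proof -
  define X where "X = u \<bullet> v + u \<bullet> w + v \<bullet> w"
  define P where "P = u' \<bullet> (v + w)"
  define Q where "Q = v' \<bullet> (u + w)"
  have B: "0 \<le> B" using n(1) norm_ge_zero order_trans by blast
  have i: "\<bar>a \<bullet> b\<bar> \<le> B\<^sup>2" if "norm a \<le> B" "norm b \<le> B" for a b :: "real^'a"
    using Cauchy_Schwarz_ineq2[of a b] mult_mono[OF that B norm_ge_zero] by (simp add: power2_eq_square)
  have Xb: "\<bar>X\<bar> \<le> 3 * B\<^sup>2"
    unfolding X_def using i[OF n(2) n(4)] i[OF n(2) n(1)] i[OF n(4) n(1)] by linarith
  have Pb: "\<bar>P\<bar> \<le> 2 * B\<^sup>2"
    unfolding P_def inner_add_right using i[OF n(3) n(4)] i[OF n(3) n(1)] by linarith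
  have Qb: "\<bar>Q\<bar> \<le> 2 * B\<^sup>2"
    unfolding Q_def inner_add_right using i[OF n(5) n(2)] i[OF n(5) n(1)] by linarith
  have eb: "\<bar>exp (s * X) - (\<Sum>i<j. (s * X) ^ i / fact i)\<bar> \<le> s ^ j * ((3 * B\<^sup>2) ^ j * exp (s0 * (3 * B\<^sup>2)))" for j
  proof -
    have "\<bar>s * X\<bar> \<le> s * (3 * B\<^sup>2)" using s Xb by (simp add: abs_mult mult_left_mono)
    moreover have "s * (3 * B\<^sup>2) \<le> s0 * (3 * B\<^sup>2)" using s by (intro mult_right_mono) auto
    ultimately have "\<bar>s * X\<bar> ^ j * exp \<bar>s * X\<bar> \<le> (s * (3 * B\<^sup>2)) ^ j * exp (s0 * (3 * B\<^sup>2))"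
      using s by (intro mult_mono power_mono) auto
    then show ?thesis
      using exp_taylor_bound[of "s * X" j] by (simp add: power_mult_distrib mult.assoc)
  qed
  \<comment> \<open>The terms with \<open>P * Q\<close> start at \<open>s\<^sup>2\<close>, so their
    series is cut one step earlier, after \<open>m = k - 1\<close> terms; both tails are then of
    order \<open>s ^ Suc k\<close>.\<close>
  obtain m where m: "k = Suc m" using k by (cases k) auto
  have "(\<Sum>n\<le>k. s ^ n / fact n * mixed_power n w u u' v v')
     = (\<Sum>n<k. s ^ Suc n / fact (Suc n) * (real (Suc n) * real n * X ^ (n - 1) * P * Q))
       + (\<Sum>n<k. s ^ Suc n / fact (Suc n) * (real (Suc n) * X ^ n * (u' \<bullet> v')))"
    unfolding sum.distrib[symmetric]
    by (simp only: lessThan_Suc_atMost[symmetric] sum.lessThan_Suc_shift)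
       (simp add: mixed_power_def X_def[symmetric] P_def[symmetric] Q_def[symmetric] distrib_left
         del: of_nat_Suc fact_Suc power_Suc)
  also have "(\<Sum>n<k. s ^ Suc n / fact (Suc n) * (real (Suc n) * X ^ n * (u' \<bullet> v')))
     = s * (u' \<bullet> v') * (\<Sum>i<k. (s * X) ^ i / fact i)"
    by (simp add: sum_distrib_left power_mult_distrib field_simps del: of_nat_Suc)
  also have "(\<Sum>n<k. s ^ Suc n / fact (Suc n) * (real (Suc n) * real n * X ^ (n - 1) * P * Q))
     = (\<Sum>n<m. s ^ Suc (Suc n) / fact (Suc (Suc n)) * (real (Suc (Suc n)) * real (Suc n) * X ^ n * P * Q))"
    unfolding m sum.lessThan_Suc_shift by (simp del: of_nat_Suc fact_Suc power_Suc)
  also have "\<dots> = s\<^sup>2 * P * Q * (\<Sum>i<m. (s * X) ^ i / fact i)"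
    by (simp add: sum_distrib_left power_mult_distrib field_simps power2_eq_square del: of_nat_Suc)
  finally have "mixed_exp s w u u' v v' - (\<Sum>n\<le>k. s ^ n / fact n * mixed_power n w u u' v v')
     = s * (u' \<bullet> v') * (exp (s * X) - (\<Sum>i<k. (s * X) ^ i / fact i))
       + s\<^sup>2 * P * Q * (exp (s * X) - (\<Sum>i<m. (s * X) ^ i / fact i))"
    unfolding mixed_exp_def X_def[symmetric] P_def[symmetric] Q_def[symmetric] by (simp add: algebra_simps)
  also have "\<bar>\<dots>\<bar> \<le> s * B\<^sup>2 * (s ^ k * ((3 * B\<^sup>2) ^ k * exp (s0 * (3 * B\<^sup>2))))
      + s\<^sup>2 * (2 * B\<^sup>2) * (2 * B\<^sup>2) * (s ^ m * ((3 * B\<^sup>2) ^ m * exp (s0 * (3 * B\<^sup>2))))"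
  proof (intro order_trans[OF abs_triangle_ineq] add_mono)
    show "\<bar>s * (u' \<bullet> v') * (exp (s * X) - (\<Sum>i<k. (s * X) ^ i / fact i))\<bar>
        \<le> s * B\<^sup>2 * (s ^ k * ((3 * B\<^sup>2) ^ k * exp (s0 * (3 * B\<^sup>2))))"
      unfolding abs_mult using s i[OF n(3) n(5)] by (intro mult_mono eb) auto
    show "\<bar>s\<^sup>2 * P * Q * (exp (s * X) - (\<Sum>i<m. (s * X) ^ i / fact i))\<bar>
        \<le> s\<^sup>2 * (2 * B\<^sup>2) * (2 * B\<^sup>2) * (s ^ m * ((3 * B\<^sup>2) ^ m * exp (s0 * (3 * B\<^sup>2))))"
      unfolding abs_mult using s by (intro mult_mono eb Pb Qb) auto
  qed
  also have "\<dots> = s ^ Suc k * (exp (s0 * (3 * B\<^sup>2)) * (B\<^sup>2 * (3 * B\<^sup>2) ^ k + (2 * B\<^sup>2)\<^sup>2 * (3 * B\<^sup>2) ^ (k - 1)))"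
    unfolding m by (simp add: algebra_simps power2_eq_square)
  finally show ?thesis .
qed

text \<open>Two directions at the same base point. In integrals over
  \<open>M \<Otimes>\<^sub>M M\<close> the first copy moves along \<open>h\<close> and the second
  along \<open>g\<close>; the third copy of the overview enters as the parameter
  \<open>w\<close>.\<close>

locale tangent_pair = H: random_tangent M x h B + G: random_tangent M x g B
  for M :: "'z measure" and x h g :: "'z \<Rightarrow> real^'d" and B
begin

sublocale PP: pair_prob_space M M ..

lemma
  fixes f :: "real^'d \<Rightarrow> real^'d \<Rightarrow> real^'d \<Rightarrow> real^'d \<Rightarrow> real"
  assumes "continuous_on UNIV (\<lambda>p. f (fst (fst p)) (snd (fst p)) (fst (snd p)) (snd (snd p)))"
  shows pair_integrable: "integrable (M \<Otimes>\<^sub>M M) (\<lambda>p. f (x (fst p)) (h (fst p)) (x (snd p)) (g (snd p)))"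
    and pair_integral_fst: "(LINT p|(M \<Otimes>\<^sub>M M). f (x (fst p)) (h (fst p)) (x (snd p)) (g (snd p)))
      = (LINT z'|M. (LINT z|M. f (x z) (h z) (x z') (g z')))"
    and pair_integral_snd: "(LINT p|(M \<Otimes>\<^sub>M M). f (x (fst p)) (h (fst p)) (x (snd p)) (g (snd p)))
      = (LINT z|M. (LINT z'|M. f (x z) (h z) (x z') (g z')))"
proof -
  let ?X = "\<lambda>p. ((x (fst p), h (fst p)), (x (snd p), g (snd p)))"
  have "norm (?X p) \<le> (B + B) + (B + B)" for p
    using norm_Pair_le[of "(x (fst p), h (fst p))" "(x (snd p), g (snd p))"]
      norm_Pair_le[of "x (fst p)" "h (fst p)"] norm_Pair_le[of "x (snd p)" "g (snd p)"]
      H.x_bound[of "fst p"] H.x'_bound[of "fst p"] G.x_bound[of "snd p"] G.x'_bound[of "snd p"]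
    by linarith
  from PP.P.integrable_continuous_bounded[OF _ this assms]
  show int: "integrable (M \<Otimes>\<^sub>M M) (\<lambda>p. f (x (fst p)) (h (fst p)) (x (snd p)) (g (snd p)))"
    by simp
  have int': "integrable (M \<Otimes>\<^sub>M M) (\<lambda>(z, z'). f (x z) (h z) (x z') (g z'))"
    using int by (simp only: case_prod_unfold)
  show "(LINT p|(M \<Otimes>\<^sub>M M). f (x (fst p)) (h (fst p)) (x (snd p)) (g (snd p)))
      = (LINT z'|M. (LINT z|M. f (x z) (h z) (x z') (g z')))"
    using PP.integral_snd[OF int'] by (simp only: case_prod_unfold)
  show "(LINT p|(M \<Otimes>\<^sub>M M). f (x (fst p)) (h (fst p)) (x (snd p)) (g (snd p)))
      = (LINT z|M. (LINT z'|M. f (x z) (h z) (x z') (g z')))"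
    using PP.integral_fst[OF int'] by (simp only: case_prod_unfold)
qed

definition pair_mixed_power :: "nat \<Rightarrow> real^'d \<Rightarrow> real" where
  "pair_mixed_power n w = (LINT p|(M \<Otimes>\<^sub>M M). mixed_power n w (x (fst p)) (h (fst p)) (x (snd p)) (g (snd p)))"

lemma continuous_mixed_power:
  "continuous_on UNIV (\<lambda>p. mixed_power n w (fst (fst p)) (snd (fst p)) (fst (snd p)) (snd (snd p)))"
  unfolding mixed_power_def by (intro continuous_intros)

lemma continuous_mixed_exp:
  "continuous_on UNIV (\<lambda>p. mixed_exp s w (fst (fst p)) (snd (fst p)) (fst (snd p)) (snd (snd p)))"
  unfolding mixed_exp_def by (intro continuous_intros)

text \<open>As a function of \<open>u\<close>, the base of the power is the affine function
  \<open>u \<bullet> (v + w) + v \<bullet> w\<close>, so \<open>flat_second\<close> applies and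
  discards the constants.\<close>

lemma mixed_power_flat_h:
  assumes "H.flat k" "n \<le> k"
  shows "(LINT z|M. mixed_power n w (x z) (h z) v v') = (if n < k then 0 else
      LINT z|M. real n * real (n - 1) * (x z \<bullet> (v + w)) ^ (n - 2) * (h z \<bullet> (v + w)) * (x z \<bullet> v')
        + real n * (x z \<bullet> (v + w)) ^ (n - 1) * (h z \<bullet> v'))"
  using H.flat_second[OF assms, of "v + w" "v \<bullet> w" v' "v' \<bullet> w"]
  by (simp add: mixed_power_def inner_add_right inner_commute[of v'] add.assoc)

lemma pair_mixed_power_eq_0:
  assumes "H.flat k" "n < k"
  shows "pair_mixed_power n w = 0"
proof -
  have "pair_mixed_power n w = (LINT z'|M. (LINT z|M. mixed_power n w (x z) (h z) (x z') (g z')))"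
    unfolding pair_mixed_power_def by (rule pair_integral_fst[OF continuous_mixed_power])
  then show ?thesis
    using assms by (simp add: mixed_power_flat_h[OF assms(1)])
qed

definition frob :: "nat \<Rightarrow> real" where
  "frob k = (\<Sum>is | length is = k. (LINT z|M. dmonom_at (x z) (h z) is) * (LINT z|M. dmonom_at (x z) (g z) is))"

text \<open>Flatness along \<open>h\<close> removes the offsets \<open>v \<bullet> w\<close> and
  \<open>v' \<bullet> w\<close>; after exchanging the integrals, flatness along \<open>g\<close>
  removes the remaining \<open>w\<close>. What is left is the mixed derivative of
  \<open>(u \<bullet> v) ^ k\<close>, a sum over words whose terms factor by independence. In
  particular the value does not depend on \<open>w\<close>.\<close>

lemma pair_mixed_power_eq_frob:
  assumes "H.flat k" "G.flat k"
  shows "pair_mixed_power k w = frob k"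
proof -
  let ?f = "\<lambda>u u' v v'. real k * real (k - 1) * (u \<bullet> (v + w)) ^ (k - 2) * (u' \<bullet> (v + w)) * (u \<bullet> v')
        + real k * (u \<bullet> (v + w)) ^ (k - 1) * (u' \<bullet> v')"
  have "pair_mixed_power k w = (LINT z'|M. (LINT z|M. mixed_power k w (x z) (h z) (x z') (g z')))"
    unfolding pair_mixed_power_def by (rule pair_integral_fst[OF continuous_mixed_power])
  also have "\<dots> = (LINT z'|M. (LINT z|M. ?f (x z) (h z) (x z') (g z')))"
    by (simp add: mixed_power_flat_h[OF assms(1)])
  \<comment> \<open>The copy that moves along \<open>g\<close> becomes the inner variable, so that
    flatness along \<open>g\<close> can act on it.\<close>
  also have "\<dots> = (LINT z|M. (LINT z'|M. ?f (x z) (h z) (x z') (g z')))"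
    by (subst pair_integral_fst[of ?f, symmetric], intro continuous_intros,
        rule pair_integral_snd[of ?f], intro continuous_intros)
  also have "\<dots> = (LINT z|M. (LINT z'|M. real k * real (k - 1) * (x z' \<bullet> x z) ^ (k - 2) * (g z' \<bullet> x z) * (x z' \<bullet> h z)
        + real k * (x z' \<bullet> x z) ^ (k - 1) * (g z' \<bullet> h z)))"
  proof (rule Bochner_Integration.integral_cong[OF refl])
    fix z
    show "(LINT z'|M. ?f (x z) (h z) (x z') (g z')) = (LINT z'|M. real k * real (k - 1) * (x z' \<bullet> x z) ^ (k - 2) * (g z' \<bullet> x z) * (x z' \<bullet> h z)
        + real k * (x z' \<bullet> x z) ^ (k - 1) * (g z' \<bullet> h z))"
      using G.flat_second[OF assms(2) order_refl, of "x z" "x z \<bullet> w" "h z" "h z \<bullet> w"]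
      by (simp add: inner_add_right inner_commute[of "x z" "x _"] inner_commute[of "h z" "x _"]
          inner_commute[of "x z" "g _"] inner_commute[of "h z" "g _"] mult_ac)
  qed
  also have "\<dots> = (LINT z|M. (LINT z'|M. (\<Sum>is | length is = k. dmonom_at (x z') (g z') is * dmonom_at (x z) (h z) is)))"
    unfolding sum_dmonom_at_mult ..
  also have "\<dots> = frob k"
  proof -
    have "integrable M (\<lambda>z. dmonom_at (x z) (g z) is)" "integrable M (\<lambda>z. dmonom_at (x z) (h z) is)" for "is"
      by (rule G.integrable_tangent, intro continuous_intros, rule H.integrable_tangent, intro continuous_intros)
    then show ?thesis by (simp add: frob_def mult.commute)
  qed
  finally show ?thesis .
qed

text \<open>Integrating the Taylor polynomial leaves only order \<open>k\<close>, since flatness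
  along \<open>h\<close> kills the lower orders. The constant is uniform in \<open>w\<close>, which
  later permits averaging over \<open>w\<close>.\<close>

lemma pair_mixed_exp_expansion:
  assumes "H.flat k" "1 \<le> k" "0 \<le> s0"
  obtains C where "0 \<le> C" "\<And>s w. 0 \<le> s \<Longrightarrow> s \<le> s0 \<Longrightarrow> norm w \<le> B \<Longrightarrow>
    \<bar>(LINT p|(M \<Otimes>\<^sub>M M). mixed_exp s w (x (fst p)) (h (fst p)) (x (snd p)) (g (snd p)))
      - s ^ k / fact k * pair_mixed_power k w\<bar> \<le> C * s ^ Suc k"
proof
  let ?C = "exp (s0 * (3 * B\<^sup>2)) * (B\<^sup>2 * (3 * B\<^sup>2) ^ k + (2 * B\<^sup>2)\<^sup>2 * (3 * B\<^sup>2) ^ (k - 1))"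
  show "0 \<le> ?C" by simp
  fix s :: real and w :: "real^'d" assume s: "0 \<le> s" "s \<le> s0" and w: "norm w \<le> B"
  let ?e = "\<lambda>p. mixed_exp s w (x (fst p)) (h (fst p)) (x (snd p)) (g (snd p))"
  let ?m = "\<lambda>n p. mixed_power n w (x (fst p)) (h (fst p)) (x (snd p)) (g (snd p))"
  have "(LINT p|(M \<Otimes>\<^sub>M M). ?e p - (\<Sum>n\<le>k. s ^ n / fact n * ?m n p))
      = (LINT p|(M \<Otimes>\<^sub>M M). ?e p) - (\<Sum>n\<le>k. s ^ n / fact n * pair_mixed_power n w)"
    using pair_integrable[OF continuous_mixed_exp] pair_integrable[OF continuous_mixed_power]
    by (simp add: pair_mixed_power_def)
  also have "(\<Sum>n\<le>k. s ^ n / fact n * pair_mixed_power n w) = (\<Sum>n\<in>{k}. s ^ n / fact n * pair_mixed_power n w)"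
    by (intro sum.mono_neutral_right) (auto simp: pair_mixed_power_eq_0[OF assms(1)])
  finally have "(LINT p|(M \<Otimes>\<^sub>M M). ?e p) - s ^ k / fact k * pair_mixed_power k w
      = (LINT p|(M \<Otimes>\<^sub>M M). ?e p - (\<Sum>n\<le>k. s ^ n / fact n * ?m n p))"
    by simp
  also have "\<bar>\<dots>\<bar> \<le> s ^ Suc k * ?C"
    using mixed_exp_taylor[OF assms(2) s w] H.x_bound H.x'_bound G.x_bound G.x'_bound
    by (intro PP.P.abs_expectation_le) auto
  finally show "\<bar>(LINT p|(M \<Otimes>\<^sub>M M). ?e p) - s ^ k / fact k * pair_mixed_power k w\<bar> \<le> ?C * s ^ Suc k"
    by (simp add: mult.commute)
qed

lemma pair_mixed_power_bounded:
  obtains C where "0 \<le> C" "\<And>w. norm w \<le> B \<Longrightarrow> \<bar>pair_mixed_power k w\<bar> \<le> C"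
proof -
  let ?f = "\<lambda>p. mixed_power k (snd p) (fst (fst (fst p))) (snd (fst (fst p))) (fst (snd (fst p))) (snd (snd (fst p)))"
  let ?S = "((cball 0 B \<times> cball 0 B) \<times> (cball 0 B \<times> cball 0 B)) \<times> cball (0::real^'d) B"
  have "bounded (?f ` ?S)"
    unfolding mixed_power_def
    by (intro compact_imp_bounded compact_continuous_image compact_Times compact_cball continuous_intros)
  then obtain C where C: "\<forall>p\<in>?S. \<bar>?f p\<bar> \<le> C"
    unfolding bounded_iff by auto
  have "\<bar>pair_mixed_power k w\<bar> \<le> \<bar>C\<bar>" if "norm w \<le> B" for w
    unfolding pair_mixed_power_def
  proof (rule PP.P.abs_expectation_le)
    fix p
    show "\<bar>mixed_power k w (x (fst p)) (h (fst p)) (x (snd p)) (g (snd p))\<bar> \<le> \<bar>C\<bar>"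
      using bspec[OF C, of "(((x (fst p), h (fst p)), (x (snd p), g (snd p))), w)"] that
        H.x_bound[of "fst p"] H.x'_bound[of "fst p"] G.x_bound[of "snd p"] G.x'_bound[of "snd p"]
      by (simp add: mem_cball_0)
  qed
  then show thesis by (intro that[of "\<bar>C\<bar>"]) auto
qed

end

section \<open>Expansion of the Fisher form\<close>

lemma tilt_measurable [measurable (raw)]:
  assumes [measurable]: "f \<in> borel_measurable N" "g \<in> borel_measurable N"
  shows "(\<lambda>p. tilt \<sigma> \<beta> (f p) (g p)) \<in> borel_measurable N"
  unfolding tilt_def by measurable

lemma dtilt_measurable [measurable (raw)]:
  assumes [measurable]: "f \<in> borel_measurable N" "g \<in> borel_measurable N" "h \<in> borel_measurable N"
  shows "(\<lambda>p. dtilt \<sigma> \<beta> (f p) (g p) (h p)) \<in> borel_measurable N"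
  unfolding dtilt_def by measurable

lemmas exp_bounded_exp_tilt' = exp_bounded_abs_le_exp[OF exp_bounded_exp_tilt]

context random_tangent
begin

lemma dlik_measurable [measurable]: "dlik \<sigma> \<beta> \<in> borel_measurable borel"
  unfolding dlik_def by measurable

text \<open>The \<open>q\<close> of the overview: the observation density divided by the centred
  Gaussian density.\<close>

definition lik :: "real \<Rightarrow> real \<Rightarrow> real^'d \<Rightarrow> real" where
  "lik \<sigma> \<beta> y = expectation (\<lambda>z. exp (tilt \<sigma> \<beta> y (x z)))"

lemma lik_measurable [measurable]: "lik \<sigma> \<beta> \<in> borel_measurable borel"
  unfolding lik_def by measurable

lemma integrable_exp_tilt: "integrable M (\<lambda>z. exp (tilt \<sigma> \<beta> y (x z)))"
proof -
  have "continuous_on UNIV (\<lambda>p. exp (\<beta> / \<sigma>\<^sup>2 * (y \<bullet> fst p) - \<beta>\<^sup>2 / (2 * \<sigma>\<^sup>2) * (fst p \<bullet> fst p)))"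
    by (intro continuous_intros)
  from integrable_tangent[OF this] show ?thesis by (simp add: tilt_def)
qed

lemma exp_bounded_dlik:
  assumes "\<bar>\<beta>\<bar> \<le> 1"
  shows "exp_bounded I (\<lambda>_. dlik \<sigma> \<beta>)"
proof -
  have "exp_bounded (I \<times> UNIV) (\<lambda>p y. dtilt \<sigma> \<beta> y (x (snd p)) (x' (snd p)) * exp (tilt \<sigma> \<beta> y (x (snd p))))"
    using x_bound x'_bound assms
    by (intro exp_bounded_mult exp_bounded_dtilt exp_bounded_exp_tilt') auto
  from exp_bounded_expectation[OF this] show ?thesis by (simp add: dlik_def[abs_def])
qed

text \<open>From \<open>\<bar>exp t - 1\<bar> \<le> \<bar>t\<bar> * exp \<bar>t\<bar>\<close>, where
  \<open>t\<close> is a tilt and hence of order \<open>\<beta>\<close>.\<close>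

lemma exp_bounded_lik_minus_1: "exp_bounded {0<..1} (\<lambda>\<beta> y. (lik \<sigma> \<beta> y - 1) / \<beta>)"
proof -
  have "exp_bounded ({0<..1} \<times> UNIV) (\<lambda>p y. (tilt \<sigma> (fst p) y (x (snd p)) / fst p) * exp \<bar>tilt \<sigma> (fst p) y (x (snd p))\<bar>)"
    using x_bound by (intro exp_bounded_mult exp_bounded_tilt_div exp_bounded_exp_tilt) auto
  then have "exp_bounded ({0<..1} \<times> UNIV) (\<lambda>p y. (exp (tilt \<sigma> (fst p) y (x (snd p))) - 1) / fst p)"
  proof (rule exp_bounded_mono)
    fix p y
    show "\<bar>(exp (tilt \<sigma> (fst p) y (x (snd p))) - 1) / fst p\<bar>
       \<le> \<bar>(tilt \<sigma> (fst p) y (x (snd p)) / fst p) * exp \<bar>tilt \<sigma> (fst p) y (x (snd p))\<bar>\<bar>"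
      using exp_taylor_bound[of "tilt \<sigma> (fst p) y (x (snd p))" 1]
      by (simp add: abs_mult divide_right_mono)
  qed
  from exp_bounded_expectation[OF this]
  have "exp_bounded {0<..1} (\<lambda>\<beta> y. expectation (\<lambda>z. (exp (tilt \<sigma> \<beta> y (x z)) - 1) / \<beta>))"
    by simp
  moreover have "expectation (\<lambda>z. (exp (tilt \<sigma> \<beta> y (x z)) - 1) / \<beta>) = (lik \<sigma> \<beta> y - 1) / \<beta>" for \<beta> y
    using integrable_exp_tilt[of \<sigma> \<beta> y] by (simp add: lik_def prob_space)
  ultimately show ?thesis by (simp only:)
qed

text \<open>An exponential upper bound on \<open>exp \<bar>tilt\<bar>\<close> is also a lower bound
  on \<open>exp tilt\<close>, and taking the expectation preserves it.\<close>

lemma exp_bounded_inverse_lik: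
  assumes "J \<subseteq> {-1..1}"
  shows "exp_bounded J (\<lambda>\<beta> y. 1 / lik \<sigma> \<beta> y)" "\<And>\<beta> y. \<beta> \<in> J \<Longrightarrow> 0 < lik \<sigma> \<beta> y"
proof -
  have "exp_bounded (J \<times> UNIV) (\<lambda>p y. exp \<bar>tilt \<sigma> (fst p) y (x (snd p))\<bar>)"
    using x_bound assms by (intro exp_bounded_exp_tilt) (auto simp: abs_le_iff)
  then obtain K C where K: "\<And>\<beta> z y. \<beta> \<in> J \<Longrightarrow> exp \<bar>tilt \<sigma> \<beta> y (x z)\<bar> \<le> K * exp (C * norm y)"
    unfolding exp_bounded_def by fastforce
  have *: "0 < 1 / (K * exp (C * norm y)) \<and> 1 / (K * exp (C * norm y)) \<le> lik \<sigma> \<beta> y" if "\<beta> \<in> J" for \<beta> y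
  proof -
    have pos: "0 < K * exp (C * norm y)" using K[OF that, of y undefined] by (rule less_le_trans[OF exp_gt_zero])
    have "1 / (K * exp (C * norm y)) \<le> exp (tilt \<sigma> \<beta> y (x z))" for z
    proof -
      have "1 / (K * exp (C * norm y)) \<le> 1 / exp \<bar>tilt \<sigma> \<beta> y (x z)\<bar>"
        using K[OF that] by (intro divide_left_mono) (auto intro: mult_pos_pos pos)
      also have "\<dots> \<le> exp (tilt \<sigma> \<beta> y (x z))"
        by (simp add: exp_minus[symmetric] divide_inverse)
      finally show ?thesis .
    qed
    then have "expectation (\<lambda>_. 1 / (K * exp (C * norm y))) \<le> lik \<sigma> \<beta> y"
      unfolding lik_def using integrable_exp_tilt by (intro Bochner_Integration.integral_mono) auto
    then show ?thesis using pos by (simp add: prob_space)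
  qed
  show pos: "0 < lik \<sigma> \<beta> y" if "\<beta> \<in> J" for \<beta> y using *[OF that, of y] by linarith
  show "exp_bounded J (\<lambda>\<beta> y. 1 / lik \<sigma> \<beta> y)"
  proof (rule exp_boundedI[of _ _ K C])
    fix \<beta> y assume \<beta>: "\<beta> \<in> J"
    have "1 / lik \<sigma> \<beta> y \<le> 1 / (1 / (K * exp (C * norm y)))"
      using *[OF \<beta>, of y] pos[OF \<beta>, of y] by (intro divide_left_mono) auto
    then show "\<bar>1 / lik \<sigma> \<beta> y\<bar> \<le> K * exp (C * norm y)"
      using pos[OF \<beta>, of y] by simp
  qed
qed

end

context tangent_pair
begin

text \<open>Taking \<open>w = 0\<close> gives the Gaussian integral of \<open>a b\<close>, and
  averaging over \<open>w = x z\<close> gives that of \<open>a b q\<close>, in the notation of the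
  overview.\<close>

definition weighted_form :: "real \<Rightarrow> real \<Rightarrow> real^'d \<Rightarrow> real" where
  "weighted_form \<sigma> \<beta> w = (LINT y|lborel. gauss_density \<sigma> y * (exp (tilt \<sigma> \<beta> y w) * (H.dlik \<sigma> \<beta> y * G.dlik \<sigma> \<beta> y)))"

definition fisher_form :: "real \<Rightarrow> real \<Rightarrow> real" where
  "fisher_form \<sigma> \<beta> = (LINT y|lborel. gauss_density \<sigma> y * (H.dlik \<sigma> \<beta> y * G.dlik \<sigma> \<beta> y / H.lik \<sigma> \<beta> y))"

text \<open>Both factors \<open>dlik\<close> are expectations; Fubini, applied to one after the
  other, moves the Gaussian integral inside, where \<open>gauss_tilt_moment\<close> evaluates
  it.\<close>

lemma weighted_form_eq:
  assumes \<sigma>: "\<sigma> > 0" and \<beta>: "\<bar>\<beta>\<bar> \<le> 1" and w: "norm w \<le> B"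
  shows "weighted_form \<sigma> \<beta> w =
    (LINT p|(M \<Otimes>\<^sub>M M). mixed_exp (\<beta>\<^sup>2 / \<sigma>\<^sup>2) w (x (fst p)) (h (fst p)) (x (snd p)) (g (snd p)))"
proof -
  have bw: "exp_bounded I (\<lambda>_ y. exp (tilt \<sigma> \<beta> y w))" for I :: "'z set"
    using w \<beta> by (intro exp_bounded_exp_tilt') auto
  have bh: "exp_bounded UNIV (\<lambda>z y. dtilt \<sigma> \<beta> y (x z) (h z) * exp (tilt \<sigma> \<beta> y (x z)))"
    using \<beta> H.x_bound H.x'_bound
    by (intro exp_bounded_mult exp_bounded_dtilt exp_bounded_exp_tilt') auto
  have bg: "exp_bounded UNIV (\<lambda>z y. dtilt \<sigma> \<beta> y (x z) (g z) * exp (tilt \<sigma> \<beta> y (x z)))"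
    using \<beta> G.x_bound G.x'_bound
    by (intro exp_bounded_mult exp_bounded_dtilt exp_bounded_exp_tilt') auto
  have bc: "exp_bounded UNIV (\<lambda>_ y. dtilt \<sigma> \<beta> y (x z) (g z) * exp (tilt \<sigma> \<beta> y (x z)))" for z
    using exp_bounded_reindex[OF bg, of UNIV "\<lambda>_. z"] by simp
  have "weighted_form \<sigma> \<beta> w = (LINT y|lborel. gauss_density \<sigma> y *
      (LINT z'|M. exp (tilt \<sigma> \<beta> y w) * H.dlik \<sigma> \<beta> y * (dtilt \<sigma> \<beta> y (x z') (g z') * exp (tilt \<sigma> \<beta> y (x z')))))"
    unfolding weighted_form_def G.dlik_def by (simp add: mult.assoc)
  also have "\<dots> = (LINT z'|M. (LINT y|lborel. gauss_density \<sigma> y *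
      (exp (tilt \<sigma> \<beta> y w) * H.dlik \<sigma> \<beta> y * (dtilt \<sigma> \<beta> y (x z') (g z') * exp (tilt \<sigma> \<beta> y (x z'))))))"
    by (intro H.gauss_fubini \<sigma> exp_bounded_mult bw bg H.exp_bounded_dlik \<beta>) measurable
  also have "\<dots> = (LINT z'|M. (LINT z|M. mixed_exp (\<beta>\<^sup>2 / \<sigma>\<^sup>2) w (x z) (h z) (x z') (g z')))"
  proof (rule Bochner_Integration.integral_cong[OF refl])
    fix z'
    let ?b = "\<lambda>y. dtilt \<sigma> \<beta> y (x z') (g z') * exp (tilt \<sigma> \<beta> y (x z'))"
    have "(LINT y|lborel. gauss_density \<sigma> y * (exp (tilt \<sigma> \<beta> y w) * H.dlik \<sigma> \<beta> y * ?b y))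
      = (LINT y|lborel. gauss_density \<sigma> y *
          (LINT z|M. exp (tilt \<sigma> \<beta> y w) * (dtilt \<sigma> \<beta> y (x z) (h z) * exp (tilt \<sigma> \<beta> y (x z))) * ?b y))"
      unfolding H.dlik_def by simp
    also have "\<dots> = (LINT z|M. (LINT y|lborel. gauss_density \<sigma> y *
          (exp (tilt \<sigma> \<beta> y w) * (dtilt \<sigma> \<beta> y (x z) (h z) * exp (tilt \<sigma> \<beta> y (x z))) * ?b y)))"
      by (intro H.gauss_fubini \<sigma> exp_bounded_mult[of _ "\<lambda>z y. _ z y * _ z y"] exp_bounded_mult bw bh bc) measurable
    also have "\<dots> = (LINT z|M. mixed_exp (\<beta>\<^sup>2 / \<sigma>\<^sup>2) w (x z) (h z) (x z') (g z'))"
      unfolding mixed_exp_def gauss_tilt_moment[OF \<sigma>, symmetric] by (simp only: mult.assoc)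
    finally show "(LINT y|lborel. gauss_density \<sigma> y * (exp (tilt \<sigma> \<beta> y w) * H.dlik \<sigma> \<beta> y * ?b y))
      = (LINT z|M. mixed_exp (\<beta>\<^sup>2 / \<sigma>\<^sup>2) w (x z) (h z) (x z') (g z'))" .
  qed
  also have "\<dots> = (LINT p|(M \<Otimes>\<^sub>M M). mixed_exp (\<beta>\<^sup>2 / \<sigma>\<^sup>2) w (x (fst p)) (h (fst p)) (x (snd p)) (g (snd p)))"
    by (rule pair_integral_fst[OF continuous_mixed_exp, symmetric])
  finally show ?thesis .
qed

text \<open>The exponent \<open>k + l + 2\<close> collects \<open>k\<close> and \<open>l\<close>
  from the two derivatives and \<open>2\<close> from the square of \<open>q - 1\<close>.\<close>

lemma exp_bounded_remainder:
  assumes "\<sigma> > 0" "H.flat k" "G.flat l"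
  shows "exp_bounded {0<..1} (\<lambda>\<beta> y. H.dlik \<sigma> \<beta> y * G.dlik \<sigma> \<beta> y * (H.lik \<sigma> \<beta> y - 1)\<^sup>2 / H.lik \<sigma> \<beta> y / \<beta> ^ (k + l + 2))"
proof -
  have h: "exp_bounded {0<..1} (\<lambda>\<beta> y. H.dlik \<sigma> \<beta> y / \<beta> ^ k)"
  proof -
    obtain K C where "\<And>\<beta> y. 0 < \<beta> \<Longrightarrow> \<beta> \<le> 1 \<Longrightarrow> \<bar>H.dlik \<sigma> \<beta> y\<bar> \<le> K * \<beta> ^ k * exp (C * norm y)"
      using H.dlik_bound[OF assms(2,1)] by metis
    then show ?thesis
      by (intro exp_boundedI[of _ _ K C]) (auto simp: field_simps)
  qed
  have g: "exp_bounded {0<..1} (\<lambda>\<beta> y. G.dlik \<sigma> \<beta> y / \<beta> ^ l)"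
  proof -
    obtain K C where "\<And>\<beta> y. 0 < \<beta> \<Longrightarrow> \<beta> \<le> 1 \<Longrightarrow> \<bar>G.dlik \<sigma> \<beta> y\<bar> \<le> K * \<beta> ^ l * exp (C * norm y)"
      using G.dlik_bound[OF assms(3,1)] by metis
    then show ?thesis
      by (intro exp_boundedI[of _ _ K C]) (auto simp: field_simps)
  qed
  have "exp_bounded {0<..1} (\<lambda>\<beta> y. (H.dlik \<sigma> \<beta> y / \<beta> ^ k) * (G.dlik \<sigma> \<beta> y / \<beta> ^ l)
      * ((H.lik \<sigma> \<beta> y - 1) / \<beta>)\<^sup>2 * (1 / H.lik \<sigma> \<beta> y))"
    by (intro exp_bounded_mult exp_bounded_power h g H.exp_bounded_lik_minus_1 H.exp_bounded_inverse_lik(1)) auto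
  then show ?thesis
    by (rule exp_bounded_mono) (simp add: power_add power_divide power2_eq_square mult_ac)
qed

text \<open>The form is twice \<open>weighted_form\<close> at \<open>0\<close>, minus its average
  over \<open>w = x z\<close>, plus a remainder. A common approximation \<open>t\<close> therefore
  enters as \<open>2 t - t\<close>, and its error as \<open>2 e + e\<close>.\<close>

lemma fisher_form_approx:
  assumes \<sigma>: "\<sigma> > 0" and flat: "H.flat k" "G.flat l"
    and approx: "\<And>\<beta> w. 0 < \<beta> \<Longrightarrow> \<beta> \<le> 1 \<Longrightarrow> norm w \<le> B \<Longrightarrow> \<bar>weighted_form \<sigma> \<beta> w - t \<beta>\<bar> \<le> e \<beta>"
  obtains C where "\<And>\<beta>. 0 < \<beta> \<Longrightarrow> \<beta> \<le> 1 \<Longrightarrow> \<bar>fisher_form \<sigma> \<beta> - t \<beta>\<bar> \<le> 3 * e \<beta> + C * \<beta> ^ (k + l + 2)"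
proof -
  let ?r = "\<lambda>\<beta> y. H.dlik \<sigma> \<beta> y * G.dlik \<sigma> \<beta> y * (H.lik \<sigma> \<beta> y - 1)\<^sup>2 / H.lik \<sigma> \<beta> y / \<beta> ^ (k + l + 2)"
  obtain C where C: "\<And>\<beta>. \<beta> \<in> {0<..1} \<Longrightarrow> \<bar>LINT y|lborel. gauss_density \<sigma> y * ?r \<beta> y\<bar> \<le> C"
    by (rule gauss_exp_bounded_integral[OF \<sigma> exp_bounded_remainder[OF \<sigma> flat]]) auto
  show thesis
  proof
    fix \<beta> :: real assume \<beta>: "0 < \<beta>" "\<beta> \<le> 1"
    then have \<beta>I: "\<beta> \<in> {0<..1}" and \<beta>1: "\<bar>\<beta>\<bar> \<le> 1" by auto
    let ?a = "H.dlik \<sigma> \<beta>" and ?b = "G.dlik \<sigma> \<beta>" and ?q = "H.lik \<sigma> \<beta>"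
    have q: "0 < ?q y" for y
      by (rule H.exp_bounded_inverse_lik(2)[of "{0<..1}"]) (use \<beta> in auto)
    have bab: "exp_bounded I (\<lambda>_ y. ?a y * ?b y)" for I :: "'z set"
      by (intro exp_bounded_mult H.exp_bounded_dlik G.exp_bounded_dlik \<beta>1)
    have bx: "exp_bounded UNIV (\<lambda>z y. exp (tilt \<sigma> \<beta> y (x z)))"
      using \<beta>1 H.x_bound by (intro exp_bounded_exp_tilt') auto
    have bq: "exp_bounded UNIV (\<lambda>_::'z. ?q)"
    proof -
      have "exp_bounded (UNIV \<times> UNIV) (\<lambda>p y. exp (tilt \<sigma> \<beta> y (x (snd p))))"
        by (rule exp_bounded_reindex[OF bx]) simp
      from H.exp_bounded_expectation[OF this] show ?thesis by (simp add: H.lik_def[abs_def])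
    qed
    have i1: "integrable lborel (\<lambda>y. gauss_density \<sigma> y * (?a y * ?b y))"
      by (rule gauss_exp_bounded_integrable[OF \<sigma> bab UNIV_I]) measurable
    have i2: "integrable lborel (\<lambda>y. gauss_density \<sigma> y * (?q y * (?a y * ?b y)))"
      by (rule gauss_exp_bounded_integrable[OF \<sigma> exp_bounded_mult[OF bq bab] UNIV_I]) measurable
    have i3: "integrable lborel (\<lambda>y. gauss_density \<sigma> y * ?r \<beta> y)"
      by (rule gauss_exp_bounded_integrable[OF \<sigma> exp_bounded_remainder[OF \<sigma> flat] \<beta>I]) measurable
    have w0: "weighted_form \<sigma> \<beta> 0 = (LINT y|lborel. gauss_density \<sigma> y * (?a y * ?b y))"
      by (simp add: weighted_form_def tilt_def)
    have wx: "(LINT z|M. weighted_form \<sigma> \<beta> (x z)) = (LINT y|lborel. gauss_density \<sigma> y * (?q y * (?a y * ?b y)))"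
    proof -
      have "(LINT y|lborel. gauss_density \<sigma> y * (?q y * (?a y * ?b y)))
         = (LINT y|lborel. gauss_density \<sigma> y * (LINT z|M. exp (tilt \<sigma> \<beta> y (x z)) * (?a y * ?b y)))"
        by (simp add: H.lik_def)
      also have "\<dots> = (LINT z|M. weighted_form \<sigma> \<beta> (x z))"
        unfolding weighted_form_def
        by (intro H.gauss_fubini \<sigma> exp_bounded_mult[OF bx bab]) measurable
      finally show ?thesis by simp
    qed
    have pt: "gauss_density \<sigma> y * (?a y * ?b y / ?q y) = 2 * (gauss_density \<sigma> y * (?a y * ?b y))
        - gauss_density \<sigma> y * (?q y * (?a y * ?b y)) + \<beta> ^ (k + l + 2) * (gauss_density \<sigma> y * ?r \<beta> y)" for y
    proof -
      \<comment> \<open>First-order expansion of the reciprocal at \<open>1\<close>, with exact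
        remainder.\<close>
      have "1 / ?q y = 2 - ?q y + (?q y - 1)\<^sup>2 / ?q y"
        using q[of y] by (simp add: field_simps power2_eq_square)
      then have "gauss_density \<sigma> y * (?a y * ?b y * (1 / ?q y)) = gauss_density \<sigma> y * (?a y * ?b y * (2 - ?q y + (?q y - 1)\<^sup>2 / ?q y))"
        by simp
      then show ?thesis using \<beta> by (simp add: algebra_simps)
    qed
    have lin: "(LINT y|lborel. 2 * f1 y - f2 y + c * f3 y) = 2 * (LINT y|lborel. f1 y) - (LINT y|lborel. f2 y) + c * (LINT y|lborel. f3 y)"
      if "integrable lborel f1" "integrable lborel f2" "integrable lborel f3" for f1 f2 f3 :: "real^'d \<Rightarrow> real" and c
      using that by simp
    have "fisher_form \<sigma> \<beta> = 2 * weighted_form \<sigma> \<beta> 0 - (LINT z|M. weighted_form \<sigma> \<beta> (x z))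
       + \<beta> ^ (k + l + 2) * (LINT y|lborel. gauss_density \<sigma> y * ?r \<beta> y)"
      unfolding fisher_form_def w0 wx pt by (rule lin[OF i1 i2 i3])
    moreover have "\<bar>weighted_form \<sigma> \<beta> 0 - t \<beta>\<bar> \<le> e \<beta>"
      using approx[OF \<beta>] H.B_nonneg by simp
    moreover have "\<bar>(LINT z|M. weighted_form \<sigma> \<beta> (x z)) - t \<beta>\<bar> \<le> e \<beta>"
    proof -
      have bd: "\<bar>weighted_form \<sigma> \<beta> (x z) - t \<beta>\<bar> \<le> e \<beta>" for z
        using approx[OF \<beta> H.x_bound] .
      have [measurable]: "(\<lambda>z. weighted_form \<sigma> \<beta> (x z)) \<in> borel_measurable M"
        unfolding weighted_form_def by measurable
      have "integrable M (\<lambda>z. weighted_form \<sigma> \<beta> (x z))"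
      proof (intro H.integrable_const_bound[of _ "\<bar>t \<beta>\<bar> + e \<beta>"] AE_I2)
        show "norm (weighted_form \<sigma> \<beta> (x z)) \<le> \<bar>t \<beta>\<bar> + e \<beta>" for z
          using bd[of z] unfolding real_norm_def by linarith
      qed measurable
      then have "(LINT z|M. weighted_form \<sigma> \<beta> (x z)) - t \<beta> = (LINT z|M. weighted_form \<sigma> \<beta> (x z) - t \<beta>)"
        by (simp add: H.prob_space)
      then show ?thesis using H.abs_expectation_le[OF bd] by simp
    qed
    moreover have "\<bar>\<beta> ^ (k + l + 2) * (LINT y|lborel. gauss_density \<sigma> y * ?r \<beta> y)\<bar> \<le> C * \<beta> ^ (k + l + 2)"
    proof -
      have "\<bar>\<beta> ^ n * I\<bar> \<le> C * \<beta> ^ n" if "\<bar>I\<bar> \<le> C" for I n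
        using mult_right_mono[OF that, of "\<beta> ^ n"] \<beta> by (simp add: abs_mult mult.commute)
      then show ?thesis using C[OF \<beta>I] .
    qed
    ultimately show "\<bar>fisher_form \<sigma> \<beta> - t \<beta>\<bar> \<le> 3 * e \<beta> + C * \<beta> ^ (k + l + 2)"
      by (simp add: abs_le_iff)
  qed
qed

text \<open>With both directions flat to order \<open>k\<close>, the leading coefficient of
  \<open>weighted_form\<close> is free of \<open>w\<close>, so it can serve as the common
  approximation. Both error terms are of order \<open>\<beta> ^ (2 * k + 2)\<close>.\<close>

lemma fisher_form_diagonal:
  assumes \<sigma>: "\<sigma> > 0" and flat: "H.flat k" "G.flat k" and k: "1 \<le> k"
  obtains C where "\<And>\<beta>. 0 < \<beta> \<Longrightarrow> \<beta> \<le> 1 \<Longrightarrow>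
    \<bar>fisher_form \<sigma> \<beta> - (\<beta>\<^sup>2 / \<sigma>\<^sup>2) ^ k / fact k * frob k\<bar> \<le> C * \<beta> ^ (2 * k + 2)"
proof -
  obtain C where C: "\<And>s w. 0 \<le> s \<Longrightarrow> s \<le> 1 / \<sigma>\<^sup>2 \<Longrightarrow> norm w \<le> B \<Longrightarrow>
    \<bar>(LINT p|(M \<Otimes>\<^sub>M M). mixed_exp s w (x (fst p)) (h (fst p)) (x (snd p)) (g (snd p)))
      - s ^ k / fact k * pair_mixed_power k w\<bar> \<le> C * s ^ Suc k"
    by (rule pair_mixed_exp_expansion[OF flat(1) k, of "1 / \<sigma>\<^sup>2"]) auto
  have "\<bar>weighted_form \<sigma> \<beta> w - (\<beta>\<^sup>2 / \<sigma>\<^sup>2) ^ k / fact k * frob k\<bar> \<le> C * (\<beta>\<^sup>2 / \<sigma>\<^sup>2) ^ Suc k"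
    if "0 < \<beta>" "\<beta> \<le> 1" "norm w \<le> B" for \<beta> w
    using C[of "\<beta>\<^sup>2 / \<sigma>\<^sup>2" w] that
    by (simp add: weighted_form_eq[OF \<sigma>] pair_mixed_power_eq_frob[OF flat] power_le_one divide_right_mono)
  from fisher_form_approx[OF \<sigma> flat this] obtain C' where
    C': "\<And>\<beta>. 0 < \<beta> \<Longrightarrow> \<beta> \<le> 1 \<Longrightarrow> \<bar>fisher_form \<sigma> \<beta> - (\<beta>\<^sup>2 / \<sigma>\<^sup>2) ^ k / fact k * frob k\<bar>
      \<le> 3 * (C * (\<beta>\<^sup>2 / \<sigma>\<^sup>2) ^ Suc k) + C' * \<beta> ^ (k + k + 2)" by blast
  have "3 * (C * (\<beta>\<^sup>2 / \<sigma>\<^sup>2) ^ Suc k) + C' * \<beta> ^ (k + k + 2) = (3 * C / (\<sigma>\<^sup>2) ^ Suc k + C') * \<beta> ^ (2 * k + 2)" for \<beta>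
  proof -
    have "(\<beta>\<^sup>2) ^ Suc k = \<beta> ^ (2 * k + 2)" by (subst power_mult[symmetric]) simp
    moreover have "k + k + 2 = 2 * k + 2" by simp
    ultimately show ?thesis by (simp only: power_divide) (simp add: algebra_simps)
  qed
  then show thesis using C' that by metis
qed

text \<open>Here the common approximation is \<open>0\<close>: flatness along \<open>h\<close> makes
  \<open>weighted_form\<close> of order \<open>s ^ k\<close>. The bound is meant for
  \<open>k\<close> being the larger of the two orders.\<close>

lemma fisher_form_off_diagonal:
  assumes \<sigma>: "\<sigma> > 0" and flat: "H.flat k" "G.flat l" and k: "1 \<le> k"
  obtains C where "\<And>\<beta>. 0 < \<beta> \<Longrightarrow> \<beta> \<le> 1 \<Longrightarrow> \<bar>fisher_form \<sigma> \<beta>\<bar> \<le> C * (\<beta> ^ (2 * k) + \<beta> ^ (k + l + 2))"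
proof -
  obtain C where C: "0 \<le> C" "\<And>s w. 0 \<le> s \<Longrightarrow> s \<le> 1 / \<sigma>\<^sup>2 \<Longrightarrow> norm w \<le> B \<Longrightarrow>
    \<bar>(LINT p|(M \<Otimes>\<^sub>M M). mixed_exp s w (x (fst p)) (h (fst p)) (x (snd p)) (g (snd p)))
      - s ^ k / fact k * pair_mixed_power k w\<bar> \<le> C * s ^ Suc k"
    by (rule pair_mixed_exp_expansion[OF flat(1) k, of "1 / \<sigma>\<^sup>2"]) auto
  obtain D where D: "0 \<le> D" "\<And>w. norm w \<le> B \<Longrightarrow> \<bar>pair_mixed_power k w\<bar> \<le> D"
    using pair_mixed_power_bounded[of k] by blast
  define c where "c = (C / \<sigma>\<^sup>2 + D) / (\<sigma>\<^sup>2) ^ k"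
  have "\<bar>weighted_form \<sigma> \<beta> w - 0\<bar> \<le> c * \<beta> ^ (2 * k)"
    if \<beta>: "0 < \<beta>" "\<beta> \<le> 1" and w: "norm w \<le> B" for \<beta> w
  proof -
    define s where "s = \<beta>\<^sup>2 / \<sigma>\<^sup>2"
    have s: "0 \<le> s" "s \<le> 1 / \<sigma>\<^sup>2" using \<beta> by (auto simp: s_def power_le_one divide_right_mono)
    have "s ^ k / fact k * \<bar>pair_mixed_power k w\<bar> \<le> s ^ k / 1 * D"
      using s D w by (intro mult_mono divide_left_mono) (auto simp: fact_ge_1)
    moreover have "C * s ^ Suc k \<le> C * (s ^ k * (1 / \<sigma>\<^sup>2))"
      using s C(1) by (simp only: power_Suc2) (intro mult_left_mono; simp)
    moreover have "\<bar>weighted_form \<sigma> \<beta> w\<bar> \<le> C * s ^ Suc k + \<bar>s ^ k / fact k * pair_mixed_power k w\<bar>"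
    proof -
      have "weighted_form \<sigma> \<beta> w = (LINT p|(M \<Otimes>\<^sub>M M). mixed_exp s w (x (fst p)) (h (fst p)) (x (snd p)) (g (snd p)))"
        unfolding s_def using \<beta> by (intro weighted_form_eq \<sigma> w) simp
      then show ?thesis using C(2)[OF s w] by linarith
    qed
    ultimately have "\<bar>weighted_form \<sigma> \<beta> w\<bar> \<le> s ^ k * (C / \<sigma>\<^sup>2 + D)"
      using s by (simp add: abs_mult algebra_simps)
    also have "\<dots> = c * \<beta> ^ (2 * k)"
      by (simp add: s_def c_def power_divide power_mult)
    finally show ?thesis by simp
  qed
  from fisher_form_approx[OF \<sigma> flat this] obtain C' where
    C': "\<And>\<beta>. 0 < \<beta> \<Longrightarrow> \<beta> \<le> 1 \<Longrightarrow> \<bar>fisher_form \<sigma> \<beta> - 0\<bar> \<le> 3 * (c * \<beta> ^ (2 * k)) + C' * \<beta> ^ (k + l + 2)" by blast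
  show thesis
  proof
    fix \<beta> :: real assume \<beta>: "0 < \<beta>" "\<beta> \<le> 1"
    have "3 * (c * \<beta> ^ (2 * k)) \<le> (3 * \<bar>c\<bar> + \<bar>C'\<bar>) * \<beta> ^ (2 * k)" "C' * \<beta> ^ (k + l + 2) \<le> (3 * \<bar>c\<bar> + \<bar>C'\<bar>) * \<beta> ^ (k + l + 2)"
      using \<beta> by (auto simp: mult.assoc[symmetric] intro!: mult_right_mono)
    then show "\<bar>fisher_form \<sigma> \<beta>\<bar> \<le> (3 * \<bar>c\<bar> + \<bar>C'\<bar>) * (\<beta> ^ (2 * k) + \<beta> ^ (k + l + 2))"
      using C'[OF \<beta>] by (simp add: distrib_left)
  qed
qed

end

section \<open>Differentiation under the expectation\<close>

lemma continuous_on_matrix_vector: "continuous_on S (\<lambda>B :: real^'m^'d. B *v v)"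
  unfolding matrix_vector_mult_def by (intro continuous_intros)

lemma matrix_vector_measurable:
  fixes A :: "'z \<Rightarrow> real^'m^'d"
  assumes "A \<in> borel_measurable M"
  shows "(\<lambda>z. A z *v v) \<in> borel_measurable M"
  using measurable_compose[OF assms borel_measurable_continuous_onI[OF continuous_on_matrix_vector]] .

text \<open>A bound on the operator norm at every point; \<open>ae_bounded_matrix_version\<close>
  below arranges it from the almost sure bound.\<close>

locale bounded_matrix = prob_space M for M :: "'z measure" +
  fixes A :: "'z \<Rightarrow> real^'m^'d" and R :: real
  assumes A_measurable: "A \<in> borel_measurable M"
    and A_bound: "norm (A z *v v) \<le> R * norm v"
begin

lemma Av_measurable [measurable]: "(\<lambda>z. A z *v v) \<in> borel_measurable M"
  using A_measurable by (rule matrix_vector_measurable)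

lemma R_mult_nonneg: "0 \<le> R * norm (v :: real^'m)"
  using A_bound[of undefined v] norm_ge_zero[of "A undefined *v v"] by linarith

lemma tangent: "random_tangent M (\<lambda>z. A z *v \<theta>) (\<lambda>z. A z *v h) (R * norm \<theta> + R * norm h)"
  by unfold_locales (auto intro: order_trans[OF A_bound] simp: R_mult_nonneg)

lemma tangent_pair:
  "tangent_pair M (\<lambda>z. A z *v \<theta>) (\<lambda>z. A z *v h) (\<lambda>z. A z *v g) (R * norm \<theta> + R * norm h + R * norm g)"
proof -
  have "norm (A z *v v) \<le> a + b" if "R * norm v \<le> a" "0 \<le> b" for z a b and v :: "real^'m"
    using A_bound[of z v] that by linarith
  moreover have "norm (A z *v v) \<le> a + b" if "0 \<le> a" "R * norm v \<le> b" for z a b and v :: "real^'m"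
    using A_bound[of z v] that by linarith
  ultimately show ?thesis
    by unfold_locales (auto simp: R_mult_nonneg)
qed

text \<open>All values of \<open>A z *v \<theta>'\<close> near \<open>\<theta>\<close> lie in one
  compact ball, on which the gradient of \<open>F\<close> is uniformly continuous. The linearization
  error is therefore small uniformly in \<open>z\<close>, and so is its expectation.\<close>

lemma has_derivative_expectation:
  fixes F :: "real^'d \<Rightarrow> real" and F' :: "real^'d \<Rightarrow> real^'d \<Rightarrow> real"
  assumes F: "\<And>u. (F has_derivative F' u) (at u)"
    and cont: "continuous_on UNIV (\<lambda>p. F' (fst p) (snd p))"
  shows "((\<lambda>\<theta>. expectation (\<lambda>z. F (A z *v \<theta>))) has_derivative
    (\<lambda>h. expectation (\<lambda>z. F' (A z *v \<theta>) (A z *v h)))) (at \<theta>)"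
  unfolding has_derivative_at_alt
proof (intro conjI allI impI)
  have lin: "linear (F' u)" for u
    using F[of u] by (simp add: has_derivative_linear)
  have contF: "continuous_on UNIV F"
    using F by (meson continuous_at_imp_continuous_on has_derivative_continuous)
  have int: "integrable M (\<lambda>z. F' (A z *v \<theta>) (A z *v h))" for \<theta> h
  proof -
    interpret random_tangent M "\<lambda>z. A z *v \<theta>" "\<lambda>z. A z *v h" "R * norm \<theta> + R * norm h" by (rule tangent)
    show ?thesis by (rule integrable_tangent[OF cont])
  qed
  have intF: "integrable M (\<lambda>z. F (A z *v \<theta>))" for \<theta>
    by (rule integrable_continuous_bounded[OF Av_measurable A_bound contF])
  show "bounded_linear (\<lambda>h. expectation (\<lambda>z. F' (A z *v \<theta>) (A z *v h)))"
    unfolding linear_conv_bounded_linear[symmetric]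
  proof (rule linearI)
    fix h g :: "real^'m" and c :: real
    show "expectation (\<lambda>z. F' (A z *v \<theta>) (A z *v (h + g)))
       = expectation (\<lambda>z. F' (A z *v \<theta>) (A z *v h)) + expectation (\<lambda>z. F' (A z *v \<theta>) (A z *v g))"
      using int by (simp add: matrix_vector_right_distrib linear_add[OF lin])
    show "expectation (\<lambda>z. F' (A z *v \<theta>) (A z *v (c *\<^sub>R h))) = c *\<^sub>R expectation (\<lambda>z. F' (A z *v \<theta>) (A z *v h))"
      using int by (simp add: matrix_vector_mult_scaleR linear_scale[OF lin])
  qed
  fix e :: real assume e: "0 < e"
  define S where "S = cball (0 :: real^'d) (R * norm \<theta> + \<bar>R\<bar>)"
  \<comment> \<open>The gradient of \<open>F\<close>; it turns joint continuity of \<open>F'\<close>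
    into uniform continuity of a vector-valued map on \<open>S\<close>.\<close>
  define G where "G u = (\<Sum>b\<in>Basis. F' u b *\<^sub>R b)" for u
  have F'G: "F' u v = v \<bullet> G u" for u v
  proof -
    have "F' u v = F' u (\<Sum>b\<in>Basis. (v \<bullet> b) *\<^sub>R b)" by (simp add: euclidean_representation)
    also have "\<dots> = (\<Sum>b\<in>Basis. (v \<bullet> b) * F' u b)"
      by (simp add: linear_sum[OF lin] linear_scale[OF lin])
    finally show ?thesis by (simp add: G_def inner_sum_right mult.commute)
  qed
  have "continuous_on S G"
    unfolding G_def
  proof (intro continuous_intros)
    fix b :: "real^'d"
    show "continuous_on S (\<lambda>u. F' u b)"
    proof -
      have "continuous_on S (\<lambda>u. (u, b))" by (intro continuous_intros)
      from continuous_on_compose2[OF cont this] show ?thesis by simp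
    qed
  qed
  then have "uniformly_continuous_on S G"
    by (rule compact_uniformly_continuous) (simp add: S_def)
  then obtain d where d: "d > 0" "\<And>u v. u \<in> S \<Longrightarrow> v \<in> S \<Longrightarrow> dist v u < d \<Longrightarrow> dist (G v) (G u) < e / (\<bar>R\<bar> + 1)"
    unfolding uniformly_continuous_on_def using e by (metis abs_ge_zero add_nonneg_pos divide_pos_pos zero_less_one)
  show "\<exists>d>0. \<forall>\<theta>'. norm (\<theta>' - \<theta>) < d \<longrightarrow>
     norm (expectation (\<lambda>z. F (A z *v \<theta>')) - expectation (\<lambda>z. F (A z *v \<theta>))
        - expectation (\<lambda>z. F' (A z *v \<theta>) (A z *v (\<theta>' - \<theta>)))) \<le> e * norm (\<theta>' - \<theta>)"
  \<comment> \<open>Distance at most \<open>1\<close> keeps the segment between the images inside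
    \<open>S\<close>; the second bound keeps it within the modulus of continuity
    \<open>d\<close>.\<close>
  proof (intro exI[of _ "min 1 (d / (\<bar>R\<bar> + 1))"] conjI allI impI)
    show "0 < min 1 (d / (\<bar>R\<bar> + 1))" using d(1) by simp
    fix \<theta>' assume \<theta>': "norm (\<theta>' - \<theta>) < min 1 (d / (\<bar>R\<bar> + 1))"
    let ?n = "norm (\<theta>' - \<theta>)"
    have n: "?n \<le> 1" "(\<bar>R\<bar> + 1) * ?n < d" using \<theta>' by (auto simp: field_simps)
    have Rn: "R * ?n \<le> (\<bar>R\<bar> + 1) * ?n" by (intro mult_right_mono) auto
    have bd: "\<bar>F (A z *v \<theta>') - F (A z *v \<theta>) - F' (A z *v \<theta>) (A z *v (\<theta>' - \<theta>))\<bar> \<le> e * ?n" for z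
    proof -
      let ?a = "A z *v \<theta>" and ?b = "A z *v \<theta>'"
      have diff: "?b - ?a = A z *v (\<theta>' - \<theta>)" by (simp add: matrix_vector_mult_diff_distrib)
      have nb: "norm (?b - ?a) \<le> (\<bar>R\<bar> + 1) * ?n"
        unfolding diff using A_bound[of z "\<theta>' - \<theta>"] Rn by linarith
      define L where "L = S \<inter> ball ?a d"
      have aS: "norm ?a \<le> R * norm \<theta>" by (rule A_bound)
      have "norm (F ?b - F ?a - F' ?a (?b - ?a)) \<le> norm (?b - ?a) * (e / (\<bar>R\<bar> + 1))"
      proof (rule differentiable_bound_linearization[where S = L])
        fix t :: real assume t: "t \<in> {0..1}"
        have le: "norm (t *\<^sub>R (?b - ?a)) \<le> norm (?b - ?a)" using t by (simp add: mult_left_le_one_le)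
        have "norm (?b - ?a) \<le> \<bar>R\<bar>"
        proof -
          have "norm (?b - ?a) \<le> R * ?n" unfolding diff by (rule A_bound)
          also have "\<dots> \<le> \<bar>R\<bar> * 1" using n(1) by (intro mult_mono) auto
          finally show ?thesis by simp
        qed
        then have "norm (?a + t *\<^sub>R (?b - ?a)) \<le> R * norm \<theta> + \<bar>R\<bar>"
          using norm_triangle_ineq[of ?a "t *\<^sub>R (?b - ?a)"] le aS by linarith
        moreover have "dist ?a (?a + t *\<^sub>R (?b - ?a)) < d"
          using le nb n(2) by (simp add: dist_norm)
        ultimately show "?a + t *\<^sub>R (?b - ?a) \<in> L" by (simp add: L_def S_def)
      next
        fix u assume "u \<in> L"
        show "(F has_derivative F' u) (at u within L)" using F by (rule has_derivative_at_withinI)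
      next
        fix u assume u: "u \<in> L"
        have "?a \<in> S" using aS by (simp add: S_def)
        then have "dist (G u) (G ?a) < e / (\<bar>R\<bar> + 1)"
          using u by (intro d(2)) (auto simp: L_def dist_commute)
        then have G: "norm (G u - G ?a) \<le> e / (\<bar>R\<bar> + 1)" by (simp add: dist_norm)
        show "onorm (F' u - F' ?a) \<le> e / (\<bar>R\<bar> + 1)"
        proof (rule onorm_le)
          fix v
          have "(F' u - F' ?a) v = v \<bullet> (G u - G ?a)" by (simp add: F'G inner_diff_right)
          then show "norm ((F' u - F' ?a) v) \<le> e / (\<bar>R\<bar> + 1) * norm v"
            using Cauchy_Schwarz_ineq2[of v "G u - G ?a"] mult_left_mono[OF G norm_ge_zero[of v]]
            by (simp add: mult.commute)
        qed
      next
        show "?a \<in> L" using aS d(1) by (simp add: L_def S_def)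
      qed
      also have "\<dots> \<le> ((\<bar>R\<bar> + 1) * ?n) * (e / (\<bar>R\<bar> + 1))"
        using nb e by (intro mult_right_mono) auto
      also have "\<dots> = e * ?n" by (simp add: field_simps)
      finally show ?thesis by (simp add: diff)
    qed
    have "expectation (\<lambda>z. F (A z *v \<theta>')) - expectation (\<lambda>z. F (A z *v \<theta>)) - expectation (\<lambda>z. F' (A z *v \<theta>) (A z *v (\<theta>' - \<theta>)))
      = expectation (\<lambda>z. F (A z *v \<theta>') - F (A z *v \<theta>) - F' (A z *v \<theta>) (A z *v (\<theta>' - \<theta>)))"
      using int intF by simp
    then show "norm (expectation (\<lambda>z. F (A z *v \<theta>')) - expectation (\<lambda>z. F (A z *v \<theta>))
        - expectation (\<lambda>z. F' (A z *v \<theta>) (A z *v (\<theta>' - \<theta>)))) \<le> e * ?n"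
      using abs_expectation_le[OF bd] by simp
  qed
qed

lemma dmoment_eq:
  "dmoment M A k \<theta> h is = (if length is = k then expectation (\<lambda>z. dmonom_at (A z *v \<theta>) (A z *v h) is) else 0)"
proof (cases "length is = k")
  case True
  have der: "((\<lambda>u. monom_at u is) has_derivative (\<lambda>v. dmonom_at u v is)) (at u)" for u :: "real^'d" and "is"
  proof (induction "is")
    case (Cons i "is")
    have "((\<lambda>u::real^'d. u $ i) has_derivative (\<lambda>v. v $ i)) (at u)"
      by (rule bounded_linear_imp_has_derivative[OF bounded_linear_vec_nth])
    from has_derivative_mult[OF this Cons] show ?case by (simp add: algebra_simps)
  qed simp
  have "((\<lambda>\<theta>. expectation (\<lambda>z. monom_at (A z *v \<theta>) is)) has_derivative
     (\<lambda>h. expectation (\<lambda>z. dmonom_at (A z *v \<theta>) (A z *v h) is))) (at \<theta>)"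
    by (rule has_derivative_expectation[OF der]) (intro continuous_intros)
  moreover have "moment M A k \<theta>' is = expectation (\<lambda>z. monom_at (A z *v \<theta>') is)" for \<theta>'
    using True by (simp add: moment_def tensor_power_def monom_at_def)
  ultimately have "((\<lambda>\<theta>'. moment M A k \<theta>' is) has_derivative
     (\<lambda>h. expectation (\<lambda>z. dmonom_at (A z *v \<theta>) (A z *v h) is))) (at \<theta>)"
    by simp
  from frechet_derivative_at[OF this, symmetric] True show ?thesis
    by (simp add: dmoment_def)
next
  case False
  then have "(\<lambda>\<theta>'. moment M A k \<theta>' is) = (\<lambda>_. 0)"
    by (simp add: moment_def tensor_power_def fun_eq_iff)
  then show ?thesis using False by (simp add: dmoment_def)
qed

lemma flat_iff_dmoment:
  "random_tangent.flat M (\<lambda>z. A z *v \<theta>) (\<lambda>z. A z *v h) k \<longleftrightarrow> (\<forall>j. 1 \<le> j \<and> j < k \<longrightarrow> dmoment M A j \<theta> h = (\<lambda>_. 0))"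
proof -
  interpret random_tangent M "\<lambda>z. A z *v \<theta>" "\<lambda>z. A z *v h" "R * norm \<theta> + R * norm h" by (rule tangent)
  show ?thesis
  proof (intro iffI allI impI)
    fix j assume "flat k" "1 \<le> j \<and> j < k"
    then show "dmoment M A j \<theta> h = (\<lambda>_. 0)" by (auto simp: flat_def dmoment_eq fun_eq_iff)
  next
    assume *: "\<forall>j. 1 \<le> j \<and> j < k \<longrightarrow> dmoment M A j \<theta> h = (\<lambda>_. 0)"
    show "flat k"
      unfolding flat_def
    proof (intro allI impI)
      fix "is" :: "'d list" assume l: "length is < k"
      show "expectation (\<lambda>z. dmonom_at (A z *v \<theta>) (A z *v h) is) = 0"
      proof (cases "is")
        case (Cons i js)
        then have "dmoment M A (length is) \<theta> h is = 0" using * l by simp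
        then show ?thesis by (simp add: dmoment_eq)
      qed simp
    qed
  qed
qed

lemma frobenius_dmoment:
  "frobenius k (dmoment M A k \<theta> h) (dmoment M A k \<theta> g) =
    tangent_pair.frob M (\<lambda>z. A z *v \<theta>) (\<lambda>z. A z *v h) (\<lambda>z. A z *v g) k"
proof -
  interpret tangent_pair M "\<lambda>z. A z *v \<theta>" "\<lambda>z. A z *v h" "\<lambda>z. A z *v g" "R * norm \<theta> + R * norm h + R * norm g"
    by (rule tangent_pair)
  show ?thesis by (simp add: frobenius_def frob_def dmoment_eq)
qed

end

section \<open>Score and Fisher information\<close>

context bounded_matrix
begin

abbreviation model_lik :: "real^'m \<Rightarrow> real \<Rightarrow> real \<Rightarrow> real^'d \<Rightarrow> real" where
  "model_lik \<theta> \<equiv> random_tangent.lik M (\<lambda>z. A z *v \<theta>)"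

abbreviation model_dlik :: "real^'m \<Rightarrow> real^'m \<Rightarrow> real \<Rightarrow> real \<Rightarrow> real^'d \<Rightarrow> real" where
  "model_dlik \<theta> h \<equiv> random_tangent.dlik M (\<lambda>z. A z *v \<theta>) (\<lambda>z. A z *v h)"

lemma obs_density_eq:
  assumes "\<sigma> > 0"
  shows "obs_density M A \<sigma> \<theta> \<beta> y = gauss_density \<sigma> y * model_lik \<theta> \<sigma> \<beta> y"
  unfolding obs_density_def random_tangent.lik_def[OF tangent[of \<theta> 0]] gauss_density_shift[OF assms]
  by simp

lemma has_derivative_model_lik:
  assumes "\<sigma> > 0"
  shows "((\<lambda>\<theta>. model_lik \<theta> \<sigma> \<beta> y) has_derivative (\<lambda>h. model_dlik \<theta> h \<sigma> \<beta> y)) (at \<theta>)"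
proof -
  have lik: "model_lik \<theta> \<sigma> \<beta> y = expectation (\<lambda>z. exp (tilt \<sigma> \<beta> y (A z *v \<theta>)))" for \<theta>
    by (rule random_tangent.lik_def[OF tangent[of \<theta> 0]])
  have dlik: "model_dlik \<theta> h \<sigma> \<beta> y = expectation (\<lambda>z. dtilt \<sigma> \<beta> y (A z *v \<theta>) (A z *v h) * exp (tilt \<sigma> \<beta> y (A z *v \<theta>)))" for h
    by (rule random_tangent.dlik_def[OF tangent])
  have "((\<lambda>u. tilt \<sigma> \<beta> y u) has_derivative (\<lambda>v. dtilt \<sigma> \<beta> y u v)) (at u)" for u
  proof -
    have "((\<lambda>u. \<beta> / \<sigma>\<^sup>2 * (y \<bullet> u) - \<beta>\<^sup>2 / (2 * \<sigma>\<^sup>2) * (u \<bullet> u)) has_derivative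
       (\<lambda>v. \<beta> / \<sigma>\<^sup>2 * (y \<bullet> v) - \<beta>\<^sup>2 / (2 * \<sigma>\<^sup>2) * (u \<bullet> v + v \<bullet> u))) (at u)"
      by (intro has_derivative_diff has_derivative_mult_right has_derivative_inner has_derivative_inner_right has_derivative_ident)
    moreover have "\<beta> / \<sigma>\<^sup>2 * (y \<bullet> v) - \<beta>\<^sup>2 / (2 * \<sigma>\<^sup>2) * (u \<bullet> v + v \<bullet> u) = dtilt \<sigma> \<beta> y u v" for v
      unfolding dtilt_def inner_commute[of v u] by simp
    moreover have "\<beta> / \<sigma>\<^sup>2 * (y \<bullet> u) - \<beta>\<^sup>2 / (2 * \<sigma>\<^sup>2) * (u \<bullet> u) = tilt \<sigma> \<beta> y u" for u
      by (simp add: tilt_def)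
    ultimately show ?thesis by (simp only:)
  qed
  then have der: "((\<lambda>u. exp (tilt \<sigma> \<beta> y u)) has_derivative (\<lambda>v. dtilt \<sigma> \<beta> y u v * exp (tilt \<sigma> \<beta> y u))) (at u)" for u
    using DERIV_compose_FDERIV[OF DERIV_exp] by blast
  have cont: "continuous_on UNIV (\<lambda>p. dtilt \<sigma> \<beta> y (fst p) (snd p) * exp (tilt \<sigma> \<beta> y (fst p)))"
    unfolding tilt_def dtilt_def by (intro continuous_intros; use assms in simp)
  show ?thesis
    using has_derivative_expectation[OF der cont, of \<theta>] unfolding lik dlik .
qed

lemma model_lik_pos:
  assumes "\<bar>\<beta>\<bar> \<le> 1"
  shows "0 < model_lik \<theta> \<sigma> \<beta> y"
proof -
  have "\<beta> \<in> {-1..1}" using assms by (simp add: abs_le_iff)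
  then show ?thesis by (rule random_tangent.exp_bounded_inverse_lik(2)[OF tangent[of \<theta> 0] order_refl])
qed

text \<open>The Gaussian factor of the density does not depend on the parameter, so it cancels in
  the logarithmic derivative.\<close>

lemma score_eq:
  assumes \<sigma>: "\<sigma> > 0" and \<beta>: "\<bar>\<beta>\<bar> \<le> 1"
  shows "score M A \<sigma> \<theta> \<beta> y = (\<Sum>b\<in>Basis. (model_dlik \<theta> b \<sigma> \<beta> y / model_lik \<theta> \<sigma> \<beta> y) *\<^sub>R b)" (is "_ = ?D")
    and inner_score: "h \<bullet> score M A \<sigma> \<theta> \<beta> y = model_dlik \<theta> h \<sigma> \<beta> y / model_lik \<theta> \<sigma> \<beta> y"
proof -
  let ?q = "model_lik \<theta> \<sigma> \<beta> y"
  have pos: "0 < gauss_density \<sigma> y" "0 < ?q"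
    using gauss_density_pos[OF \<sigma>] model_lik_pos[OF \<beta>] by auto
  have lin: "linear (\<lambda>h. model_dlik \<theta> h \<sigma> \<beta> y)"
    using has_derivative_model_lik[OF \<sigma>] by (rule has_derivative_linear)
  have D: "h \<bullet> ?D = model_dlik \<theta> h \<sigma> \<beta> y / ?q" for h
  proof -
    have "model_dlik \<theta> h \<sigma> \<beta> y = model_dlik \<theta> (\<Sum>b\<in>Basis. (h \<bullet> b) *\<^sub>R b) \<sigma> \<beta> y"
      by (simp add: euclidean_representation)
    also have "\<dots> = (\<Sum>b\<in>Basis. (h \<bullet> b) * model_dlik \<theta> b \<sigma> \<beta> y)"
      by (subst linear_sum[OF lin]) (simp only: linear_scale[OF lin] real_scaleR_def)
    finally show ?thesis
      by (simp add: inner_sum_right sum_divide_distrib mult.commute)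
  qed
  have "((\<lambda>\<theta>'. ln (gauss_density \<sigma> y * model_lik \<theta>' \<sigma> \<beta> y)) has_derivative
      (\<lambda>h. (gauss_density \<sigma> y * model_dlik \<theta> h \<sigma> \<beta> y) * inverse (gauss_density \<sigma> y * ?q))) (at \<theta>)"
  proof (rule has_derivative_ln)
    show "0 < gauss_density \<sigma> y * ?q" using pos by (rule mult_pos_pos)
    show "((\<lambda>\<theta>'. gauss_density \<sigma> y * model_lik \<theta>' \<sigma> \<beta> y) has_derivative
        (\<lambda>h. gauss_density \<sigma> y * model_dlik \<theta> h \<sigma> \<beta> y)) (at \<theta>)"
      by (rule has_derivative_mult_right[OF has_derivative_model_lik[OF \<sigma>]])
  qed
  also have "(\<lambda>h. (gauss_density \<sigma> y * model_dlik \<theta> h \<sigma> \<beta> y) * inverse (gauss_density \<sigma> y * ?q)) = (\<lambda>h. h \<bullet> ?D)"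
  proof
    fix h
    have "(c * d) * inverse (c * q) = d / q" if "0 < c" for c d q :: real
      using that by (simp add: field_simps)
    from this[OF pos(1)] show "(gauss_density \<sigma> y * model_dlik \<theta> h \<sigma> \<beta> y) * inverse (gauss_density \<sigma> y * ?q) = h \<bullet> ?D"
      unfolding D .
  qed
  finally have deriv: "GDERIV (\<lambda>\<theta>'. ln (obs_density M A \<sigma> \<theta>' \<beta> y)) \<theta> :> ?D"
    unfolding gderiv_def obs_density_eq[OF \<sigma>] .
  show "score M A \<sigma> \<theta> \<beta> y = ?D"
    unfolding score_def gradient_def
  proof (rule the_equality)
    show "GDERIV (\<lambda>\<theta>'. ln (obs_density M A \<sigma> \<theta>' \<beta> y)) \<theta> :> ?D" by (rule deriv)
  next
    fix D assume "GDERIV (\<lambda>\<theta>'. ln (obs_density M A \<sigma> \<theta>' \<beta> y)) \<theta> :> D"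
    then have eq: "(\<lambda>h. h \<bullet> D) = (\<lambda>h. h \<bullet> ?D)"
      using deriv unfolding gderiv_def by (rule has_derivative_unique)
    have "\<forall>h. h \<bullet> D = h \<bullet> ?D" by (intro allI fun_cong[OF eq])
    then show "D = ?D" by (simp only: vector_eq_ldot)
  qed
  then show "h \<bullet> score M A \<sigma> \<theta> \<beta> y = model_dlik \<theta> h \<sigma> \<beta> y / ?q"
    by (simp only: D)
qed

text \<open>The map sending a matrix \<open>B\<close> to \<open>h \<bullet> (B *v g)\<close> is
  bounded linear, so it passes through the matrix-valued integral. The density then cancels one of
  the two factors \<open>lik\<close> in the denominator.\<close>

lemma fisher_obs_eq:
  assumes \<sigma>: "\<sigma> > 0" and \<beta>: "\<bar>\<beta>\<bar> \<le> 1"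
  shows "h \<bullet> (fisher_obs M A \<sigma> \<theta> \<beta> *v g) =
    tangent_pair.fisher_form M (\<lambda>z. A z *v \<theta>) (\<lambda>z. A z *v h) (\<lambda>z. A z *v g) \<sigma> \<beta>"
proof -
  let ?q = "model_lik \<theta> \<sigma> \<beta>" and ?s = "score M A \<sigma> \<theta> \<beta>" and ?p = "obs_density M A \<sigma> \<theta> \<beta>"
  have q_meas [measurable]: "?q \<in> borel_measurable borel"
    by (rule random_tangent.lik_measurable[OF tangent[of \<theta> 0]])
  have d_meas [measurable]: "model_dlik \<theta> v \<sigma> \<beta> \<in> borel_measurable borel" for v
    by (rule random_tangent.dlik_measurable[OF tangent])
  have s_meas [measurable]: "?s \<in> borel_measurable borel"
    unfolding score_eq[OF \<sigma> \<beta>, abs_def] by measurable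
  have p_meas [measurable]: "?p \<in> borel_measurable borel"
    unfolding obs_density_eq[OF \<sigma>, abs_def] by measurable
  have p_nonneg: "0 \<le> ?p y" for y
    unfolding obs_density_eq[OF \<sigma>] using gauss_density_pos[OF \<sigma>, of y] model_lik_pos[OF \<beta>, of \<theta> \<sigma> y] by simp
  have prod: "?p y * ((u \<bullet> ?s y) * (v \<bullet> ?s y)) = gauss_density \<sigma> y * (model_dlik \<theta> u \<sigma> \<beta> y * model_dlik \<theta> v \<sigma> \<beta> y / ?q y)" for u v y
    unfolding inner_score[OF \<sigma> \<beta>] obs_density_eq[OF \<sigma>] using model_lik_pos[OF \<beta>, of \<theta> \<sigma> y]
    by (simp add: field_simps)
  have int: "integrable lborel (\<lambda>y. ?p y * ((u \<bullet> ?s y) * (v \<bullet> ?s y)))" for u v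
  proof -
    have "exp_bounded {\<beta>} (\<lambda>\<beta>' y. model_dlik \<theta> u \<sigma> \<beta> y * model_dlik \<theta> v \<sigma> \<beta> y * (1 / model_lik \<theta> \<sigma> \<beta>' y))"
      using \<beta> by (intro exp_bounded_mult random_tangent.exp_bounded_dlik[OF tangent]
        random_tangent.exp_bounded_inverse_lik(1)[OF tangent[of \<theta> 0]]) (auto simp: abs_le_iff)
    from gauss_exp_bounded_integrable[OF \<sigma> this, of \<beta>] show ?thesis
      unfolding prod by simp
  qed
  \<comment> \<open>Matrix units, which reduce measurability and integrability of the matrix-valued
    integrand to its scalar entries.\<close>
  define E where "E i j = (\<chi> a b. if a = i \<and> b = j then 1 else (0 :: real))" for i j :: 'm
  have mat: "(\<chi> i j. ?s y $ i * ?s y $ j) = (\<Sum>i\<in>UNIV. \<Sum>j\<in>UNIV. (?s y $ i * ?s y $ j) *\<^sub>R E i j)" for y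
  proof -
    have "(\<Sum>i\<in>UNIV. \<Sum>j\<in>UNIV. (?s y $ i * ?s y $ j) * (if a = i \<and> b = j then 1 else 0)) = ?s y $ a * ?s y $ b" for a b
    proof -
      have "(\<Sum>j\<in>UNIV. (?s y $ i * ?s y $ j) * (if a = i \<and> b = j then 1 else 0)) = (if a = i then ?s y $ i * ?s y $ b else 0)" for i
        by (cases "a = i") (simp_all add: if_distrib[of "(*) _"] cong: if_cong)
      then show ?thesis by simp
    qed
    then show ?thesis by (simp add: vec_eq_iff E_def)
  qed
  have axis: "v $ i = axis i 1 \<bullet> v" for i and v :: "real^'m" by (simp add: inner_axis')
  have mat_meas: "(\<lambda>y. \<chi> i j. ?s y $ i * ?s y $ j) \<in> borel_measurable lborel"
    unfolding mat unfolding axis by measurable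
  have mat_int: "integrable lborel (\<lambda>y. ?p y *\<^sub>R (\<chi> i j. ?s y $ i * ?s y $ j))"
    unfolding mat unfolding axis scaleR_sum_right scaleR_scaleR
    by (intro Bochner_Integration.integrable_sum integrable_scaleR_left int)
  have fisher: "fisher_obs M A \<sigma> \<theta> \<beta> = (LINT y|lborel. ?p y *\<^sub>R (\<chi> i j. ?s y $ i * ?s y $ j))"
    unfolding fisher_obs_def by (intro integral_density mat_meas AE_I2 p_nonneg) simp
  have bl: "bounded_linear (\<lambda>B :: real^'m^'m. h \<bullet> (B *v g))"
    unfolding linear_conv_bounded_linear[symmetric]
    by (intro linearI) (simp_all add: matrix_vector_mult_add_rdistrib inner_add_right scaleR_matrix_vector_assoc[symmetric])
  have form: "h \<bullet> ((\<chi> i j. v $ i * v $ j) *v g) = (h \<bullet> v) * (g \<bullet> v)" for v :: "real^'m"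
    by (simp add: matrix_vector_mult_def inner_vec_def sum_product sum_distrib_left mult_ac)
  have "h \<bullet> (fisher_obs M A \<sigma> \<theta> \<beta> *v g) = (LINT y|lborel. h \<bullet> ((?p y *\<^sub>R (\<chi> i j. ?s y $ i * ?s y $ j)) *v g))"
    unfolding fisher by (rule integral_bounded_linear[OF bl mat_int, symmetric])
  also have "\<dots> = (LINT y|lborel. ?p y * ((h \<bullet> ?s y) * (g \<bullet> ?s y)))"
    by (simp add: scaleR_matrix_vector_assoc[symmetric] form)
  also have "\<dots> = tangent_pair.fisher_form M (\<lambda>z. A z *v \<theta>) (\<lambda>z. A z *v h) (\<lambda>z. A z *v g) \<sigma> \<beta>"
    unfolding prod tangent_pair.fisher_form_def[OF tangent_pair] ..
  finally show ?thesis .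
qed

lemma fisher_form_swap:
  "tangent_pair.fisher_form M (\<lambda>z. A z *v \<theta>) (\<lambda>z. A z *v h) (\<lambda>z. A z *v g) =
   tangent_pair.fisher_form M (\<lambda>z. A z *v \<theta>) (\<lambda>z. A z *v g) (\<lambda>z. A z *v h)"
  unfolding tangent_pair.fisher_form_def[OF tangent_pair, abs_def] by (simp add: mult.commute)

end

text \<open>The vector described by \<open>fisher_obs_on\<close> is the orthogonal projection onto
  \<open>W\<close>, which exists and is unique; hence the definite description is
  meaningful.\<close>

lemma inner_fisher_obs_on:
  assumes W: "subspace W" and h: "h \<in> W"
  shows "h \<bullet> fisher_obs_on M A \<sigma> W \<theta> \<beta> g = h \<bullet> (fisher_obs M A \<sigma> \<theta> \<beta> *v g)"
proof -
  let ?v = "fisher_obs M A \<sigma> \<theta> \<beta> *v g"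
  let ?P = "\<lambda>u. u \<in> W \<and> (\<forall>h\<in>W. h \<bullet> u = h \<bullet> ?v)"
  obtain y z where yz: "y \<in> span W" "\<And>w. w \<in> span W \<Longrightarrow> orthogonal z w" "?v = y + z"
    using orthogonal_subspace_decomp_exists by blast
  have "?P y"
    using yz W by (auto simp: span_eq_iff[THEN iffD2] inner_add_right orthogonal_def inner_commute)
  moreover have "u = y" if "?P u" for u
  proof -
    have "u - y \<in> W" using that \<open>?P y\<close> W by (simp add: subspace_diff)
    then have "(u - y) \<bullet> (u - y) = 0"
      using that \<open>?P y\<close> by (simp add: inner_diff_right)
    then show ?thesis by simp
  qed
  ultimately have "?P (THE u. ?P u)" by (rule theI)
  then show ?thesis using h unfolding fisher_obs_on_def by blast
qed

section \<open>From bounds in \<open>\<beta>\<close> to asymptotics in the SNR\<close>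

lemma snr_powr:
  assumes "\<sigma> > 0" "\<beta> > 0"
  shows "snr \<sigma> \<beta> powr (real n / 2) = \<beta> ^ n / \<sigma> ^ n"
proof -
  have "snr \<sigma> \<beta> = (\<beta> / \<sigma>) powr 2"
    using assms by (simp add: snr_def power_divide powr_numeral)
  then have "snr \<sigma> \<beta> powr (real n / 2) = (\<beta> / \<sigma>) powr real n"
    by (simp add: powr_powr)
  then show ?thesis using assms by (simp add: powr_realpow power_divide)
qed

lemma snr_bigoI:
  assumes \<sigma>: "\<sigma> > 0" and f: "\<And>\<beta>. 0 < \<beta> \<Longrightarrow> \<beta> \<le> 1 \<Longrightarrow> \<bar>f \<beta>\<bar> \<le> C * \<beta> ^ n"
  shows "f \<in> O[at_right 0](\<lambda>\<beta>. snr \<sigma> \<beta> powr (real n / 2))"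
proof (rule bigoI)
  have "\<forall>\<^sub>F \<beta> in at_right 0. \<beta> \<in> {0<..<1::real}"
    by (rule eventually_at_right_real) simp
  then show "\<forall>\<^sub>F \<beta> in at_right 0. norm (f \<beta>) \<le> (C * \<sigma> ^ n) * norm (snr \<sigma> \<beta> powr (real n / 2))"
  proof eventually_elim
    case (elim \<beta>)
    then show ?case using f[of \<beta>] \<sigma> by (simp add: snr_powr)
  qed
qed

context bounded_matrix
begin

text \<open>The second claim covers both off-diagonal cases: its two conditions on \<open>n\<close>
  match the exponents \<open>2 * max k l\<close> and \<open>k + l + 2\<close> of the bound in
  \<open>\<beta>\<close>.\<close>

lemma fisher_obs_expansion:
  assumes \<sigma>: "\<sigma> > 0" and "1 \<le> k" "1 \<le> l" and W: "subspace W" and h: "h \<in> W"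
    and flat_h: "\<And>j. 1 \<le> j \<Longrightarrow> j < k \<Longrightarrow> dmoment M A j \<theta> h = (\<lambda>_. 0)"
    and flat_g: "\<And>j. 1 \<le> j \<Longrightarrow> j < l \<Longrightarrow> dmoment M A j \<theta> g = (\<lambda>_. 0)"
  shows "k = l \<Longrightarrow> (\<lambda>\<beta>. h \<bullet> fisher_obs_on M A \<sigma> W \<theta> \<beta> g
        - snr \<sigma> \<beta> ^ k / fact k * frobenius k (dmoment M A k \<theta> h) (dmoment M A k \<theta> g))
          \<in> O[at_right 0](\<lambda>\<beta>. snr \<sigma> \<beta> ^ (k + 1))"
    and "n \<le> k + l + 2 \<Longrightarrow> n \<le> 2 * max k l \<Longrightarrow> (\<lambda>\<beta>. h \<bullet> fisher_obs_on M A \<sigma> W \<theta> \<beta> g)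
          \<in> O[at_right 0](\<lambda>\<beta>. snr \<sigma> \<beta> powr (real n / 2))"
proof -
  let ?x = "\<lambda>z. A z *v \<theta>" and ?h = "\<lambda>z. A z *v h" and ?g = "\<lambda>z. A z *v g"
  have fh: "random_tangent.flat M ?x ?h k" and fg: "random_tangent.flat M ?x ?g l"
    using flat_h flat_g by (auto simp: flat_iff_dmoment)
  have eq: "h \<bullet> fisher_obs_on M A \<sigma> W \<theta> \<beta> g = tangent_pair.fisher_form M ?x ?h ?g \<sigma> \<beta>" if "0 < \<beta>" "\<beta> \<le> 1" for \<beta>
    unfolding inner_fisher_obs_on[OF W h] using that by (intro fisher_obs_eq \<sigma>) auto
  show "(\<lambda>\<beta>. h \<bullet> fisher_obs_on M A \<sigma> W \<theta> \<beta> g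
        - snr \<sigma> \<beta> ^ k / fact k * frobenius k (dmoment M A k \<theta> h) (dmoment M A k \<theta> g))
          \<in> O[at_right 0](\<lambda>\<beta>. snr \<sigma> \<beta> ^ (k + 1))" (is "?f \<in> _") if "k = l"
  proof -
    obtain C where C: "\<And>\<beta>. 0 < \<beta> \<Longrightarrow> \<beta> \<le> 1 \<Longrightarrow>
      \<bar>tangent_pair.fisher_form M ?x ?h ?g \<sigma> \<beta> - (\<beta>\<^sup>2 / \<sigma>\<^sup>2) ^ k / fact k * tangent_pair.frob M ?x ?h ?g k\<bar> \<le> C * \<beta> ^ (2 * k + 2)"
      using tangent_pair.fisher_form_diagonal[OF tangent_pair \<sigma> fh] fg \<open>k = l\<close> \<open>1 \<le> k\<close> by metis
    have "?f \<in> O[at_right 0](\<lambda>\<beta>. snr \<sigma> \<beta> powr (real (2 * k + 2) / 2))"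
      by (rule snr_bigoI[OF \<sigma>, of _ C]) (use C eq in \<open>simp add: snr_def frobenius_dmoment\<close>)
    also have "(\<lambda>\<beta>. snr \<sigma> \<beta> powr (real (2 * k + 2) / 2)) \<in> O[at_right 0](\<lambda>\<beta>. snr \<sigma> \<beta> ^ (k + 1))"
    proof (rule landau_o.bigI[of 1])
      have "\<forall>\<^sub>F \<beta> in at_right 0. \<beta> \<in> {0<..<1::real}"
        by (rule eventually_at_right_real) simp
      then show "\<forall>\<^sub>F \<beta> in at_right 0. norm (snr \<sigma> \<beta> powr (real (2 * k + 2) / 2)) \<le> 1 * norm (snr \<sigma> \<beta> ^ (k + 1))"
      proof eventually_elim
        case (elim \<beta>)
        then have "snr \<sigma> \<beta> > 0" using \<sigma> by (simp add: snr_def)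
        moreover have "real (2 * k + 2) / 2 = real (k + 1)" by simp
        ultimately show ?case by (simp only: powr_realpow mult_1 order_refl)
      qed
    qed simp
    finally show ?thesis .
  qed
  assume n: "n \<le> k + l + 2" "n \<le> 2 * max k l"
  obtain C where C: "\<And>\<beta>. 0 < \<beta> \<Longrightarrow> \<beta> \<le> 1 \<Longrightarrow>
      \<bar>tangent_pair.fisher_form M ?x ?h ?g \<sigma> \<beta>\<bar> \<le> C * (\<beta> ^ (2 * max k l) + \<beta> ^ (k + l + 2))"
  proof (cases "l \<le> k")
    case True
    then show thesis
      using tangent_pair.fisher_form_off_diagonal[OF tangent_pair \<sigma> fh fg \<open>1 \<le> k\<close>] that by (metis max.absorb1)
  next
    \<comment> \<open>The off-diagonal bound is governed by the order of its first direction, so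
      \<open>h\<close> and \<open>g\<close> change places.\<close>
    case False
    then have "max k l = l" "k + l + 2 = l + k + 2" by auto
    then show thesis
      using tangent_pair.fisher_form_off_diagonal[OF tangent_pair \<sigma> fg fh \<open>1 \<le> l\<close>] that
      unfolding fisher_form_swap[of \<theta> h g] by metis
  qed
  show "(\<lambda>\<beta>. h \<bullet> fisher_obs_on M A \<sigma> W \<theta> \<beta> g) \<in> O[at_right 0](\<lambda>\<beta>. snr \<sigma> \<beta> powr (real n / 2))"
  proof (rule snr_bigoI[OF \<sigma>])
    fix \<beta> :: real assume \<beta>: "0 < \<beta>" "\<beta> \<le> 1"
    have "\<beta> ^ (2 * max k l) \<le> \<beta> ^ n"
      by (rule power_decreasing[OF n(2)]) (use \<beta> in auto)
    moreover have "\<beta> ^ (k + l + 2) \<le> \<beta> ^ n"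
      by (rule power_decreasing[OF n(1)]) (use \<beta> in auto)
    ultimately have "\<beta> ^ (2 * max k l) + \<beta> ^ (k + l + 2) \<le> 2 * \<beta> ^ n" by linarith
    then have "\<bar>C\<bar> * (\<beta> ^ (2 * max k l) + \<beta> ^ (k + l + 2)) \<le> \<bar>C\<bar> * (2 * \<beta> ^ n)"
      by (rule mult_left_mono) simp
    moreover have "C * (\<beta> ^ (2 * max k l) + \<beta> ^ (k + l + 2)) \<le> \<bar>C\<bar> * (\<beta> ^ (2 * max k l) + \<beta> ^ (k + l + 2))"
      using \<beta> by (intro mult_right_mono) auto
    ultimately show "\<bar>h \<bullet> fisher_obs_on M A \<sigma> W \<theta> \<beta> g\<bar> \<le> 2 * \<bar>C\<bar> * \<beta> ^ n"
      using C[OF \<beta>] eq[OF \<beta>] by simp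
  qed
qed

end

section \<open>From an almost sure to an everywhere bound on the matrices\<close>

lemma ae_bounded_matrix_version:
  fixes A :: "'z \<Rightarrow> real^'m^'d"
  assumes "prob_space M" and A: "A \<in> borel_measurable M" and a: "AE z in M. onorm (\<lambda>v. A z *v v) \<le> a"
  obtains A' where "bounded_matrix M A' \<bar>a\<bar>" "AE z in M. A z = A' z"
proof -
  \<comment> \<open>The bound is imposed for every vector, an intersection of closed conditions on
    the matrix, so \<open>G\<close> is a Borel set.\<close>
  define G where "G = {B :: real^'m^'d. \<forall>v. norm (B *v v) \<le> \<bar>a\<bar> * norm v}"
  have "closed G"
    unfolding G_def
    by (intro closed_Collect_all closed_Collect_le continuous_on_norm continuous_on_matrix_vector continuous_on_const)
  then have [measurable]: "G \<in> sets borel" by simp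
  note A [measurable]
  define A' where "A' z = (if A z \<in> G then A z else 0)" for z
  have m: "A' \<in> borel_measurable M"
    unfolding A'_def by measurable
  have b: "norm (A' z *v v) \<le> \<bar>a\<bar> * norm v" for z v
    by (auto simp: A'_def G_def)
  have "AE z in M. A z = A' z"
    using a
  proof eventually_elim
    case (elim z)
    have "norm (A z *v v) \<le> \<bar>a\<bar> * norm v" for v
    proof -
      have "norm (A z *v v) \<le> onorm (\<lambda>v. A z *v v) * norm v"
        by (rule onorm) (rule matrix_vector_mul_bounded_linear)
      also have "\<dots> \<le> \<bar>a\<bar> * norm v" using elim by (intro mult_right_mono) auto
      finally show ?thesis .
    qed
    then show ?case by (simp add: A'_def G_def)
  qed
  moreover have "bounded_matrix M A' \<bar>a\<bar>"
    unfolding bounded_matrix_def bounded_matrix_axioms_def using assms(1) m b by blast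
  ultimately show thesis using that by blast
qed

text \<open>Moments and densities see \<open>A\<close> only through integrals over \<open>z\<close>,
  so a change on a null set has no effect on them.\<close>

lemma
  fixes A A' :: "'z \<Rightarrow> real^'m^'d"
  assumes [measurable]: "A \<in> borel_measurable M" "A' \<in> borel_measurable M" and eq: "AE z in M. A z = A' z"
  shows moment_cong_AE: "moment M A = moment M A'"
    and obs_density_cong_AE: "obs_density M A = obs_density M A'"
proof -
  note [measurable] = matrix_vector_measurable[OF assms(1)] matrix_vector_measurable[OF assms(2)]
  have tp: "tensor_power k v is = (if length is = k then monom_at v is else 0)" for k "is" and v :: "real^'d"
    by (simp add: tensor_power_def monom_at_def)
  have [measurable]: "(\<lambda>v :: real^'d. tensor_power k v is) \<in> borel_measurable borel" for k "is"
    unfolding tp by (cases "length is = k") (auto intro!: borel_measurable_continuous_onI continuous_intros)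
  show "moment M A = moment M A'"
    unfolding moment_def[abs_def]
    by (intro ext integral_cong_AE) (use eq in \<open>auto elim!: AE_mp\<close>)
  show "obs_density M A = obs_density M A'"
    unfolding obs_density_def[abs_def]
    by (intro ext integral_cong_AE) (use eq in \<open>auto elim!: AE_mp\<close>)
qed

theorem proposition3p13:
  fixes M :: "'z measure"
    and A :: "'z \<Rightarrow> real^'m^'d"
    and S :: "(real^'m) set"
    and \<theta>s h g :: "real^'m"
    and \<sigma> :: real
    and k l :: nat
  assumes "prob_space M"
    and "A \<in> borel_measurable M"
    and "\<sigma> > 0"
    and "C2_full_dim_submanifold S"
    and "\<theta>s \<in> interior S"
    and "condition_R M A S"
    and "condition_Q M A S \<theta>s"
    and "1 \<le> k" and "1 \<le> l"
    and "enat k \<le> r_loc M A S \<theta>s" and "enat l \<le> r_loc M A S \<theta>s"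
    and "h \<in> layer M A S \<theta>s k"
    and "g \<in> layer M A S \<theta>s l"
  shows
    "(k = l \<longrightarrow>
        (\<lambda>\<beta>. h \<bullet> fisher_obs_on M A \<sigma> (class_normal M A S \<theta>s) \<theta>s \<beta> g
              - snr \<sigma> \<beta> ^ k / fact k *
                frobenius k (dmoment M A k \<theta>s h) (dmoment M A k \<theta>s g))
          \<in> O[at_right 0](\<lambda>\<beta>. snr \<sigma> \<beta> ^ (k + 1))) \<and>
     (\<bar>int k - int l\<bar> = 1 \<longrightarrow>
        (\<lambda>\<beta>. h \<bullet> fisher_obs_on M A \<sigma> (class_normal M A S \<theta>s) \<theta>s \<beta> g)
          \<in> O[at_right 0](\<lambda>\<beta>. snr \<sigma> \<beta> powr (real (k + l + 1) / 2))) \<and>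
     (\<bar>int k - int l\<bar> \<ge> 2 \<longrightarrow>
        (\<lambda>\<beta>. h \<bullet> fisher_obs_on M A \<sigma> (class_normal M A S \<theta>s) \<theta>s \<beta> g)
          \<in> O[at_right 0](\<lambda>\<beta>. snr \<sigma> \<beta> powr (real (k + l + 2) / 2)))"
proof -
  obtain a where "AE z in M. onorm (\<lambda>v. A z *v v) \<le> a"
    using assms(6) unfolding condition_R_def by blast
  then obtain A' where A': "bounded_matrix M A' \<bar>a\<bar>" "AE z in M. A z = A' z"
    using ae_bounded_matrix_version[OF assms(1,2)] by blast
  interpret bounded_matrix M A' "\<bar>a\<bar>" by (rule A'(1))
  \<comment> \<open>\<open>W\<close> is still formed from \<open>A\<close>; only the moment
    derivatives and the Fisher operator are carried over to \<open>A'\<close>.\<close>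
  define W where "W = class_normal M A S \<theta>s"
  have W: "subspace W"
    unfolding W_def class_normal_def by (rule subspace_orthogonal_comp)
  have dm: "dmoment M A = dmoment M A'"
    using moment_cong_AE[OF assms(2) A_measurable A'(2)] by (simp add: dmoment_def[abs_def])
  have "score M A = score M A'" "obs_density M A = obs_density M A'"
    using obs_density_cong_AE[OF assms(2) A_measurable A'(2)] by (simp_all add: score_def[abs_def])
  then have fish: "fisher_obs_on M A = fisher_obs_on M A'"
    by (simp add: fisher_obs_on_def[abs_def] fisher_obs_def[abs_def])
  have h: "h \<in> W" "\<And>j. 1 \<le> j \<Longrightarrow> j < k \<Longrightarrow> dmoment M A' j \<theta>s h = (\<lambda>_. 0)"
    using assms(12) by (auto simp: layer_def filtration_def W_def dm)
  have g: "\<And>j. 1 \<le> j \<Longrightarrow> j < l \<Longrightarrow> dmoment M A' j \<theta>s g = (\<lambda>_. 0)"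
    using assms(13) by (auto simp: layer_def filtration_def dm)
  note expansion = fisher_obs_expansion[OF assms(3,8,9) W h g]
  show ?thesis
    unfolding W_def[symmetric] fish dm
    \<comment> \<open>If the orders differ by one, then \<open>2 * max k l = k + l + 1\<close>; if
      they differ by at least two, then \<open>2 * max k l\<close> is at least
      \<open>k + l + 2\<close>.\<close>
    using expansion(1) expansion(2)[of "k + l + 1"] expansion(2)[of "k + l + 2"] by auto
qed

end
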